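(* Let $u(x,t)$ be a global (weak) solution of $$\begin{cases} u_t+(-\Delta)^s u_t+(-\Delta_g^A)^s u=|u|^{p-1}u, & t>0,\ x\in\Omega,\\ u(x,t)=0, & t>0,\ x\in\mathbb{R}^N\setminus\Omega,\\ u(x,0)=u_0(x), & x\in\Omega.\end{cases}$$ If $W_{A,0}^{s,G}(\Omega,\mathbb{C})\cap H_0^s(\Omega,\mathbb{C})=W_{A,0}^{s,G}(\Omega,\mathbb{C})$, then there exist a function $u^\ast\in\Phi$ and an increasing sequence $\{t_k\}_{k=1}^\infty$ with $t_k\to+\infty$ as $k\to+\infty$ such that $$\lim_{k\to+\infty}\big[u(\cdot,t_k)-u^\ast\big]_{s,G}^A=0.$$
   Context: Setting. $\Omega\subset\mathbb{R}^N$ ($N\ge1$) is a bounded domain with smooth boundary, $A:\mathbb{R}^N\to\mathbb{R}^N$ is a smooth vector field, $s\in(0,1)$. $G$ is an $N$-function: $G(t)=\int_0^t g(\tau)\,d\tau$ for $t\ge0$, where $g$ is positive for $t>0$, right-continuous for $t\ge 0$, non-decreasing, $g(0)=0$, $g(t)\to\infty$ as $t\to\infty$; normalized by $G(1)=1$. Put $q^-=\inf_{t>0}\frac{tg(t)}{G(t)}$, $q^+=\sup_{t>0}\frac{tg(t)}{G(t)}$, and $q^{-\ast}=\frac{Nq^-}{N-sq^-}$ if $sq^-<N$, $q^{-\ast}=\infty$ if $sq^-\ge N$. Standing assumptions. $g$ is differentiable on $(0,\infty)$ with $q^--1\le \frac{tg'(t)}{g(t)}\le q^+-1$ for all $t>0$;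 $0<s<1<q^-\le q^+<p+1<q^{-\ast}$ and $\max\{\frac{tg(t)}{G(t)}-1,1\}<p$ for all $t>0$; $\int_0^1 \frac{G^{-1}(t)}{t^{(N+s)/N}}dt<\infty$ and $\int_1^\infty \frac{G^{-1}(t)}{t^{(N+s)/N}}dt=\infty$; the function $t\mapsto G(\sqrt t)$ is convex. Notation. $\Omega^c=\mathbb{R}^N\setminus\Omega$, $Q=(\mathbb{R}^N\times\mathbb{R}^N)\setminus(\Omega^c\times\Omega^c)$, $d\mu=\frac{dx\,dy}{|x-y|^N}$, $D_su(x,y)=\frac{u(x)-u(y)}{|x-y|^s}$, $D_s^Au(x,y)=\frac{u(x)-e^{i(x-y)\cdot A(\frac{x+y}{2})}u(y)}{|x-y|^s}$. $\|\cdot\|_r$ is the $L^r(\Omega,\mathbb{C})$ norm. $\frac{g(|z|)}{|z|}z:=0$ for $z=0$. Operators: $(-\Delta)^su(x)=2\,\mathrm{P.V.}\int_{\mathbb{R}^N}\frac{u(x)-u(y)}{|x-y|^{N+2s}}dy$, $(-\Delta_g^A)^su(x)=2\,\mathrm{P.V.}\int_{\mathbb{R}^N}\frac{g(|D_s^Au(x,y)|)}{|D_s^Au(x,y)|}D_s^Au(x,y)\frac{dy}{|x-y|^{N+s}}$. Spaces. $H_0^s(\Omega,\mathbb{C})=W_0^{s,2}(\Omega,\mathbb{C})=\{u\in L^2(\Omega,\mathbb{C}): u=0 \text{ in }\Omega^c,\ [u]_{s,2}<\infty\}$, with $[u]_{s,2}^2=\int_Q|D_su|^2d\mu$ and norm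 $\|u\|_{s,2,0}=(\|u\|_2^2+[u]_{s,2}^2)^{1/2}$. $L^G(\Omega,\mathbb{C})$ is the set of measurable $u:\Omega\to\mathbb{C}$ with $\rho_G(u)=\int_\Omega G(|u|)dx<\infty$, with Luxemburg norm $\|u\|_G=\inf\{\lambda>0:\rho_G(u/\lambda)\le1\}$. $W_{A,0}^{s,G}(\Omega,\mathbb{C})=\{u\in L^G(\Omega,\mathbb{C}): u=0\text{ in }\Omega^c,\ \rho_{s,G}^A(u)<\infty\}$, $\rho_{s,G}^A(u)=\int_QG(|D_s^Au|)d\mu$, with norm $\|u\|_{s,G,0}^A=\|u\|_G+[u]_{s,G}^A$, $[u]_{s,G}^A=\inf\{\lambda>0:\rho_{s,G}^A(u/\lambda)\le1\}$. Energy: $J(u)=\rho_{s,G}^A(u)-\frac1{p+1}\int_\Omega|u|^{p+1}dx$, whose derivative is $\langle J'(\psi),\varphi\rangle=\Re\big[\int_Q\frac{g(|D_s^A\psi|)}{|D_s^A\psi|}D_s^A\psi\,\overline{D_s^A\varphi}\,d\mu-\int_\Omega|\psi|^{p-1}\psi\overline\varphi\,dx\big]$. $\Phi$ is the set of solutions of the stationary problem $(-\Delta_g^A)^su=|u|^{p-1}u$ in $\Omega$, $u=0$ in $\mathbb{R}^N\setminus\Omega$, i.e. $\Phi=\{\psi\in W_{A,0}^{s,G}(\Omega,\mathbb{C}):\langle J'(\psi),\varphi\rangle=0\ \ \forall\varphi\in W_{A,0}^{s,G}(\Omega,\mathbb{C})\}$. Weak solution on $[0,T)$, $T\in(0,\infty]$.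 $u\in L^\infty(0,T;W_{A,0}^{s,G}(\Omega,\mathbb{C})\cap H_0^s(\Omega,\mathbb{C}))$ with $u_t\in L^2(0,T;H_0^s(\Omega,\mathbb{C}))$ is a weak solution if $u(x,0)=u_0\in W_{A,0}^{s,G}(\Omega,\mathbb{C})\cap H_0^s(\Omega,\mathbb{C})$ and, for (a.e.) $t\in(0,T)$ and every $\varphi\in W_{A,0}^{s,G}(\Omega,\mathbb{C})\cap H_0^s(\Omega,\mathbb{C})$, $$\Re\Big[\int_\Omega u_t\overline\varphi\,dx+\int_QD_su_t\overline{D_s\varphi}\,d\mu+\int_Q\frac{g(|D_s^Au|)}{|D_s^Au|}D_s^Au\,\overline{D_s^A\varphi}\,d\mu\Big]=\Re\Big[\int_\Omega|u|^{p-1}u\overline\varphi\,dx\Big],$$ and moreover $\int_0^t\|u_\tau\|_{s,2,0}^2d\tau+J(u(t))=J(u_0)$ for $t\in[0,T)$. It is global if $T=\infty$. *)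

theory Defs
  imports "HOL-Analysis.Analysis"
begin

section \<open>Smoothness and domains\<close>

primrec higher_differentiable ::
  "nat \<Rightarrow> ('a::real_normed_vector \<Rightarrow> 'b::real_normed_vector) \<Rightarrow> bool" where
  "higher_differentiable 0 f \<longleftrightarrow> continuous_on UNIV f"
| "higher_differentiable (Suc k) f \<longleftrightarrow>
     (\<forall>x. f differentiable (at x)) \<and>
     (\<forall>v. higher_differentiable k (\<lambda>x. frechet_derivative f (at x) v))"

definition smooth :: "('a::real_normed_vector \<Rightarrow> 'b::real_normed_vector) \<Rightarrow> bool" where
  "smooth f \<longleftrightarrow> (\<forall>k. higher_differentiable k f)"

text \<open>Near each boundary point the set is the region strictly above the graph, in some unit
  direction \<open>\<nu>\<close>, of a smooth function \<open>\<gamma>\<close> on the hyperplane orthogonal to \<open>\<nu>\<close>. Only the values of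
  \<open>\<gamma>\<close> on that hyperplane are used; every smooth function on it extends smoothly to the whole
  space.\<close>

definition smooth_boundary :: "'a::euclidean_space set \<Rightarrow> bool" where
  "smooth_boundary \<Omega> \<longleftrightarrow>
     (\<forall>x0\<in>frontier \<Omega>. \<exists>r>0. \<exists>\<nu> \<gamma>. norm \<nu> = 1 \<and> smooth (\<gamma> :: 'a \<Rightarrow> real) \<and>
        \<Omega> \<inter> ball x0 r = {x \<in> ball x0 r. x \<bullet> \<nu> > \<gamma> (x - (x \<bullet> \<nu>) *\<^sub>R \<nu>)})"

definition bounded_smooth_domain :: "'a::euclidean_space set \<Rightarrow> bool" where
  "bounded_smooth_domain \<Omega> \<longleftrightarrow>
     open \<Omega> \<and> connected \<Omega> \<and> \<Omega> \<noteq> {} \<and> bounded \<Omega> \<and> smooth_boundary \<Omega>"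

section \<open>N-functions\<close>

definition N_density :: "(real \<Rightarrow> real) \<Rightarrow> bool" where
  "N_density g \<longleftrightarrow>
     (\<forall>t>0. g t > 0) \<and> (\<forall>t\<ge>0. continuous (at_right t) g) \<and> mono_on {0..} g \<and>
     g 0 = 0 \<and> filterlim g at_top at_top"

definition N_fun :: "(real \<Rightarrow> real) \<Rightarrow> real \<Rightarrow> real" where
  "N_fun g t = integral {0..t} g"

definition N_fun_inv :: "(real \<Rightarrow> real) \<Rightarrow> real \<Rightarrow> real" where
  "N_fun_inv g = the_inv_into {0..} (N_fun g)"

text \<open>The infimum is over a set of nonnegative reals. The real supremum is meaningful only when the
  quotients are bounded above; where it is used, this is guaranteed by the assumption
  \<open>t * g t / N_fun g t - 1 < p\<close> for all \<open>t > 0\<close>.\<close>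

definition q_minus :: "(real \<Rightarrow> real) \<Rightarrow> real" where
  "q_minus g = (INF t\<in>{0<..}. t * g t / N_fun g t)"

definition q_plus :: "(real \<Rightarrow> real) \<Rightarrow> real" where
  "q_plus g = (SUP t\<in>{0<..}. t * g t / N_fun g t)"

definition critical_exponent :: "nat \<Rightarrow> real \<Rightarrow> real \<Rightarrow> ereal" where
  "critical_exponent N s q =
     (if s * q < real N then ereal (real N * q / (real N - s * q)) else \<infinity>)"

section \<open>Fractional difference quotients and modulars\<close>

text \<open>Functions on \<open>\<Omega>\<close> that vanish outside \<open>\<Omega>\<close> are represented by functions on the whole space, and
  equalities between them are understood almost everywhere. Pairs are integrated against Lebesgue
  measure on the product space, which is complete, so that \<open>(x, y) \<mapsto> u x - u y\<close> is measurable for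
  every Lebesgue measurable \<open>u\<close>. The diagonal is a null set, so the values there do not matter.\<close>

definition Q_set :: "(real^'n) set \<Rightarrow> ((real^'n) \<times> (real^'n)) set" where
  "Q_set \<Omega> = UNIV - (- \<Omega>) \<times> (- \<Omega>)"

definition frac_measure :: "((real^'n) \<times> (real^'n)) measure" where
  "frac_measure = density lebesgue (\<lambda>(x, y). ennreal (1 / norm (x - y) ^ CARD('n)))"

definition Ds :: "real \<Rightarrow> (real^'n \<Rightarrow> complex) \<Rightarrow> (real^'n) \<times> (real^'n) \<Rightarrow> complex" where
  "Ds s u = (\<lambda>(x, y). (u x - u y) / complex_of_real (norm (x - y) powr s))"

definition DsA ::
  "(real^'n \<Rightarrow> real^'n) \<Rightarrow> real \<Rightarrow> (real^'n \<Rightarrow> complex) \<Rightarrow> (real^'n) \<times> (real^'n) \<Rightarrow> complex" where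
  "DsA A s u = (\<lambda>(x, y).
     (u x - exp (\<i> * complex_of_real ((x - y) \<bullet> A ((1/2) *\<^sub>R (x + y)))) * u y)
       / complex_of_real (norm (x - y) powr s))"

definition rho_G :: "(real^'n) set \<Rightarrow> (real \<Rightarrow> real) \<Rightarrow> (real^'n \<Rightarrow> complex) \<Rightarrow> ennreal" where
  "rho_G \<Omega> g u = (\<integral>\<^sup>+x\<in>\<Omega>. ennreal (N_fun g (cmod (u x))) \<partial>lebesgue)"

definition rho_sGA ::
  "(real^'n) set \<Rightarrow> (real^'n \<Rightarrow> real^'n) \<Rightarrow> real \<Rightarrow> (real \<Rightarrow> real) \<Rightarrow> (real^'n \<Rightarrow> complex) \<Rightarrow> ennreal"
  where
  "rho_sGA \<Omega> A s g u =
     (\<integral>\<^sup>+z\<in>Q_set \<Omega>. ennreal (N_fun g (cmod (DsA A s u z))) \<partial>frac_measure)"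

definition L2_sq :: "(real^'n) set \<Rightarrow> (real^'n \<Rightarrow> complex) \<Rightarrow> ennreal" where
  "L2_sq \<Omega> u = (\<integral>\<^sup>+x\<in>\<Omega>. ennreal ((cmod (u x))\<^sup>2) \<partial>lebesgue)"

definition gagliardo_sq :: "(real^'n) set \<Rightarrow> real \<Rightarrow> (real^'n \<Rightarrow> complex) \<Rightarrow> ennreal" where
  "gagliardo_sq \<Omega> s u = (\<integral>\<^sup>+z\<in>Q_set \<Omega>. ennreal ((cmod (Ds s u z))\<^sup>2) \<partial>frac_measure)"

section \<open>Function spaces\<close>

definition vanishes_outside :: "(real^'n) set \<Rightarrow> (real^'n \<Rightarrow> complex) \<Rightarrow> bool" where
  "vanishes_outside \<Omega> u \<longleftrightarrow> (AE x in lebesgue. x \<notin> \<Omega> \<longrightarrow> u x = 0)"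

definition L2_space :: "(real^'n) set \<Rightarrow> (real^'n \<Rightarrow> complex) set" where
  "L2_space \<Omega> = {u. u \<in> borel_measurable (lebesgue_on \<Omega>) \<and> L2_sq \<Omega> u < \<infinity>}"

definition LG_space :: "(real^'n) set \<Rightarrow> (real \<Rightarrow> real) \<Rightarrow> (real^'n \<Rightarrow> complex) set" where
  "LG_space \<Omega> g = {u. u \<in> borel_measurable (lebesgue_on \<Omega>) \<and> rho_G \<Omega> g u < \<infinity>}"

definition H0s_space :: "(real^'n) set \<Rightarrow> real \<Rightarrow> (real^'n \<Rightarrow> complex) set" where
  "H0s_space \<Omega> s = {u \<in> L2_space \<Omega>. vanishes_outside \<Omega> u \<and> gagliardo_sq \<Omega> s u < \<infinity>}"

definition WA0_space ::
  "(real^'n) set \<Rightarrow> (real^'n \<Rightarrow> real^'n) \<Rightarrow> real \<Rightarrow> (real \<Rightarrow> real) \<Rightarrow> (real^'n \<Rightarrow> complex) set" where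
  "WA0_space \<Omega> A s g = {u \<in> LG_space \<Omega> g. vanishes_outside \<Omega> u \<and> rho_sGA \<Omega> A s g u < \<infinity>}"

text \<open>The norms below are real-valued and are only used for elements of the spaces on which they
  are finite.\<close>

definition norm_s2 :: "(real^'n) set \<Rightarrow> real \<Rightarrow> (real^'n \<Rightarrow> complex) \<Rightarrow> real" where
  "norm_s2 \<Omega> s u = sqrt (enn2real (L2_sq \<Omega> u) + enn2real (gagliardo_sq \<Omega> s u))"

definition luxemburg :: "((real^'n \<Rightarrow> complex) \<Rightarrow> ennreal) \<Rightarrow> (real^'n \<Rightarrow> complex) \<Rightarrow> real" where
  "luxemburg \<rho> u = Inf {l. l > 0 \<and> \<rho> (\<lambda>x. u x / complex_of_real l) \<le> 1}"

definition seminorm_sGA ::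
  "(real^'n) set \<Rightarrow> (real^'n \<Rightarrow> real^'n) \<Rightarrow> real \<Rightarrow> (real \<Rightarrow> real) \<Rightarrow> (real^'n \<Rightarrow> complex) \<Rightarrow> real"
  where
  "seminorm_sGA \<Omega> A s g u = luxemburg (rho_sGA \<Omega> A s g) u"

definition norm_sGA ::
  "(real^'n) set \<Rightarrow> (real^'n \<Rightarrow> real^'n) \<Rightarrow> real \<Rightarrow> (real \<Rightarrow> real) \<Rightarrow> (real^'n \<Rightarrow> complex) \<Rightarrow> real"
  where
  "norm_sGA \<Omega> A s g u = luxemburg (rho_G \<Omega> g) u + seminorm_sGA \<Omega> A s g u"

section \<open>Energy and stationary solutions\<close>

text \<open>\<open>flux g z\<close> is \<open>0\<close> at \<open>z = 0\<close> since division by zero is zero.\<close>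

definition flux :: "(real \<Rightarrow> real) \<Rightarrow> complex \<Rightarrow> complex" where
  "flux g z = complex_of_real (g (cmod z) / cmod z) * z"

definition source :: "real \<Rightarrow> complex \<Rightarrow> complex" where
  "source p z = complex_of_real (cmod z powr (p - 1)) * z"

definition energy ::
  "(real^'n) set \<Rightarrow> (real^'n \<Rightarrow> real^'n) \<Rightarrow> real \<Rightarrow> (real \<Rightarrow> real) \<Rightarrow> real \<Rightarrow> (real^'n \<Rightarrow> complex) \<Rightarrow> real"
  where
  "energy \<Omega> A s g p u =
     enn2real (rho_sGA \<Omega> A s g u) - 1 / (p + 1) * (LINT x:\<Omega>|lebesgue. cmod (u x) powr (p + 1))"

definition energy_deriv ::
  "(real^'n) set \<Rightarrow> (real^'n \<Rightarrow> real^'n) \<Rightarrow> real \<Rightarrow> (real \<Rightarrow> real) \<Rightarrow> real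
     \<Rightarrow> (real^'n \<Rightarrow> complex) \<Rightarrow> (real^'n \<Rightarrow> complex) \<Rightarrow> real" where
  "energy_deriv \<Omega> A s g p \<psi> \<phi> =
     Re ((LINT z:Q_set \<Omega>|frac_measure. flux g (DsA A s \<psi> z) * cnj (DsA A s \<phi> z))
         - (LINT x:\<Omega>|lebesgue. source p (\<psi> x) * cnj (\<phi> x)))"

definition stationary_solutions ::
  "(real^'n) set \<Rightarrow> (real^'n \<Rightarrow> real^'n) \<Rightarrow> real \<Rightarrow> (real \<Rightarrow> real) \<Rightarrow> real \<Rightarrow> (real^'n \<Rightarrow> complex) set"
  where
  "stationary_solutions \<Omega> A s g p =
     {\<psi> \<in> WA0_space \<Omega> A s g. \<forall>\<phi>\<in>WA0_space \<Omega> A s g. energy_deriv \<Omega> A s g p \<psi> \<phi> = 0}"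

section \<open>Vector-valued functions of time\<close>

text \<open>A space of functions is given by a carrier \<open>X\<close> and a norm \<open>nrm\<close> on it; measurability is
  strong (Bochner) measurability with respect to that norm.\<close>

definition strongly_measurable_on ::
  "real set \<Rightarrow> ('a \<Rightarrow> complex) set \<Rightarrow> (('a \<Rightarrow> complex) \<Rightarrow> real) \<Rightarrow> (real \<Rightarrow> 'a \<Rightarrow> complex) \<Rightarrow> bool" where
  "strongly_measurable_on I X nrm u \<longleftrightarrow>
     (\<exists>S :: nat \<Rightarrow> real \<Rightarrow> 'a \<Rightarrow> complex.
        (\<forall>k. simple_function (lebesgue_on I) (S k) \<and> S k ` I \<subseteq> X) \<and>
        (AE t in lebesgue_on I. (\<lambda>k. nrm (\<lambda>x. S k t x - u t x)) \<longlonglongrightarrow> 0))"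

definition Linfty_in ::
  "real set \<Rightarrow> ('a \<Rightarrow> complex) set \<Rightarrow> (('a \<Rightarrow> complex) \<Rightarrow> real) \<Rightarrow> (real \<Rightarrow> 'a \<Rightarrow> complex) \<Rightarrow> bool" where
  "Linfty_in I X nrm u \<longleftrightarrow>
     (\<forall>t\<in>I. u t \<in> X) \<and> strongly_measurable_on I X nrm u \<and>
     (\<exists>C. AE t in lebesgue_on I. nrm (u t) \<le> C)"

definition L2_in ::
  "real set \<Rightarrow> ('a \<Rightarrow> complex) set \<Rightarrow> (('a \<Rightarrow> complex) \<Rightarrow> real) \<Rightarrow> (real \<Rightarrow> 'a \<Rightarrow> complex) \<Rightarrow> bool" where
  "L2_in I X nrm u \<longleftrightarrow>
     (\<forall>t\<in>I. u t \<in> X) \<and> strongly_measurable_on I X nrm u \<and>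
     (\<integral>\<^sup>+t\<in>I. ennreal ((nrm (u t))\<^sup>2) \<partial>lebesgue) < \<infinity>"

text \<open>The identity \<open>\<integral> \<eta>' u dt = - \<integral> \<eta> u\<^sub>t dt\<close> of integrals with values in \<open>L\<^sup>2\<close> on \<open>\<Omega>\<close>, for all scalar
  test functions \<open>\<eta>\<close> on \<open>I\<close>, tested against all elements \<open>\<phi>\<close> of that space.\<close>

definition weak_time_derivative ::
  "(real^'n) set \<Rightarrow> real set \<Rightarrow> (real \<Rightarrow> real^'n \<Rightarrow> complex) \<Rightarrow> (real \<Rightarrow> real^'n \<Rightarrow> complex) \<Rightarrow> bool"
  where
  "weak_time_derivative \<Omega> I u ut \<longleftrightarrow>
     (\<forall>\<eta> :: real \<Rightarrow> real. smooth \<eta> \<and> compact (closure {t. \<eta> t \<noteq> 0}) \<and> closure {t. \<eta> t \<noteq> 0} \<subseteq> I \<longrightarrow>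
       (\<forall>\<phi>\<in>L2_space \<Omega>.
          (LINT t:I|lebesgue. complex_of_real (deriv \<eta> t) * (LINT x:\<Omega>|lebesgue. u t x * cnj (\<phi> x)))
          = - (LINT t:I|lebesgue. complex_of_real (\<eta> t) * (LINT x:\<Omega>|lebesgue. ut t x * cnj (\<phi> x)))))"

section \<open>Weak solutions\<close>

text \<open>A function bounded in time with values in the space below, whose time derivative is square
  integrable with values in \<open>H\<^sub>0\<^sup>s\<close>, has a unique representative that is continuous in time with
  values in \<open>H\<^sub>0\<^sup>s\<close>. The initial condition and the values \<open>u t\<close> refer to that representative.\<close>

definition weak_solution ::
  "(real^'n) set \<Rightarrow> (real^'n \<Rightarrow> real^'n) \<Rightarrow> real \<Rightarrow> (real \<Rightarrow> real) \<Rightarrow> real \<Rightarrow> ereal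
     \<Rightarrow> (real^'n \<Rightarrow> complex) \<Rightarrow> (real \<Rightarrow> real^'n \<Rightarrow> complex) \<Rightarrow> bool" where
  "weak_solution \<Omega> A s g p T u0 u \<longleftrightarrow>
    (let H = H0s_space \<Omega> s;
         X = WA0_space \<Omega> A s g \<inter> H;
         I = {t. 0 < t \<and> ereal t < T};
         I0 = {t. 0 \<le> t \<and> ereal t < T}
     in
       Linfty_in I X (\<lambda>v. norm_sGA \<Omega> A s g v + norm_s2 \<Omega> s v) u \<and>
       u0 \<in> X \<and> u 0 \<in> X \<and> (AE x in lebesgue. u 0 x = u0 x) \<and>
       (\<forall>t\<in>I0. ((\<lambda>\<tau>. norm_s2 \<Omega> s (\<lambda>x. u \<tau> x - u t x)) \<longlongrightarrow> 0) (at t within I0)) \<and>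
       (\<exists>ut. L2_in I H (norm_s2 \<Omega> s) ut \<and> weak_time_derivative \<Omega> I u ut \<and>
         (AE t in lebesgue_on I. \<forall>\<phi>\<in>X.
            Re ((LINT x:\<Omega>|lebesgue. ut t x * cnj (\<phi> x))
                + (LINT z:Q_set \<Omega>|frac_measure. Ds s (ut t) z * cnj (Ds s \<phi> z))
                + (LINT z:Q_set \<Omega>|frac_measure. flux g (DsA A s (u t) z) * cnj (DsA A s \<phi> z)))
            = Re (LINT x:\<Omega>|lebesgue. source p (u t x) * cnj (\<phi> x))) \<and>
         (\<forall>t\<in>I0. (LINT \<tau>:{0<..<t}|lebesgue. (norm_s2 \<Omega> s (ut \<tau>))\<^sup>2) + energy \<Omega> A s g p (u t)
                  = energy \<Omega> A s g p u0)))"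

definition global_weak_solution ::
  "(real^'n) set \<Rightarrow> (real^'n \<Rightarrow> real^'n) \<Rightarrow> real \<Rightarrow> (real \<Rightarrow> real) \<Rightarrow> real
     \<Rightarrow> (real^'n \<Rightarrow> complex) \<Rightarrow> (real \<Rightarrow> real^'n \<Rightarrow> complex) \<Rightarrow> bool" where
  "global_weak_solution \<Omega> A s g p u0 u \<longleftrightarrow> weak_solution \<Omega> A s g p \<infinity> u0 u"

end

theory Submission
  imports Defs "HOL-Complex_Analysis.Great_Picard"
begin

text \<open>The time derivative of a global solution is square integrable on \<open>(0, \<infinity>)\<close> with values in
\<open>H\<^sub>0\<^sup>s\<close>. Hence there are times \<open>t\<^sub>k \<rightarrow> \<infinity>\<close> at which the weak equation and the uniform bound
on \<open>u\<close> hold and \<open>u\<^sub>t\<close> has norm at most \<open>1/(k+1)\<close> (\<open>ex_late_good_time\<close>). At such a time the equation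
says that the derivative of the energy at \<open>u(t\<^sub>k)\<close> equals, up to sign, the real part of the \<open>H\<^sub>0\<^sup>s\<close> inner
product with \<open>u\<^sub>t(t\<^sub>k)\<close>. So \<open>u(t\<^sub>k)\<close> is a bounded Palais-Smale sequence, and the theorem is the compactness of
such sequences, \<open>palais_smale\<close>.

A subsequence of it is shown to be Cauchy for the modular of the seminorm. Three facts carry this.

\<^item> Convexity of \<open>G(\<surd>t)\<close> gives a Clarkson type inequality (\<open>lamperti\<close>). Together with the
tangent inequality of the convex function \<open>G(\<bar>z\<bar>)\<close> it yields \<open>flux_monotone\<close>: \<open>G(\<bar>a - b\<bar>)\<close> is
at most a constant times the real part of \<open>flux a - flux b\<close> against the conjugate of \<open>a - b\<close>. Testing
the equations of two members of the sequence with their difference therefore bounds the modular of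
that difference by the two residuals and by the source terms (\<open>modular_diff_le_residual\<close>).

\<^item> Boundedness in \<open>H\<^sub>0\<^sup>s\<close> gives a subsequence that is Cauchy in \<open>L\<^sup>1\<close> (\<open>fractional_rellich\<close>):
averages over small cubes approximate a function well if its Gagliardo seminorm is bounded, and the
averages lie in a finite-dimensional space.

\<^item> The modular controls the \<open>L\<^sup>m\<close> norm for some \<open>m > p + 1\<close> (\<open>subcritical_sobolev\<close>). By the
diamagnetic inequality only the differences \<open>\<bar>u(x)\<bar> - \<bar>u(y)\<bar>\<close> matter, and the decay of the level sets of
\<open>\<bar>u\<bar>\<close> follows by iterating one estimate.

Interpolation turns the \<open>L\<^sup>1\<close> Cauchy property into one in \<open>L\<^bsup>p+1\<^esup>\<close>, which makes the source terms
vanish, and the sequence is Cauchy for the modular. An almost everywhere limit exists along a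
subsequence; by Fatou it lies in the energy space and is the limit in the modular, hence in the
Luxemburg seminorm because \<open>G\<close> has polynomial growth. Finally the derivative of the energy passes
to the limit, so the limit is stationary.\<close>

section \<open>N-functions and the flux\<close>

text \<open>The constants \<open>q\<close> and \<open>p + 1\<close> bound the growth index \<open>t g(t) / G(t)\<close>. The lower one makes \<open>G\<close>
dominate the power \<open>t\<^sup>q\<close> for large \<open>t\<close>, the upper one is the doubling condition.\<close>

locale N_function =
  fixes g :: "real \<Rightarrow> real" and q p :: real
  assumes density: "N_density g"
    and normalized: "N_fun g 1 = 1"
    and isCont_density: "\<And>t. 0 < t \<Longrightarrow> isCont g t"
    and growth_lower: "\<And>t. 0 < t \<Longrightarrow> q * N_fun g t \<le> t * g t"
    and growth_upper: "\<And>t. 0 < t \<Longrightarrow> t * g t \<le> (p + 1) * N_fun g t"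
    and q_pos: "0 < q" and p_pos: "0 < p"
    and convex_sqrt: "convex_on {0..} (\<lambda>t. N_fun g (sqrt t))"
begin

abbreviation G :: "real \<Rightarrow> real" where "G \<equiv> N_fun g"

lemma g_0 [simp]: "g 0 = 0"
  using density by (simp add: N_density_def)

lemma g_pos: "0 < t \<Longrightarrow> 0 < g t"
  using density by (simp add: N_density_def)

lemma g_nonneg: "0 \<le> t \<Longrightarrow> 0 \<le> g t"
  using g_pos[of t] by (cases "t = 0") auto

lemma g_mono: "0 \<le> a \<Longrightarrow> a \<le> b \<Longrightarrow> g a \<le> g b"
  using density by (auto simp: N_density_def mono_on_def)

lemma continuous_on_g: "continuous_on {0..} g"
  unfolding continuous_on_eq_continuous_within
proof
  fix t :: real assume "t \<in> {0..}"
  show "continuous (at t within {0..}) g"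
  proof (cases "t = 0")
    case True
    then show ?thesis
      using density by (simp add: N_density_def at_within_Ici_at_right)
  next
    case False
    with \<open>t \<in> {0..}\<close> show ?thesis
      using continuous_at_imp_continuous_at_within[OF isCont_density[of t]] by simp
  qed
qed

lemma g_integrable: "0 \<le> a \<Longrightarrow> g integrable_on {a..b}"
  by (intro integrable_continuous_interval continuous_on_subset[OF continuous_on_g]) auto

lemma G_0 [simp]: "G 0 = 0"
  by (simp add: N_fun_def)

lemma G_deriv:
  assumes "0 < t" shows "(G has_real_derivative g t) (at t)"
proof -
  have "((\<lambda>x. integral {0..x} g) has_real_derivative g t) (at t within {0..t+1})"
    using assms by (intro integral_has_real_derivative continuous_on_subset[OF continuous_on_g]) auto
  moreover have "at t within {0..t+1} = at t"
    using assms by (intro at_within_interior) auto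
  ultimately show ?thesis
    unfolding N_fun_def[abs_def] by simp
qed

lemma G_diff: "0 \<le> a \<Longrightarrow> a \<le> b \<Longrightarrow> G b - G a = integral {a..b} g"
  using Henstock_Kurzweil_Integration.integral_combine[of 0 a b g] g_integrable[of 0 b]
  by (simp add: N_fun_def)

lemma G_tangent:
  assumes "0 \<le> a" "0 \<le> b" shows "g a * (b - a) \<le> G b - G a"
proof (cases "a \<le> b")
  case True
  have "integral {a..b} (\<lambda>_. g a) \<le> integral {a..b} g"
    using assms by (intro integral_le g_integrable) (auto intro: g_mono)
  with True assms show ?thesis by (simp add: G_diff mult.commute)
next
  case False
  have "integral {b..a} g \<le> integral {b..a} (\<lambda>_. g a)"
    using assms by (intro integral_le g_integrable) (auto intro: g_mono)
  with False assms G_diff[of b a] show ?thesis by (simp add: algebra_simps)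
qed

lemma G_mono: "0 \<le> a \<Longrightarrow> a \<le> b \<Longrightarrow> G a \<le> G b"
  using G_tangent[of a b] mult_nonneg_nonneg[OF g_nonneg[of a], of "b - a"] by linarith

lemma G_nonneg: "0 \<le> t \<Longrightarrow> 0 \<le> G t"
  using G_mono[of 0 t] by simp

lemma G_norm_nonneg [simp]: "0 \<le> G (cmod z)"
  by (simp add: G_nonneg)

lemma continuous_on_G: "continuous_on {0..} G"
proof -
    have "continuous (at t within {0..}) G" if "0 \<le> t" for t
    proof (cases "t = 0")
      case True
      have "continuous_on {0..1} (\<lambda>x. integral {0..x} g)"
        by (intro indefinite_integral_continuous_1 g_integrable) simp
      then have "continuous (at 0 within {0..1}) G"
        by (simp add: continuous_on_eq_continuous_within N_fun_def[abs_def])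
      moreover have "at 0 within {0..1} = at (0::real) within {0..}"
        by (rule at_within_nhd[of _ "{..<1}"]) auto
      ultimately show ?thesis using True by simp
    next
      case False
      with that show ?thesis
        using DERIV_isCont[OF G_deriv[of t]] by (simp add: continuous_at_imp_continuous_at_within)
    qed
    then show ?thesis
      by (simp add: continuous_on_eq_continuous_within)
qed

lemma continuous_on_G_norm: "continuous_on S (\<lambda>z. G (norm z))"
  by (rule continuous_on_compose2[OF continuous_on_G]) (auto intro: continuous_intros)

lemma measurable_G_norm [measurable]:
  "(\<lambda>z::complex. G (cmod z)) \<in> borel_measurable borel"
  by (intro borel_measurable_continuous_onI continuous_on_G_norm)

text \<open>This is Young's inequality for \<open>G\<close> and its conjugate function. The conjugate, evaluated at \<open>g a\<close>, is
\<open>a * g a - G a\<close>, and that is at most \<open>p * G a\<close>.\<close>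

lemma young_inequality: "0 \<le> a \<Longrightarrow> 0 \<le> b \<Longrightarrow> g a * b \<le> G b + p * G a"
  using G_tangent[of a b] growth_upper[of a]
  by (cases "a = 0") (auto simp: algebra_simps G_nonneg)

text \<open>The derivative of \<open>G(t) t\<^sup>-\<^sup>r\<close> has the sign of \<open>t g(t) - r G(t)\<close>. With \<open>r = p + 1\<close> this gives the
doubling property, with \<open>r = q\<close> the lower bound for large arguments.\<close>

lemma G_powr_antimono:
  assumes "0 < a" "a \<le> b"
  shows "G b * b powr -(p+1) \<le> G a * a powr -(p+1)"
proof (rule DERIV_nonpos_imp_nonincreasing[OF assms(2)])
  fix t assume "a \<le> t" "t \<le> b"
  then have t: "0 < t" using assms by simp
  have "((\<lambda>t. G t * t powr -(p+1)) has_real_derivative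
      g t * t powr -(p+1) + (-(p+1) * t powr (-(p+1) - 1)) * G t) (at t)"
    by (rule DERIV_mult[OF G_deriv[OF t] has_real_derivative_powr[OF t]])
  moreover have "g t * t powr -(p+1) + (-(p+1) * t powr (-(p+1) - 1)) * G t
      = t powr (-(p+1) - 1) * (t * g t - (p+1) * G t)"
    using powr_mult_base[of t "-(p+1) - 1"] t by (simp add: algebra_simps flip: mult.assoc)
  moreover have "\<dots> \<le> 0"
    using growth_upper[OF t] by (intro mult_nonneg_nonpos) auto
  ultimately show "\<exists>y. ((\<lambda>t. G t * t powr -(p+1)) has_real_derivative y) (at t) \<and> y \<le> 0"
    by auto
qed

lemma G_powr_mono:
  assumes "0 < a" "a \<le> b"
  shows "G a * a powr -q \<le> G b * b powr -q"
proof (rule DERIV_nonneg_imp_nondecreasing[OF assms(2)])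
  fix t assume "a \<le> t" "t \<le> b"
  then have t: "0 < t" using assms by simp
  have "((\<lambda>t. G t * t powr -q) has_real_derivative
      g t * t powr -q + (-q * t powr (-q - 1)) * G t) (at t)"
    by (rule DERIV_mult[OF G_deriv[OF t] has_real_derivative_powr[OF t]])
  moreover have "g t * t powr -q + (-q * t powr (-q - 1)) * G t
      = t powr (-q - 1) * (t * g t - q * G t)"
    using t by (simp add: algebra_simps powr_diff powr_minus)
  moreover have "0 \<le> \<dots>"
    using growth_lower[OF t] by (intro mult_nonneg_nonneg) auto
  ultimately show "\<exists>y. ((\<lambda>t. G t * t powr -q) has_real_derivative y) (at t) \<and> 0 \<le> y"
    by auto
qed

lemma G_scale:
  assumes "0 \<le> t" "1 \<le> c" shows "G (c * t) \<le> c powr (p+1) * G t"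
proof (cases "t = 0")
  case False
  with assms have t: "0 < t" by simp
  have "G (c*t) * (c*t) powr -(p+1) \<le> G t * t powr -(p+1)"
    using t assms by (intro G_powr_antimono) auto
  then have "G (c*t) * (c*t) powr -(p+1) * (c*t) powr (p+1) \<le> G t * t powr -(p+1) * (c*t) powr (p+1)"
    by (intro mult_right_mono) auto
  then show ?thesis using t assms
    by (simp add: powr_mult powr_minus field_simps flip: powr_add)
qed auto

lemma powr_le_G: "1 \<le> t \<Longrightarrow> t powr q \<le> G t"
  using G_powr_mono[of 1 t] by (simp add: normalized powr_minus field_simps)

lemma G_le_powr: "0 \<le> t \<Longrightarrow> G t \<le> 1 + t powr (p+1)"
  using G_scale[of 1 t] G_mono[of t 1] powr_ge_zero[of t "p+1"]
  by (cases "1 \<le> t") (auto simp: normalized simp del: powr_ge_zero)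

definition doubling :: real where "doubling = 2 powr (p+1)"

lemma doubling_ge_1: "1 \<le> doubling"
  using p_pos by (simp add: doubling_def ge_one_powr_ge_zero)

lemma G_add:
  assumes "0 \<le> a" "0 \<le> b" shows "G (a + b) \<le> doubling * (G a + G b)"
proof -
  have "G (a + b) \<le> G (2 * max a b)"
    using assms by (intro G_mono) auto
  also have "\<dots> \<le> doubling * G (max a b)"
    using assms G_scale[of "max a b" 2] by (simp add: doubling_def)
  also have "\<dots> \<le> doubling * (G a + G b)"
    using assms doubling_ge_1 G_nonneg[of a] G_nonneg[of b] by (intro mult_left_mono) (auto simp: max_def)
  finally show ?thesis .
qed

lemma G_norm_add: "G (norm (a + b)) \<le> doubling * (G (norm a) + G (norm b))"
  using G_mono[of "norm (a + b)" "norm a + norm b"] G_add[of "norm a" "norm b"]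
    norm_triangle_ineq[of a b] by auto

lemma G_norm_diff: "G (norm (a - b)) \<le> doubling * (G (norm a) + G (norm b))"
  using G_norm_add[of a "-b"] by simp

text \<open>A convex function on the half-line that vanishes at 0 is superadditive. For \<open>H(t) = G(\<surd>t)\<close> this
combines with the parallelogram identity.\<close>

lemma lamperti:
  fixes a b :: complex
  shows "G (cmod ((a + b) / 2)) + G (cmod ((a - b) / 2)) \<le> (G (cmod a) + G (cmod b)) / 2"
proof -
  define H where "H t = G (sqrt t)" for t
  have H: "convex_on {0..} H" using convex_sqrt by (simp add: H_def[abs_def])
  have H0: "H 0 = 0" by (simp add: H_def)
  have Hsq: "H ((cmod z)\<^sup>2) = G (cmod z)" for z by (simp add: H_def)
  \<comment> \<open>The point \<open>x\<close> divides the segment from 0 to \<open>x + y\<close>, and \<open>H\<close> vanishes at 0.\<close>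
  have star: "H x * (x + y) \<le> x * H (x + y)" if "0 \<le> x" "0 \<le> y" "0 < x + y" for x y
  proof -
    have "H ((1 - x/(x+y)) *\<^sub>R 0 + (x/(x+y)) *\<^sub>R (x+y)) \<le> (1 - x/(x+y)) * H 0 + (x/(x+y)) * H (x+y)"
      using that by (intro convex_onD[OF H]) auto
    then have "H x \<le> x / (x+y) * H (x+y)" using that H0 by simp
    then show ?thesis using that by (simp add: field_simps)
  qed
  have super: "H x + H y \<le> H (x + y)" if "0 \<le> x" "0 \<le> y" for x y
  proof (cases "x + y = 0")
    case True then show ?thesis using that H0 by (simp add: add_nonneg_eq_0_iff)
  next
    case False
    then have pos: "0 < x + y" using that by simp
    have "(H x + H y) * (x + y) \<le> H (x + y) * (x + y)"
      using star[of x y] star[of y x] that pos by (simp add: algebra_simps)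
    then show ?thesis using pos by simp
  qed
  have par: "(cmod ((a + b) / 2))\<^sup>2 + (cmod ((a - b) / 2))\<^sup>2 = ((cmod a)\<^sup>2 + (cmod b)\<^sup>2) / 2"
    unfolding cmod_power2 by (simp add: field_simps power2_eq_square)
  have "H ((cmod ((a + b) / 2))\<^sup>2) + H ((cmod ((a - b) / 2))\<^sup>2) \<le> H (((cmod a)\<^sup>2 + (cmod b)\<^sup>2) / 2)"
    using super[of "(cmod ((a + b) / 2))\<^sup>2" "(cmod ((a - b) / 2))\<^sup>2"] unfolding par by simp
  also have "\<dots> = H ((1 - 1/2) *\<^sub>R (cmod a)\<^sup>2 + (1/2) *\<^sub>R (cmod b)\<^sup>2)"
    by (simp add: field_simps)
  also have "\<dots> \<le> (1 - 1/2) * H ((cmod a)\<^sup>2) + (1/2) * H ((cmod b)\<^sup>2)"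
    by (intro convex_onD[OF H]) auto
  finally show ?thesis unfolding Hsq by (simp add: field_simps)
qed

text \<open>The flux is the gradient of the convex function \<open>G(\<bar>z\<bar>)\<close> on the plane, so the graph lies above the
tangent plane at \<open>a\<close>.\<close>

lemma flux_tangent: "Re (flux g a * cnj (c - a)) \<le> G (cmod c) - G (cmod a)"
proof (cases "a = 0")
  case True then show ?thesis by (simp add: flux_def)
next
  case False
  have "Re (a * cnj (c - a)) = Re (a * cnj c) - (cmod a)\<^sup>2"
    using cmod_power2[of a] by (simp add: algebra_simps power2_eq_square)
  also have "\<dots> \<le> cmod a * (cmod c - cmod a)"
    using complex_Re_le_cmod[of "a * cnj c"] by (simp add: norm_mult power2_eq_square algebra_simps)
  finally have "Re (a * cnj (c - a)) \<le> cmod a * (cmod c - cmod a)" .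
  then have "g (cmod a) / cmod a * Re (a * cnj (c - a)) \<le> g (cmod a) / cmod a * (cmod a * (cmod c - cmod a))"
    by (intro mult_left_mono) (auto simp: g_nonneg)
  also have "\<dots> = g (cmod a) * (cmod c - cmod a)" using False by simp
  also have "\<dots> \<le> G (cmod c) - G (cmod a)" by (rule G_tangent) auto
  finally show ?thesis by (simp add: flux_def mult.assoc)
qed

text \<open>The tangent planes at \<open>a\<close> and at \<open>b\<close> bound \<open>G\<close> at the midpoint from below, \<open>lamperti\<close> bounds it from
above with a gain of \<open>G(\<bar>a - b\<bar>/2)\<close>.\<close>

lemma flux_strongly_monotone:
  "4 * G (cmod (a - b) / 2) \<le> Re ((flux g a - flux g b) * cnj (a - b))"
proof -
  have "Re (flux g a * cnj ((a + b)/2 - a)) \<le> G (cmod ((a + b)/2)) - G (cmod a)"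
    and "Re (flux g b * cnj ((a + b)/2 - b)) \<le> G (cmod ((a + b)/2)) - G (cmod b)"
    by (rule flux_tangent)+
  moreover have "Re (flux g a * cnj ((a + b)/2 - a)) + Re (flux g b * cnj ((a + b)/2 - b))
      = - Re ((flux g a - flux g b) * cnj (a - b)) / 2"
    by (simp add: field_simps)
  moreover have "cmod ((a - b) / 2) = cmod (a - b) / 2" by (simp add: norm_divide)
  ultimately show ?thesis using lamperti[of a b] by (simp add: field_simps)
qed

lemma flux_monotone:
  "G (cmod (a - b)) \<le> doubling * Re ((flux g a - flux g b) * cnj (a - b))"
proof -
  have "G (cmod (a - b)) \<le> doubling * G (cmod (a - b) / 2)"
    using G_scale[of "cmod (a - b) / 2" 2] by (simp add: doubling_def)
  also have "\<dots> \<le> doubling * Re ((flux g a - flux g b) * cnj (a - b))"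
    using doubling_ge_1 G_nonneg[of "cmod (a - b) / 2"]
    by (intro mult_left_mono order_trans[OF _ flux_strongly_monotone]) auto
  finally show ?thesis .
qed

lemma norm_flux: "cmod (flux g z) = g (cmod z)"
  by (cases "z = 0") (auto simp: flux_def norm_mult norm_divide g_nonneg)

lemma isCont_flux: "isCont (flux g) z"
proof (cases "z = 0")
  case True
  have "continuous_on UNIV (\<lambda>z::complex. g (cmod z))"
    by (rule continuous_on_compose2[OF continuous_on_g]) (auto intro: continuous_intros)
  then have "((\<lambda>z. g (cmod z)) \<longlongrightarrow> g (cmod 0)) (at (0::complex))"
    by (intro isContD) (simp add: continuous_on_eq_continuous_at)
  then have "((\<lambda>z. cmod (flux g z)) \<longlongrightarrow> 0) (at 0)" by (simp add: norm_flux)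
  then have "(flux g \<longlongrightarrow> 0) (at 0)" by (simp add: tendsto_norm_zero_iff)
  then show ?thesis using True by (simp add: isCont_def flux_def)
next
  case False
  have "isCont (\<lambda>z. g (cmod z)) z"
    by (rule isCont_o2[of _ cmod]) (use False isCont_density in \<open>auto intro: continuous_intros\<close>)
  then show ?thesis
    unfolding flux_def[abs_def] using False by (intro continuous_intros) auto
qed

lemma measurable_flux [measurable]: "flux g \<in> borel_measurable borel"
  by (intro borel_measurable_continuous_onI continuous_at_imp_continuous_on) (auto intro: isCont_flux)

end

section \<open>Integration over pairs of points\<close>

text \<open>Lebesgue measure on the product space is the completion of the product measure. Passing to Borel
representatives makes functions of pairs measurable for the product measure itself, where Tonelli's
theorem is available.\<close>

lemma ex_borel_representative:
  fixes u :: "'a::euclidean_space \<Rightarrow> complex"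
  assumes "u \<in> borel_measurable lebesgue"
  obtains v where "v \<in> borel_measurable borel" "AE x in lebesgue. u x = v x"
proof -
  have "(\<lambda>x. Re (u x)) \<in> borel_measurable (completion lborel)" "(\<lambda>x. Im (u x)) \<in> borel_measurable (completion lborel)"
    using assms by auto
  then obtain a b where ab: "a \<in> borel_measurable lborel" "AE x in lborel. Re (u x) = a x"
      "b \<in> borel_measurable lborel" "AE x in lborel. Im (u x) = b x"
    using completion_ex_borel_measurable_real by metis
  show thesis
  proof
    show "(\<lambda>x. Complex (a x) (b x)) \<in> borel_measurable borel"
      using ab unfolding Complex_eq by measurable
    have "AE x in lborel. u x = Complex (a x) (b x)"
      using ab(2,4) by eventually_elim (simp add: complex_eq_iff)
    then show "AE x in lebesgue. u x = Complex (a x) (b x)"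
      by (rule AE_completion)
  qed
qed

lemma AE_lebesgue_pair:
  fixes P :: "'a::euclidean_space \<Rightarrow> bool"
  assumes "AE x in lebesgue. P x"
  shows "AE z in (lebesgue :: ('a \<times> 'a) measure). P (fst z) \<and> P (snd z)"
proof -
  obtain N where N: "N \<in> null_sets lborel" "{x. \<not> P x} \<subseteq> N"
    using assms unfolding AE_completion_iff eventually_ae_filter[of _ lborel] by auto
  then have [measurable]: "N \<in> sets borel" by (auto simp: null_sets_def)
  have ae: "AE x in lborel. x \<notin> N" using N by (intro AE_not_in)
  have "AE z in (lborel \<Otimes>\<^sub>M lborel :: ('a \<times> 'a) measure). fst z \<notin> N \<and> snd z \<notin> N"
  proof (rule lborel_pair.AE_pair_measure)
    show "AE x in lborel. AE y in lborel. fst (x, y) \<notin> N \<and> snd (x, y) \<notin> N"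
      using ae by eventually_elim (use ae in auto)
  qed measurable
  then have "AE z in (lborel :: ('a \<times> 'a) measure). fst z \<notin> N \<and> snd z \<notin> N"
    unfolding lborel_prod .
  then have "AE z in (lborel :: ('a \<times> 'a) measure). P (fst z) \<and> P (snd z)"
    by eventually_elim (use N in auto)
  then show ?thesis by (rule AE_completion)
qed

text \<open>The modulars and forms integrate over the set of pairs with at least one point in the domain.
Restricting the measure to that set once turns them into plain integrals.\<close>

definition pair_measure_on :: "(real^'n) set \<Rightarrow> ((real^'n) \<times> (real^'n)) measure" where
  "pair_measure_on \<Omega> = restrict_space frac_measure (Q_set \<Omega>)"

lemma borel_kernel [measurable]:
  "(\<lambda>z. ennreal (1 / norm (fst z - snd z) ^ CARD('n))) \<in> borel_measurable (borel :: ((real^'n) \<times> (real^'n)) measure)"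
  unfolding borel_prod[symmetric] by measurable

lemma lebesgue_kernel:
  "(\<lambda>z. ennreal (1 / norm (fst z - snd z) ^ CARD('n))) \<in> borel_measurable (lebesgue :: ((real^'n) \<times> (real^'n)) measure)"
  using borel_kernel by (intro measurable_completion) simp

lemma sets_frac_measure [simp]: "sets frac_measure = sets lebesgue"
  and space_frac_measure [simp]: "space frac_measure = UNIV"
  by (simp_all add: frac_measure_def)

lemma sets_Q_set [simp]:
  assumes "open \<Omega>" shows "Q_set \<Omega> \<in> sets borel" and "Q_set \<Omega> \<in> sets lebesgue"
proof -
  have "open (Q_set \<Omega>)"
    unfolding Q_set_def using assms by (intro open_Diff closed_Times) (auto simp: closed_def)
  then show "Q_set \<Omega> \<in> sets borel" "Q_set \<Omega> \<in> sets lebesgue" by auto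
qed

lemma AE_pair_measure_on:
  assumes "open \<Omega>" "AE z in lebesgue. P z"
  shows "AE z in pair_measure_on \<Omega>. P z"
proof -
  have "AE z in frac_measure. P z"
    unfolding frac_measure_def case_prod_beta' using assms(2)
    by (subst AE_density[OF lebesgue_kernel]) auto
  then show ?thesis
    unfolding pair_measure_on_def using assms(1) by (subst AE_restrict_space_iff) auto
qed

lemma AE_pair_measure_on_both:
  assumes "open \<Omega>" "AE x in lebesgue. P x"
  shows "AE z in pair_measure_on \<Omega>. P (fst z) \<and> P (snd z)"
  using assms by (intro AE_pair_measure_on AE_lebesgue_pair)

lemma measurable_pair_measure_on:
  "f \<in> borel_measurable lebesgue \<Longrightarrow> f \<in> borel_measurable (pair_measure_on \<Omega>)"
  unfolding pair_measure_on_def by (intro measurable_restrict_space1) (simp add: frac_measure_def)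

lemma measurable_DsA_borel:
  fixes u :: "real^'n \<Rightarrow> complex"
  assumes [measurable]: "u \<in> borel_measurable borel" and A: "continuous_on UNIV A"
  shows "DsA A s u \<in> borel_measurable borel"
proof -
  have [measurable]: "A \<in> borel_measurable borel"
    by (rule borel_measurable_continuous_onI[OF A])
  have "(\<lambda>z. (u (fst z) - exp (\<i> * complex_of_real ((fst z - snd z) \<bullet> A ((1/2) *\<^sub>R (fst z + snd z)))) * u (snd z))
       / complex_of_real (norm (fst z - snd z) powr s)) \<in> borel_measurable borel"
    unfolding borel_prod[symmetric] by measurable
  then show ?thesis by (simp add: DsA_def case_prod_beta')
qed

lemma AE_DsA_cong:
  fixes u v :: "real^'n \<Rightarrow> complex"
  assumes "AE x in lebesgue. u x = v x"
  shows "AE z in lebesgue. DsA A s u z = DsA A s v z"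
  using AE_lebesgue_pair[OF assms] by eventually_elim (auto simp: DsA_def case_prod_beta')

lemma measurable_DsA_lebesgue:
  fixes u :: "real^'n \<Rightarrow> complex"
  assumes "u \<in> borel_measurable lebesgue" "continuous_on UNIV A"
  shows "DsA A s u \<in> borel_measurable lebesgue"
proof -
  obtain v where v: "v \<in> borel_measurable borel" "AE x in lebesgue. u x = v x"
    using assms(1) by (rule ex_borel_representative)
  have "DsA A s v \<in> borel_measurable (completion lborel)"
    using measurable_DsA_borel[OF v(1) assms(2)] by (intro measurable_completion) simp
  moreover have "AE z in lebesgue. DsA A s v z = DsA A s u z"
    using AE_DsA_cong[OF v(2), of A s] by eventually_elim auto
  ultimately show ?thesis by (rule borel_measurable_AE)
qed

lemma measurable_DsA [measurable]:
  fixes u :: "real^'n \<Rightarrow> complex"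
  assumes "u \<in> borel_measurable lebesgue" "continuous_on UNIV A"
  shows "DsA A s u \<in> borel_measurable (pair_measure_on \<Omega>)"
  using assms by (intro measurable_pair_measure_on measurable_DsA_lebesgue)

lemma DsA_diff: "DsA A s (\<lambda>x. u x - v x) z = DsA A s u z - DsA A s v z"
  by (simp add: DsA_def case_prod_beta' diff_divide_distrib right_diff_distrib)

lemma DsA_divide: "DsA A s (\<lambda>x. u x / c) z = DsA A s u z / c"
  by (simp add: DsA_def case_prod_beta' diff_divide_distrib mult.commute[of c])

lemma Ds_eq_DsA: "Ds s u = DsA (\<lambda>_. 0) s u"
  by (simp add: Ds_def DsA_def)

lemma measurable_Ds [measurable]:
  "u \<in> borel_measurable lebesgue \<Longrightarrow> Ds s u \<in> borel_measurable (pair_measure_on \<Omega>)"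
  unfolding Ds_eq_DsA by (intro measurable_DsA) simp_all

lemma DsA_tendsto:
  assumes "(\<lambda>k. u k (fst z)) \<longlonglongrightarrow> v (fst z)" "(\<lambda>k. u k (snd z)) \<longlonglongrightarrow> v (snd z)"
  shows "(\<lambda>k. DsA A s (u k) z) \<longlonglongrightarrow> DsA A s v z"
proof (cases "norm (fst z - snd z) powr s = 0")
  case False
  then show ?thesis
    unfolding DsA_def case_prod_beta' using assms by (intro tendsto_intros) auto
qed (simp add: DsA_def case_prod_beta')

lemma measurable_of_vanishing:
  fixes u :: "real^'n \<Rightarrow> complex"
  assumes "u \<in> borel_measurable (lebesgue_on \<Omega>)" "vanishes_outside \<Omega> u" "open \<Omega>"
  shows "u \<in> borel_measurable lebesgue"
proof (rule borel_measurable_AE)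
  show "(\<lambda>x. indicator \<Omega> x *\<^sub>R u x) \<in> borel_measurable lebesgue"
    using assms by (subst (asm) borel_measurable_restrict_space_iff) auto
  show "AE x in lebesgue. indicator \<Omega> x *\<^sub>R u x = u x"
    using assms(2) unfolding vanishes_outside_def
    by eventually_elim (auto split: split_indicator)
qed

lemma measurable_lebesgue_on:
  "u \<in> borel_measurable lebesgue \<Longrightarrow> u \<in> borel_measurable (lebesgue_on \<Omega>)"
  by (rule measurable_restrict_space1)

lemma rho_sGA_eq: "open \<Omega> \<Longrightarrow>
  rho_sGA \<Omega> A s g u = (\<integral>\<^sup>+z. ennreal (N_fun g (cmod (DsA A s u z))) \<partial>pair_measure_on \<Omega>)"
  by (simp add: rho_sGA_def pair_measure_on_def nn_integral_restrict_space)

lemma gagliardo_sq_eq: "open \<Omega> \<Longrightarrow>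
  gagliardo_sq \<Omega> s u = (\<integral>\<^sup>+z. ennreal ((cmod (Ds s u z))\<^sup>2) \<partial>pair_measure_on \<Omega>)"
  by (simp add: gagliardo_sq_def pair_measure_on_def nn_integral_restrict_space)

lemma rho_G_eq: "open \<Omega> \<Longrightarrow>
  rho_G \<Omega> g u = (\<integral>\<^sup>+x. ennreal (N_fun g (cmod (u x))) \<partial>lebesgue_on \<Omega>)"
  by (simp add: rho_G_def nn_integral_restrict_space)

lemma L2_sq_eq: "open \<Omega> \<Longrightarrow>
  L2_sq \<Omega> u = (\<integral>\<^sup>+x. ennreal ((cmod (u x))\<^sup>2) \<partial>lebesgue_on \<Omega>)"
  by (simp add: L2_sq_def nn_integral_restrict_space)

lemma LINT_Q_eq: "open \<Omega> \<Longrightarrow>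
  (LINT z:Q_set \<Omega>|frac_measure. f z) = (LINT z|pair_measure_on \<Omega>. f z)"
  for f :: "_ \<Rightarrow> 'b::{banach, second_countable_topology}"
  by (simp add: set_lebesgue_integral_def pair_measure_on_def integral_restrict_space)

lemma LINT_Omega_eq: "open \<Omega> \<Longrightarrow>
  (LINT x:\<Omega>|lebesgue. f x) = (LINT x|lebesgue_on \<Omega>. f x)"
  for f :: "_ \<Rightarrow> 'b::{banach, second_countable_topology}"
  by (simp add: set_lebesgue_integral_def integral_restrict_space)

lemma ex_borel_representative_vanishing:
  fixes u :: "real^'n \<Rightarrow> complex"
  assumes "u \<in> borel_measurable lebesgue" "vanishes_outside \<Omega> u" "open \<Omega>"
  obtains v where "v \<in> borel_measurable borel" "\<And>x. x \<notin> \<Omega> \<Longrightarrow> v x = 0" "AE x in lebesgue. u x = v x"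
proof -
  obtain w where w [measurable]: "w \<in> borel_measurable borel" and uw: "AE x in lebesgue. u x = w x"
    using assms(1) by (rule ex_borel_representative)
  have [measurable]: "\<Omega> \<in> sets borel" using assms(3) by auto
  show thesis
  proof
    show "(\<lambda>x. indicator \<Omega> x *\<^sub>R w x) \<in> borel_measurable borel" by measurable
    show "AE x in lebesgue. u x = indicator \<Omega> x *\<^sub>R w x"
      using uw assms(2)[unfolded vanishes_outside_def]
      by eventually_elim (auto split: split_indicator)
  qed simp
qed

lemma nn_integral_pair_measure_on:
  fixes f :: "(real^'n) \<times> (real^'n) \<Rightarrow> ennreal"
  assumes \<Omega>: "open \<Omega>" and f: "f \<in> borel_measurable borel"
  shows "(\<integral>\<^sup>+z. f z \<partial>pair_measure_on \<Omega>) = (\<integral>\<^sup>+x. \<integral>\<^sup>+y.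
    ennreal (1 / norm (x - y) ^ CARD('n)) * (f (x, y) * indicator (Q_set \<Omega>) (x, y)) \<partial>lborel \<partial>lborel)"
proof -
  have [measurable]: "Q_set \<Omega> \<in> sets borel" using \<Omega> by simp
  have [measurable]: "f \<in> borel_measurable lebesgue" "Q_set \<Omega> \<in> sets lebesgue"
    using f \<Omega> by (auto intro: measurable_completion[of _ lborel])
  have meas: "(\<lambda>z. ennreal (1 / norm (fst z - snd z) ^ CARD('n)) * (f z * indicator (Q_set \<Omega>) z))
      \<in> borel_measurable (lborel \<Otimes>\<^sub>M lborel)"
    using f borel_kernel[where 'n='n] unfolding lborel_prod by measurable
  have "(\<integral>\<^sup>+z. f z \<partial>pair_measure_on \<Omega>) = (\<integral>\<^sup>+z. f z * indicator (Q_set \<Omega>) z \<partial>frac_measure)"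
    using \<Omega> by (simp add: pair_measure_on_def nn_integral_restrict_space)
  also have "\<dots> = (\<integral>\<^sup>+z. ennreal (1 / norm (fst z - snd z) ^ CARD('n)) * (f z * indicator (Q_set \<Omega>) z) \<partial>lebesgue)"
    unfolding frac_measure_def case_prod_beta' by (subst nn_integral_density[OF lebesgue_kernel]) auto
  also have "\<dots> = (\<integral>\<^sup>+z. ennreal (1 / norm (fst z - snd z) ^ CARD('n)) * (f z * indicator (Q_set \<Omega>) z) \<partial>(lborel \<Otimes>\<^sub>M lborel))"
    by (simp add: nn_integral_completion lborel_prod)
  also have "\<dots> = (\<integral>\<^sup>+x. \<integral>\<^sup>+y. ennreal (1 / norm (x - y) ^ CARD('n)) * (f (x, y) * indicator (Q_set \<Omega>) (x, y)) \<partial>lborel \<partial>lborel)"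
    using lborel.nn_integral_fst[OF meas] by simp
  finally show ?thesis .
qed

section \<open>Modulars and Luxemburg norms\<close>

lemma measurable_cnj [measurable]: "cnj \<in> borel_measurable borel"
  by (intro borel_measurable_continuous_onI continuous_intros)

context N_function
begin

lemma G_scale_down:
  assumes "0 \<le> t" "1 \<le> c" shows "G (t / c) \<le> G t / c powr q"
proof (cases "t = 0")
  case False
  with assms have t: "0 < t" by simp
  have "G (t/c) * (t/c) powr -q \<le> G t * t powr -q"
    using t assms by (intro G_powr_mono) (auto simp: divide_le_eq mult_le_cancel_left1)
  then have "G (t/c) * (t/c) powr -q * t powr q \<le> G t * t powr -q * t powr q"
    by (intro mult_right_mono) auto
  then show ?thesis using t assms
    by (simp add: powr_divide powr_minus field_simps)
qed auto

lemma integrable_G_iff: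
  assumes [measurable]: "f \<in> borel_measurable M"
  shows "integrable M (\<lambda>z. G (cmod (f z))) \<longleftrightarrow> (\<integral>\<^sup>+z. ennreal (G (cmod (f z))) \<partial>M) < \<infinity>"
  by (simp add: integrable_iff_bounded)

lemma nn_integral_G:
  "integrable M (\<lambda>z. G (cmod (f z))) \<Longrightarrow>
    (\<integral>\<^sup>+z. ennreal (G (cmod (f z))) \<partial>M) = ennreal (\<integral>z. G (cmod (f z)) \<partial>M)"
  by (rule nn_integral_eq_integral) auto

lemma integrable_G_diff:
  assumes [measurable]: "f \<in> borel_measurable M" "h \<in> borel_measurable M"
    and "integrable M (\<lambda>z. G (cmod (f z)))" "integrable M (\<lambda>z. G (cmod (h z)))"
  shows "integrable M (\<lambda>z. G (cmod (f z - h z)))"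
proof (rule Bochner_Integration.integrable_bound)
  show "integrable M (\<lambda>z. doubling * (G (cmod (f z)) + G (cmod (h z))))"
    using assms by auto
  show "AE z in M. norm (G (cmod (f z - h z))) \<le> norm (doubling * (G (cmod (f z)) + G (cmod (h z))))"
    by (intro AE_I2) (use G_norm_diff doubling_ge_1 in auto)
qed measurable

lemma norm_flux_mult_le: "norm (flux g a * cnj b) \<le> G (cmod b) + p * G (cmod a)"
  using young_inequality[of "cmod a" "cmod b"] by (simp add: norm_mult norm_flux)

lemma integrable_flux_mult:
  assumes [measurable]: "f \<in> borel_measurable M" "h \<in> borel_measurable M"
    and "integrable M (\<lambda>z. G (cmod (f z)))" "integrable M (\<lambda>z. G (cmod (h z)))"
  shows "integrable M (\<lambda>z. flux g (f z) * cnj (h z))"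
proof (rule Bochner_Integration.integrable_bound)
  show "integrable M (\<lambda>z. G (cmod (h z)) + p * G (cmod (f z)))"
    using assms by auto
  show "AE z in M. norm (flux g (f z) * cnj (h z)) \<le> norm (G (cmod (h z)) + p * G (cmod (f z)))"
    by (intro AE_I2 order_trans[OF norm_flux_mult_le]) simp
qed measurable

lemma nn_integral_le_modular:
  assumes int: "integrable M (\<lambda>z. G (cmod (f z)))"
    and "0 \<le> c" and le: "\<And>z. b z \<le> c * G (cmod (f z))"
  shows "(\<integral>\<^sup>+z. ennreal (b z) \<partial>M) \<le> ennreal (c * (\<integral>z. G (cmod (f z)) \<partial>M))"
proof -
  have "(\<integral>\<^sup>+z. ennreal (b z) \<partial>M) \<le> (\<integral>\<^sup>+z. ennreal (c * G (cmod (f z))) \<partial>M)"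
    using le by (intro nn_integral_mono ennreal_leI)
  also have "\<dots> = ennreal (\<integral>z. c * G (cmod (f z)) \<partial>M)"
    using int \<open>0 \<le> c\<close> by (intro nn_integral_eq_integral) auto
  finally show ?thesis by simp
qed

text \<open>The norm of \<open>L\<^sup>G\<close> and the seminorm built on difference quotients are both Luxemburg functionals of
a modular of the form \<open>\<integral> G(\<bar>f\<bar>)\<close>, with \<open>f\<close> the function itself or its difference quotient. Both
are treated at once: dividing the function \<open>w\<close> by a number divides \<open>f\<close> by the same number.\<close>

context
  fixes \<rho> :: "('b \<Rightarrow> complex) \<Rightarrow> ennreal" and w :: "'b \<Rightarrow> complex"
    and M :: "'c measure" and f :: "'c \<Rightarrow> complex"
  assumes f: "f \<in> borel_measurable M"
    and int: "integrable M (\<lambda>z. G (cmod (f z)))"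
    and \<rho>: "\<And>l. 0 < l \<Longrightarrow> \<rho> (\<lambda>x. w x / complex_of_real l) = (\<integral>\<^sup>+z. ennreal (G (cmod (f z / complex_of_real l))) \<partial>M)"
begin

text \<open>Division by a number \<open>l \<ge> 1\<close> reduces the modular at least by the factor \<open>l\<^sup>q\<close>. Hence the infimum
that defines the Luxemburg norm is taken over a nonempty set.\<close>

lemma modular_divide_le_one_if_large: "\<exists>l>0. \<rho> (\<lambda>x. w x / complex_of_real l) \<le> 1"
proof -
  define I where "I = (\<integral>z. G (cmod (f z)) \<partial>M)"
  have I: "0 \<le> I" by (simp add: I_def)
  define l where "l = (1 + I) powr (1 / q)"
  have l: "1 \<le> l" "l powr q = 1 + I"
    using I q_pos by (auto simp: l_def powr_powr ge_one_powr_ge_zero)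
  have "(\<integral>\<^sup>+z. ennreal (G (cmod (f z / complex_of_real l))) \<partial>M) \<le> ennreal (1 / (1 + I) * I)"
    unfolding I_def
    by (rule nn_integral_le_modular[OF int])
       (use I l G_scale_down[of _ l] in \<open>auto simp: I_def norm_divide\<close>)
  also have "\<dots> \<le> 1" using I by (simp add: ennreal_le_1)
  finally show ?thesis using \<rho>[of l] l by (intro exI[of _ l]) auto
qed

lemma luxemburg_nonneg: "0 \<le> Inf {l. l > 0 \<and> \<rho> (\<lambda>x. w x / complex_of_real l) \<le> 1}"
  using modular_divide_le_one_if_large by (intro cInf_greatest) auto

lemma modular_le_of_luxemburg_less:
  assumes "Inf {l. l > 0 \<and> \<rho> (\<lambda>x. w x / complex_of_real l) \<le> 1} < C"
  shows "(\<integral>z. G (cmod (f z)) \<partial>M) \<le> max 1 C powr (p + 1)"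
proof -
  obtain l where l: "0 < l" "l < C" "\<rho> (\<lambda>x. w x / complex_of_real l) \<le> 1"
    using cInf_lessD[OF _ assms] modular_divide_le_one_if_large by auto
  define c where "c = max 1 C"
  have c: "1 \<le> c" "l < c" using l by (auto simp: c_def)
  have "ennreal (\<integral>z. G (cmod (f z)) \<partial>M) = (\<integral>\<^sup>+z. ennreal (G (cmod (f z))) \<partial>M)"
    using nn_integral_G[OF int] by simp
  also have "\<dots> \<le> (\<integral>\<^sup>+z. ennreal (c powr (p+1)) * ennreal (G (cmod (f z / complex_of_real l))) \<partial>M)"
  proof (intro nn_integral_mono)
    fix z
    have "G (cmod (f z)) \<le> G (c * cmod (f z / complex_of_real l))"
      using l c by (intro G_mono) (auto simp: norm_divide field_simps intro!: mult_right_mono)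
    also have "\<dots> \<le> c powr (p+1) * G (cmod (f z / complex_of_real l))"
      using c by (intro G_scale) auto
    finally show "ennreal (G (cmod (f z))) \<le> ennreal (c powr (p+1)) * ennreal (G (cmod (f z / complex_of_real l)))"
      by (simp flip: ennreal_mult add: ennreal_leI)
  qed
  also have "\<dots> = ennreal (c powr (p+1)) * (\<integral>\<^sup>+z. ennreal (G (cmod (f z / complex_of_real l))) \<partial>M)"
    using f by (intro nn_integral_cmult measurable_compose[OF _ measurable_G_norm] borel_measurable_divide) auto
  also have "\<dots> \<le> ennreal (c powr (p+1)) * 1"
    using l \<rho>[of l] by (intro mult_left_mono) auto
  finally show ?thesis by (simp add: c_def)
qed

lemma luxemburg_le_of_modular:
  assumes "0 < l" "l \<le> 1" "(\<integral>z. G (cmod (f z)) \<partial>M) \<le> l powr (p + 1)"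
  shows "Inf {l. l > 0 \<and> \<rho> (\<lambda>x. w x / complex_of_real l) \<le> 1} \<le> l"
proof (rule cInf_lower)
  have "(\<integral>\<^sup>+z. ennreal (G (cmod (f z / complex_of_real l))) \<partial>M)
      \<le> ennreal ((1 / l) powr (p+1) * (\<integral>z. G (cmod (f z)) \<partial>M))"
    by (rule nn_integral_le_modular[OF int])
       (use assms G_scale[of _ "1 / l"] in \<open>auto simp: norm_divide\<close>)
  also have "\<dots> \<le> ennreal ((1 / l) powr (p+1) * l powr (p + 1))"
    using assms by (intro ennreal_leI mult_left_mono) auto
  also have "\<dots> = 1" using assms by (simp flip: powr_mult)
  finally show "l \<in> {l. l > 0 \<and> \<rho> (\<lambda>x. w x / complex_of_real l) \<le> 1}"
    using assms \<rho>[of l] by simp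
  show "bdd_below {l. l > 0 \<and> \<rho> (\<lambda>x. w x / complex_of_real l) \<le> 1}"
    by (rule bdd_belowI[of _ 0]) auto
qed

end

end

section \<open>A subcritical Sobolev inequality\<close>

text \<open>The exponent \<open>r\<close> is a subsolution of \<open>r = q + r \<theta>\<close>, so a bound \<open>a k \<le> K 2\<^bsup>- k r\<^esup>\<close> reproduces itself
as soon as \<open>K\<^sup>1\<^sup>-\<^sup>\<theta> \<ge> B 2\<^sup>r\<close>.\<close>

lemma iterate_level_estimate:
  fixes a :: "nat \<Rightarrow> real"
  assumes a: "\<And>k. 0 \<le> a k" and "a 0 \<le> V" and \<theta>: "0 \<le> \<theta>" "\<theta> < 1" and r: "r * (1 - \<theta>) \<le> q"
    and B: "0 \<le> B"
    and step: "\<And>k. a (Suc k) \<le> B * 2 powr (- real k * q) * a k powr \<theta>"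
  shows "a k \<le> max V (max 1 ((B * 2 powr r) powr (1 / (1 - \<theta>)))) * 2 powr (- real k * r)"
proof -
  define K where "K = max V (max 1 ((B * 2 powr r) powr (1 / (1 - \<theta>))))"
  have K: "1 \<le> K" "V \<le> K" by (auto simp: K_def)
  have "(B * 2 powr r) = ((B * 2 powr r) powr (1 / (1 - \<theta>))) powr (1 - \<theta>)"
    using \<theta> B by (simp add: powr_powr)
  also have "\<dots> \<le> K powr (1 - \<theta>)"
    using \<theta> by (intro powr_mono2) (auto simp: K_def)
  finally have "B * 2 powr r * K powr \<theta> \<le> K powr (1 - \<theta>) * K powr \<theta>"
    by (intro mult_right_mono) auto
  also have "\<dots> = K" using K by (simp flip: powr_add)
  finally have BK: "B * 2 powr r * K powr \<theta> \<le> K" .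
  have "a k \<le> K * 2 powr (- real k * r)"
  proof (induction k)
    case 0
    then show ?case using assms(2) K by simp
  next
    case (Suc k)
    have "a k powr \<theta> \<le> (K * 2 powr (- real k * r)) powr \<theta>"
      using Suc a \<theta> by (intro powr_mono2) auto
    also have "\<dots> = K powr \<theta> * 2 powr (- real k * r * \<theta>)"
      using K by (simp add: powr_mult powr_powr)
    finally have "a (Suc k) \<le> B * 2 powr (- real k * q) * (K powr \<theta> * 2 powr (- real k * r * \<theta>))"
      using B by (intro order_trans[OF step] mult_left_mono) auto
    also have "\<dots> = B * K powr \<theta> * 2 powr (- real k * (q + r * \<theta>))"
      by (simp add: algebra_simps flip: powr_add)
    also have "\<dots> \<le> B * K powr \<theta> * 2 powr (- real k * r)"
    proof (rule mult_left_mono, rule powr_mono)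
      have "r \<le> q + r * \<theta>" using r by (simp add: algebra_simps)
      then show "- real k * (q + r * \<theta>) \<le> - real k * r"
        by (simp add: mult_left_mono)
    qed (use B in auto)
    also have "\<dots> = (B * 2 powr r * K powr \<theta>) * 2 powr (- real (Suc k) * r)"
      by (simp add: algebra_simps flip: powr_add)
    also have "\<dots> \<le> K * 2 powr (- real (Suc k) * r)"
      using BK by (intro mult_right_mono) auto
    finally show ?case .
  qed
  then show ?thesis by (simp add: K_def)
qed

text \<open>The magnetic phase has modulus one and disappears in the reverse triangle inequality.\<close>

lemma diamagnetic:
  "\<bar>cmod (v x) - cmod (v y)\<bar> / norm (x - y) powr s \<le> cmod (DsA A s v (x, y))"
proof -
  let ?e = "exp (\<i> * complex_of_real ((x - y) \<bullet> A ((1/2) *\<^sub>R (x + y))))"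
  have "cmod (?e * v y) = cmod (v y)" by (simp add: norm_mult norm_exp_eq_Re)
  then have "\<bar>cmod (v x) - cmod (v y)\<bar> \<le> cmod (v x - ?e * v y)"
    using norm_triangle_ineq3[of "v x" "?e * v y"] by simp
  then show ?thesis by (simp add: DsA_def norm_divide divide_right_mono)
qed

context N_function
begin

text \<open>Let \<open>x\<close> have \<open>\<bar>v x\<bar> > 2\<kappa>\<close>. A ball around \<open>x\<close> with twice the volume of the level set
\<open>{\<bar>v\<bar> > \<kappa>}\<close> has at least half of its volume outside that set, and at the points \<open>y\<close> there
\<open>\<bar>v\<bar>\<close> differs from \<open>\<bar>v x\<bar>\<close> by at least \<open>\<kappa>\<close>. Integrating the energy density over these pairs
only gives the estimate. The radius of the ball is at most \<open>R\<close>, and the lower bound on \<open>\<kappa>\<close>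
ensures that the difference quotients are at least 1, where \<open>G(t) \<ge> t\<^sup>q\<close>.\<close>

lemma level_set_estimate:
  fixes v :: "real^'n \<Rightarrow> complex"
  assumes v [measurable]: "v \<in> borel_measurable borel" and v0: "\<And>x. x \<notin> \<Omega> \<Longrightarrow> v x = 0"
    and \<Omega>: "open \<Omega>" "bounded \<Omega>" and A: "continuous_on UNIV A" and "0 < s"
    and M: "(\<integral>\<^sup>+z. ennreal (G (cmod (DsA A s v z))) \<partial>pair_measure_on \<Omega>) \<le> ennreal M" "0 \<le> M"
  defines "\<omega> \<equiv> unit_ball_vol (real CARD('n))"
  defines "R \<equiv> (2 * measure lborel \<Omega> / \<omega>) powr (1 / real CARD('n))"
  assumes \<kappa>: "R powr s \<le> \<kappa>" "0 < \<kappa>"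
  shows "measure lborel {x. 2 * \<kappa> < cmod (v x)} \<le>
    2 * M / \<omega> * \<kappa> powr (-q) * (2 * measure lborel {x. \<kappa> < cmod (v x)} / \<omega>) powr (s * q / real CARD('n))"
proof -
  define N where "N = real CARD('n)"
  have N: "0 < N" by (simp add: N_def)
  have \<omega>: "0 < \<omega>" by (simp add: \<omega>_def)
  define E where "E t = {x. t < cmod (v x)}" for t
  define a where "a = measure lborel (E \<kappa>)"
  define a2 where "a2 = measure lborel (E (2 * \<kappa>))"
  have [measurable]: "E t \<in> sets borel" for t unfolding E_def by measurable
  have \<Omega>_fin: "emeasure lborel \<Omega> < \<infinity>" using \<Omega>(2) by (rule emeasure_bounded_finite)
  have E_sub: "E t \<subseteq> \<Omega>" if "0 \<le> t" for t using v0 that by (force simp: E_def)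
  have E_fin: "emeasure lborel (E t) < \<infinity>" if "0 \<le> t" for t
    using emeasure_mono[OF E_sub[OF that], of lborel] \<Omega>_fin \<Omega>(1) by (auto intro: le_less_trans)
  have E2_sub: "E (2 * \<kappa>) \<subseteq> E \<kappa>" using \<kappa> by (auto simp: E_def)
  have a2_le: "a2 \<le> a" unfolding a_def a2_def
    using E_fin[of \<kappa>] \<kappa> by (intro measure_mono_fmeasurable E2_sub) (auto simp: fmeasurable_def)
  have a_le: "a \<le> measure lborel \<Omega>" unfolding a_def
    using \<kappa> \<Omega>_fin \<Omega>(1) by (intro measure_mono_fmeasurable E_sub) (auto simp: fmeasurable_def)
  show ?thesis
  proof (cases "a = 0")
    case True
    then have "a2 = 0" using a2_le by (simp add: a2_def measure_le_0_iff)
    then show ?thesis using M(2) \<omega> by (simp add: a2_def E_def)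
  next
    case False
    then have a: "0 < a" by (simp add: a_def zero_less_measure_iff)
    define \<rho> where "\<rho> = (2 * a / \<omega>) powr (1 / N)"
    have \<rho>: "0 < \<rho>" using a \<omega> by (simp add: \<rho>_def)
    have "\<rho> powr N = 2 * a / \<omega>" using N a \<omega> by (simp add: \<rho>_def powr_powr)
    then have \<rho>N: "\<omega> * \<rho> ^ CARD('n) = 2 * a"
      using \<rho> \<omega> by (simp add: N_def powr_realpow)
    have "\<rho> \<le> R" unfolding \<rho>_def R_def N_def
      using a_le a \<omega> by (intro powr_mono2) (auto intro!: divide_right_mono)
    then have \<rho>s: "\<rho> powr s \<le> \<kappa>"
      using \<rho> \<open>0 < s\<close> \<kappa> powr_mono2[of s \<rho> R] by simp
    define c where "c = 1 / \<rho> ^ CARD('n) * G (\<kappa> / \<rho> powr s)"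
    have c: "0 \<le> c" unfolding c_def using \<rho> \<kappa> by (simp add: G_nonneg)
    define F where "F x y = ennreal (1 / norm (x - y) ^ CARD('n))
      * (ennreal (G (cmod (DsA A s v (x, y)))) * indicator (Q_set \<Omega>) (x, y))" for x y
    have low: "ennreal c * indicator (ball x \<rho> - E \<kappa>) y \<le> F x y" if x: "x \<in> E (2 * \<kappa>)" for x y
    proof (cases "y \<in> ball x \<rho> - E \<kappa>")
      case True
      then have xy: "norm (x - y) < \<rho>" "y \<notin> E \<kappa>" by (auto simp: dist_norm)
      then have "x \<noteq> y" using x E2_sub by auto
      then have pos: "0 < norm (x - y)" by simp
      have Q: "(x, y) \<in> Q_set \<Omega>" using x E_sub[of "2 * \<kappa>"] \<kappa> by (auto simp: Q_set_def)
      have "\<kappa> / \<rho> powr s \<le> \<bar>cmod (v x) - cmod (v y)\<bar> / norm (x - y) powr s"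
        using x xy pos \<rho> \<open>0 < s\<close> \<kappa> by (intro frac_le powr_mono2) (auto simp: E_def)
      also have "\<dots> \<le> cmod (DsA A s v (x, y))" by (rule diamagnetic)
      finally have "G (\<kappa> / \<rho> powr s) \<le> G (cmod (DsA A s v (x, y)))"
        using \<kappa> by (intro G_mono) auto
      moreover have "1 / \<rho> ^ CARD('n) \<le> 1 / norm (x - y) ^ CARD('n)"
        using pos xy \<rho> by (intro divide_left_mono power_mono mult_pos_pos zero_less_power) auto
      ultimately have "c \<le> 1 / norm (x - y) ^ CARD('n) * G (cmod (DsA A s v (x, y)))"
        unfolding c_def using \<rho> \<kappa> by (intro mult_mono) (auto intro: G_nonneg)
      then show ?thesis using True Q by (simp add: F_def ennreal_leI flip: ennreal_mult)
    qed auto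
    \<comment> \<open>The ball has twice the volume of the level set, so at least half of it lies outside.\<close>
    have half: "ennreal a \<le> emeasure lborel (ball x \<rho> - E \<kappa>)" for x :: "real^'n"
    proof -
      have fin: "emeasure lborel (ball x \<rho> - E \<kappa>) < \<infinity>"
        by (intro emeasure_bounded_finite bounded_subset[OF bounded_ball]) auto
      have "ennreal (2 * a) = emeasure lborel (ball x \<rho>)"
        using \<rho> \<rho>N by (simp add: emeasure_ball \<omega>_def)
      also have "\<dots> \<le> emeasure lborel ((ball x \<rho> - E \<kappa>) \<union> E \<kappa>)"
        by (intro emeasure_mono) auto
      also have "\<dots> \<le> emeasure lborel (ball x \<rho> - E \<kappa>) + emeasure lborel (E \<kappa>)"
        by (intro emeasure_subadditive) auto
      also have "\<dots> = ennreal (measure lborel (ball x \<rho> - E \<kappa>) + a)"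
        using fin E_fin[of \<kappa>] \<kappa> by (simp add: a_def emeasure_eq_ennreal_measure)
      finally have "a \<le> measure lborel (ball x \<rho> - E \<kappa>)"
        by (subst (asm) ennreal_le_iff) (use a in \<open>auto intro: add_nonneg_nonneg\<close>)
      then show ?thesis
        using fin by (subst emeasure_eq_ennreal_measure) (auto intro: ennreal_leI)
    qed
    have inner: "ennreal (c * a) * indicator (E (2 * \<kappa>)) x \<le> (\<integral>\<^sup>+y. F x y \<partial>lborel)" for x
    proof (cases "x \<in> E (2 * \<kappa>)")
      case True
      have "ennreal (c * a) \<le> ennreal c * emeasure lborel (ball x \<rho> - E \<kappa>)"
        using half[of x] c a by (simp add: ennreal_mult mult_left_mono)
      also have "\<dots> = (\<integral>\<^sup>+y. ennreal c * indicator (ball x \<rho> - E \<kappa>) y \<partial>lborel)"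
        by (rule nn_integral_cmult_indicator[symmetric]) simp
      also have "\<dots> \<le> (\<integral>\<^sup>+y. F x y \<partial>lborel)" by (intro nn_integral_mono low[OF True])
      finally show ?thesis using True by simp
    qed simp
    have "ennreal (c * (a * a2)) = (\<integral>\<^sup>+x. ennreal (c * a) * indicator (E (2 * \<kappa>)) x \<partial>lborel)"
      using E_fin[of "2 * \<kappa>"] \<kappa> a c
      by (subst nn_integral_cmult_indicator) (auto simp: a2_def ennreal_mult emeasure_eq_ennreal_measure mult.assoc)
    also have "\<dots> \<le> (\<integral>\<^sup>+x. \<integral>\<^sup>+y. F x y \<partial>lborel \<partial>lborel)" by (intro nn_integral_mono inner)
    also have "\<dots> = (\<integral>\<^sup>+z. ennreal (G (cmod (DsA A s v z))) \<partial>pair_measure_on \<Omega>)"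
      unfolding F_def
      by (rule nn_integral_pair_measure_on[symmetric, OF \<Omega>(1)]) (use measurable_DsA_borel[OF v A] in measurable)
    also have "\<dots> \<le> ennreal M" by (rule M)
    finally have "c * (a * a2) \<le> M" using M(2) by simp
    moreover have "c * (a * a2) = \<omega> / 2 * G (\<kappa> / \<rho> powr s) * a2"
      unfolding c_def using \<rho> \<rho>N a \<omega> by (simp add: field_simps)
    moreover have "(\<kappa> / \<rho> powr s) powr q \<le> G (\<kappa> / \<rho> powr s)"
      using \<rho> \<rho>s \<kappa> by (intro powr_le_G) auto
    then have "\<omega> / 2 * (\<kappa> / \<rho> powr s) powr q * a2 \<le> \<omega> / 2 * G (\<kappa> / \<rho> powr s) * a2"
      using \<omega> by (intro mult_left_mono mult_right_mono) (auto simp: a2_def)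
    ultimately have "\<omega> / 2 * (\<kappa> / \<rho> powr s) powr q * a2 \<le> M" by simp
    moreover have "(\<kappa> / \<rho> powr s) powr q = \<kappa> powr q / \<rho> powr (s * q)"
      using \<rho> \<kappa> by (simp add: powr_divide powr_powr)
    ultimately have "a2 \<le> 2 * M / \<omega> * \<kappa> powr (-q) * \<rho> powr (s * q)"
      using \<omega> \<rho> \<kappa> by (simp add: powr_minus field_simps)
    moreover have "\<rho> powr (s * q) = (2 * a / \<omega>) powr (s * q / N)"
      using a \<omega> by (simp add: \<rho>_def powr_powr mult.commute)
    ultimately show ?thesis by (simp add: a2_def a_def E_def N_def)
  qed
qed

end

text \<open>For \<open>s q < N\<close> the choice \<open>\<theta> = s q / N\<close> turns \<open>r = q / (1 - \<theta>)\<close> into the critical exponent. Otherwise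
every \<open>\<theta> < 1\<close> is possible, and \<open>r\<close> is as large as desired.\<close>

lemma subcritical_exponents:
  assumes "ereal (p + 1) < critical_exponent N s q" "0 < N" "0 < s" "0 < q" "0 < p"
  obtains \<theta> r where "0 \<le> \<theta>" "\<theta> < 1" "\<theta> \<le> s * q / real N" "p + 1 < r" "r * (1 - \<theta>) \<le> q"
proof (cases "s * q < real N")
  case True
  with assms have "p + 1 < real N * q / (real N - s * q)"
    by (simp add: critical_exponent_def)
  moreover have "real N * q / (real N - s * q) * (1 - s * q / real N) = q"
    using assms True by (simp add: field_simps)
  ultimately show thesis
    using True assms by (intro that[of "s * q / real N" "real N * q / (real N - s * q)"]) auto
next
  case False
  then have "1 \<le> s * q / real N" using assms by simp
  moreover define \<theta> where "\<theta> = max 0 (1 - q / (p + 2))"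
  have "0 \<le> \<theta>" "\<theta> < 1" "1 - \<theta> \<le> q / (p + 2)"
    using assms by (auto simp: \<theta>_def)
  moreover from this assms have "(p + 2) * (1 - \<theta>) \<le> q"
    by (simp add: field_simps)
  ultimately show thesis
    by (intro that[of \<theta> "p + 2"]) auto
qed

text \<open>For \<open>t > \<kappa>\<close> a single term of the sum suffices, that of the largest \<open>k\<close> with \<open>2\<^sup>k \<kappa> < t\<close>.\<close>

lemma powr_le_dyadic_sum:
  fixes t \<kappa> m :: real
  assumes "0 \<le> t" "0 < \<kappa>" "0 \<le> m"
  shows "ennreal (t powr m) \<le> ennreal (\<kappa> powr m)
      + (\<Sum>k. ennreal ((2 ^ Suc k * \<kappa>) powr m) * indicator {2 ^ k * \<kappa><..} t)"
proof (cases "t \<le> \<kappa>")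
  case True
  then have "t powr m \<le> \<kappa> powr m" using assms by (intro powr_mono2) auto
  then show ?thesis by (intro add_increasing2 ennreal_leI) auto
next
  case False
  define j where "j = (LEAST j. t \<le> 2 ^ j * \<kappa>)"
  obtain n where "t / \<kappa> < 2 ^ n" using real_arch_pow[of 2 "t / \<kappa>"] by auto
  then have "t \<le> 2 ^ n * \<kappa>" using assms by (simp add: field_simps)
  then have j: "t \<le> 2 ^ j * \<kappa>" unfolding j_def by (rule LeastI)
  then have "j \<noteq> 0" using False by (cases j) auto
  then obtain k where k: "j = Suc k" by (cases j) auto
  then have "\<not> t \<le> 2 ^ k * \<kappa>" using not_less_Least[of k "\<lambda>j. t \<le> 2 ^ j * \<kappa>"] by (auto simp: j_def)
  then have ind: "indicator {2 ^ k * \<kappa><..} t = (1 :: ennreal)" by simp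
  have "t powr m \<le> (2 ^ Suc k * \<kappa>) powr m" using assms j k by (intro powr_mono2) auto
  then have "ennreal (t powr m) \<le> ennreal ((2 ^ Suc k * \<kappa>) powr m) * indicator {2 ^ k * \<kappa><..} t"
    using ind by (simp add: ennreal_leI)
  also have "\<dots> \<le> (\<Sum>k. ennreal ((2 ^ Suc k * \<kappa>) powr m) * indicator {2 ^ k * \<kappa><..} t)"
  proof -
    define f where "f k = ennreal ((2 ^ Suc k * \<kappa>) powr m) * indicator {2 ^ k * \<kappa><..} t" for k
    have "sum f {k} \<le> suminf f" by (intro sum_le_suminf summableI) auto
    then have "f k \<le> suminf f" by simp
    then show ?thesis unfolding f_def[abs_def] .
  qed
  finally show ?thesis by (intro add_increasing) auto
qed

text \<open>The volumes \<open>a k\<close> of the level sets at heights \<open>2\<^sup>k \<kappa>\<close> satisfy the recursion of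
\<open>iterate_level_estimate\<close>, so they decay like \<open>2\<^bsup>- k r\<^esup>\<close> with some \<open>r > p + 1\<close>. This is a weak
\<open>L\<^sup>r\<close> bound, and on a set of finite measure it controls the \<open>L\<^sup>m\<close> norm for every \<open>m < r\<close>.\<close>

lemma (in N_function) subcritical_sobolev:
  fixes \<Omega> :: "(real^'n) set" and A :: "real^'n \<Rightarrow> real^'n"
  assumes \<Omega>: "open \<Omega>" "bounded \<Omega>" and A: "continuous_on UNIV A" and s: "0 < s"
    and crit: "ereal (p + 1) < critical_exponent CARD('n) s q"
  obtains m C where "p + 1 < m" "\<And>M. 0 \<le> C M"
    "\<And>M u. \<lbrakk>0 \<le> M; u \<in> borel_measurable lebesgue; vanishes_outside \<Omega> u;
        (\<integral>\<^sup>+z. ennreal (G (cmod (DsA A s u z))) \<partial>pair_measure_on \<Omega>) \<le> ennreal M\<rbrakk>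
      \<Longrightarrow> (\<integral>\<^sup>+x. ennreal (cmod (u x) powr m) \<partial>lebesgue_on \<Omega>) \<le> ennreal (C M)"
proof -
  obtain \<theta> r where \<theta>: "0 \<le> \<theta>" "\<theta> < 1" "\<theta> \<le> s * q / real CARD('n)" and r: "p + 1 < r" "r * (1 - \<theta>) \<le> q"
    using subcritical_exponents[OF crit _ s q_pos p_pos] by auto
  define m where "m = (p + 1 + r) / 2"
  have m: "p + 1 < m" "m < r" "0 < m" using r p_pos by (auto simp: m_def)
  define V where "V = measure lborel \<Omega>"
  define \<omega> where "\<omega> = unit_ball_vol (real CARD('n))"
  have \<omega>: "0 < \<omega>" by (simp add: \<omega>_def)
  define \<sigma> where "\<sigma> = s * q / real CARD('n)"
  \<comment> \<open>The first height must be admissible in \<open>level_set_estimate\<close>; being at least 1, it drops out of the recursion.\<close>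
  define \<kappa> where "\<kappa> = max 1 (((2 * V / \<omega>) powr (1 / real CARD('n))) powr s)"
  have \<kappa>: "1 \<le> \<kappa>" "((2 * V / \<omega>) powr (1 / real CARD('n))) powr s \<le> \<kappa>" by (auto simp: \<kappa>_def)
  define B where "B M = 2 * M / \<omega> * ((2 / \<omega>) powr \<sigma> * V powr (\<sigma> - \<theta>))" for M
  define K where "K M = max V (max 1 ((B M * 2 powr r) powr (1 / (1 - \<theta>))))" for M
  have K: "1 \<le> K M" for M by (auto simp: K_def)
  define x where "x = 2 powr (m - r)"
  have x: "0 < x" "x < 1" using m by (auto simp: x_def powr_less_one)
  define C where "C M = \<kappa> powr m * V + (2 * \<kappa>) powr m * K M * (1 / (1 - x))" for M
  have V0: "0 \<le> V" by (simp add: V_def)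
  have \<Omega>_fin: "emeasure lborel \<Omega> < \<infinity>" using \<Omega>(2) by (rule emeasure_bounded_finite)
  have [measurable]: "\<Omega> \<in> sets borel" using \<Omega> by auto
  show thesis
  proof (rule that[OF m(1)])
    show "0 \<le> C M" for M
      using V0 K[of M] x by (auto simp: C_def)
  next
    fix M u
    assume M: "0 \<le> M" and u: "u \<in> borel_measurable lebesgue" "vanishes_outside \<Omega> u"
      and energy: "(\<integral>\<^sup>+z. ennreal (G (cmod (DsA A s u z))) \<partial>pair_measure_on \<Omega>) \<le> ennreal M"
    obtain v where v [measurable]: "v \<in> borel_measurable borel" and v0: "\<And>x. x \<notin> \<Omega> \<Longrightarrow> v x = 0"
      and uv: "AE x in lebesgue. u x = v x"
      using ex_borel_representative_vanishing[OF u \<Omega>(1)] by metis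
    have "(\<integral>\<^sup>+z. ennreal (G (cmod (DsA A s v z))) \<partial>pair_measure_on \<Omega>)
        = (\<integral>\<^sup>+z. ennreal (G (cmod (DsA A s u z))) \<partial>pair_measure_on \<Omega>)"
      by (rule nn_integral_cong_AE, rule eventually_mono[OF AE_pair_measure_on[OF \<Omega>(1) AE_DsA_cong[OF uv, of A s]]]) simp
    then have Mv: "(\<integral>\<^sup>+z. ennreal (G (cmod (DsA A s v z))) \<partial>pair_measure_on \<Omega>) \<le> ennreal M"
      using energy by simp
    define a where "a k = measure lborel {x. 2 ^ k * \<kappa> < cmod (v x)}" for k :: nat
    have sub: "{x. 2 ^ k * \<kappa> < cmod (v x)} \<subseteq> \<Omega>" for k
    proof
      fix x assume "x \<in> {x. 2 ^ k * \<kappa> < cmod (v x)}"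
      moreover have "0 \<le> 2 ^ k * \<kappa>" using \<kappa> by simp
      ultimately have "v x \<noteq> 0" by auto
      then show "x \<in> \<Omega>" using v0 by blast
    qed
    have a_le: "a k \<le> V" for k
      unfolding a_def V_def using \<Omega>_fin by (intro measure_mono_fmeasurable sub) (auto simp: fmeasurable_def)
    have a0: "0 \<le> a k" for k by (simp add: a_def)
    have step: "a (Suc k) \<le> B M * 2 powr (- real k * q) * a k powr \<theta>" for k
    proof -
      have two: "(1::real) \<le> 2 ^ k" by simp
      then have k1: "\<kappa> \<le> 2 ^ k * \<kappa>" using \<kappa> mult_right_mono[OF two, of \<kappa>] by simp
      have "a (Suc k) \<le> 2 * M / \<omega> * (2 ^ k * \<kappa>) powr (-q) * (2 * a k / \<omega>) powr \<sigma>"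
        using level_set_estimate[OF v v0 \<Omega> A s Mv M, of "2 ^ k * \<kappa>", folded V_def \<omega>_def,
            OF _ order_trans[OF \<kappa>(2) k1]] \<kappa>
        by (simp add: a_def \<sigma>_def mult.assoc)
      \<comment> \<open>The exponent \<open>\<sigma>\<close> may be 1 or more; the bound by the volume of the domain lowers it to \<open>\<theta>\<close>.\<close>
      also have "\<dots> \<le> 2 * M / \<omega> * (2 powr (- real k * q)) * ((2 / \<omega>) powr \<sigma> * (V powr (\<sigma> - \<theta>) * a k powr \<theta>))"
      proof (intro mult_mono)
        have "(2 ^ k * \<kappa>) powr (-q) \<le> (2 ^ k) powr (-q)"
          using q_pos k1 \<kappa> mult_left_mono[of 1 \<kappa> "2 ^ k"] by (intro powr_mono2') auto
        also have "\<dots> = 2 powr (- real k * q)"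
          by (simp add: powr_powr flip: powr_realpow)
        finally show "(2 ^ k * \<kappa>) powr (-q) \<le> 2 powr (- real k * q)" .
        show "(2 * a k / \<omega>) powr \<sigma> \<le> (2 / \<omega>) powr \<sigma> * (V powr (\<sigma> - \<theta>) * a k powr \<theta>)"
        proof (cases "a k = 0")
          case False
          then have ak: "0 < a k" using a0[of k] by simp
          have "(2 * a k / \<omega>) powr \<sigma> = ((2 / \<omega>) * a k) powr \<sigma>" by simp
          also have "\<dots> = (2 / \<omega>) powr \<sigma> * (a k powr (\<sigma> - \<theta>) * a k powr \<theta>)"
            using \<omega> ak by (subst powr_mult) (auto simp flip: powr_add)
          also have "\<dots> \<le> (2 / \<omega>) powr \<sigma> * (V powr (\<sigma> - \<theta>) * a k powr \<theta>)"
            using ak a_le \<theta> by (intro mult_left_mono mult_right_mono powr_mono2) (auto simp: \<sigma>_def)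
          finally show ?thesis .
        qed simp
      qed (use M \<omega> in auto)
      finally show ?thesis by (simp add: B_def mult_ac)
    qed
    have aK: "a k \<le> K M * 2 powr (- real k * r)" for k
      unfolding K_def
      by (rule iterate_level_estimate[where q = q]) (use a0 a_le \<theta> r M \<omega> step in \<open>auto simp: B_def\<close>)
    have "(\<integral>\<^sup>+x. ennreal (cmod (u x) powr m) \<partial>lebesgue_on \<Omega>)
        = (\<integral>\<^sup>+x. ennreal (cmod (u x) powr m) * indicator \<Omega> x \<partial>lebesgue)"
      using \<Omega> by (simp add: nn_integral_restrict_space)
    also have "\<dots> = (\<integral>\<^sup>+x. ennreal (cmod (v x) powr m) * indicator \<Omega> x \<partial>lebesgue)"
      by (rule nn_integral_cong_AE, rule eventually_mono[OF uv]) simp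
    also have "\<dots> = (\<integral>\<^sup>+x. ennreal (cmod (v x) powr m) * indicator \<Omega> x \<partial>lborel)"
      by (simp add: nn_integral_completion)
    also have "\<dots> \<le> (\<integral>\<^sup>+x. ennreal (\<kappa> powr m) * indicator \<Omega> x
        + (\<Sum>k. ennreal ((2 ^ Suc k * \<kappa>) powr m) * indicator {x. 2 ^ k * \<kappa> < cmod (v x)} x) \<partial>lborel)"
    proof (intro nn_integral_mono)
      fix x :: "real^'n"
      have "indicator {2 ^ k * \<kappa><..} (cmod (v x)) = (indicator {x. 2 ^ k * \<kappa> < cmod (v x)} x :: ennreal)" for k
        by (simp add: indicator_def)
      then show "ennreal (cmod (v x) powr m) * indicator \<Omega> x \<le> ennreal (\<kappa> powr m) * indicator \<Omega> x
        + (\<Sum>k. ennreal ((2 ^ Suc k * \<kappa>) powr m) * indicator {x. 2 ^ k * \<kappa> < cmod (v x)} x)"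
        using powr_le_dyadic_sum[of "cmod (v x)" \<kappa> m] m \<kappa> by (auto split: split_indicator)
    qed
    also have "\<dots> = ennreal (\<kappa> powr m) * emeasure lborel \<Omega>
        + (\<Sum>k. ennreal ((2 ^ Suc k * \<kappa>) powr m) * emeasure lborel {x. 2 ^ k * \<kappa> < cmod (v x)})"
      by (simp add: nn_integral_add nn_integral_suminf nn_integral_cmult_indicator)
    also have "\<dots> \<le> ennreal (\<kappa> powr m * V) + (\<Sum>k. ennreal ((2 * \<kappa>) powr m * K M * x ^ k))"
    proof (intro add_mono suminf_le summableI)
      show "ennreal (\<kappa> powr m) * emeasure lborel \<Omega> \<le> ennreal (\<kappa> powr m * V)"
        using \<Omega>_fin by (simp add: V_def ennreal_mult emeasure_eq_ennreal_measure)
      fix k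
      have "emeasure lborel {x. 2 ^ k * \<kappa> < cmod (v x)} < \<infinity>"
        using emeasure_mono[OF sub, of lborel k] \<Omega>_fin by (auto intro: le_less_trans)
      then have "ennreal ((2 ^ Suc k * \<kappa>) powr m) * emeasure lborel {x. 2 ^ k * \<kappa> < cmod (v x)}
          = ennreal ((2 ^ Suc k * \<kappa>) powr m * a k)"
        by (simp add: a_def ennreal_mult emeasure_eq_ennreal_measure)
      also have "\<dots> \<le> ennreal ((2 ^ Suc k * \<kappa>) powr m * (K M * 2 powr (- real k * r)))"
        by (intro ennreal_leI mult_left_mono aK) auto
      also have "(2 ^ Suc k * \<kappa>) powr m * (K M * 2 powr (- real k * r))
          = (2 * \<kappa>) powr m * K M * ((2 ^ k) powr m * 2 powr (- real k * r))"
        using \<kappa> by (simp add: powr_mult)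
      also have "(2 ^ k) powr m * 2 powr (- real k * r) = x ^ k"
      proof -
        have "(2 ^ k :: real) powr m = 2 powr (real k * m)" by (simp add: powr_powr flip: powr_realpow)
        then have "(2 ^ k) powr m * 2 powr (- real k * r) = 2 powr (real k * m + - real k * r)"
          by (simp only: powr_add)
        also have "real k * m + - real k * r = (m - r) * real k" by (simp add: algebra_simps)
        also have "2 powr ((m - r) * real k) = x ^ k"
          using x by (simp add: x_def powr_powr flip: powr_realpow)
        finally show ?thesis .
      qed
      finally show "ennreal ((2 ^ Suc k * \<kappa>) powr m) * emeasure lborel {x. 2 ^ k * \<kappa> < cmod (v x)}
          \<le> ennreal ((2 * \<kappa>) powr m * K M * x ^ k)" .
    qed
    also have "(\<Sum>k. ennreal ((2 * \<kappa>) powr m * K M * x ^ k)) = ennreal ((2 * \<kappa>) powr m * K M * (1 / (1 - x)))"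
      using x K[of M] by (intro suminf_ennreal_eq sums_mult geometric_sums) auto
    also have "ennreal (\<kappa> powr m * V) + ennreal ((2 * \<kappa>) powr m * K M * (1 / (1 - x))) = ennreal (C M)"
      unfolding C_def using V0 K[of M] x by (intro ennreal_plus[symmetric]) auto
    finally show "(\<integral>\<^sup>+x. ennreal (cmod (u x) powr m) \<partial>lebesgue_on \<Omega>) \<le> ennreal (C M)" .
  qed
qed

section \<open>Compact embedding into integrable functions\<close>

definition cell :: "real \<Rightarrow> ('n \<Rightarrow> int) \<Rightarrow> (real^'n) set" where
  "cell h z = {x. \<forall>i. \<lfloor>x $ i / h\<rfloor> = z i}"

lemma cell_between_boxes:
  fixes z :: "'n::finite \<Rightarrow> int"
  assumes "0 < h"
  defines "l \<equiv> \<chi> i. h * real_of_int (z i)" and "e \<equiv> \<chi> i. h"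
  shows "box l (l + e) \<subseteq> cell h z" "cell h z \<subseteq> cbox l (l + e)"
proof -
  show "box l (l + e) \<subseteq> cell h z"
    using assms(1) by (auto simp: mem_box_cart cell_def l_def e_def floor_eq_iff field_simps)
      (metis add_less_cancel_left less_eq_real_def)+
  show "cell h z \<subseteq> cbox l (l + e)"
    using assms(1) by (auto simp: mem_box_cart cell_def l_def e_def floor_eq_iff field_simps) (simp add: less_imp_le)
qed

lemma sets_cell [measurable]: "cell h z \<in> sets borel" for z :: "'n::finite \<Rightarrow> int"
proof -
  have "Measurable.pred borel (\<lambda>x :: real^'n. \<forall>i\<in>UNIV. \<lfloor>x $ i / h\<rfloor> = z i)"
    by measurable
  then show ?thesis by (simp add: cell_def pred_def)
qed

lemma emeasure_cell:
  fixes z :: "'n::finite \<Rightarrow> int"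
  assumes h: "0 < h"
  shows "emeasure lborel (cell h z) = ennreal (h ^ CARD('n))"
proof (rule antisym)
  define l e :: "real^'n" where "l = (\<chi> i. h * real_of_int (z i))" and "e = (\<chi> i. h)"
  have eb: "e \<bullet> b = h" if "b \<in> Basis" for b
    using that by (auto simp: Basis_vec_def e_def inner_axis)
  have "emeasure lborel (cell h z) \<le> emeasure lborel (cbox l (l + e))"
    using cell_between_boxes(2)[OF h, of z] by (intro emeasure_mono) (auto simp: l_def e_def)
  also have "\<dots> = ennreal (h ^ CARD('n))"
    using h by (simp add: emeasure_lborel_cbox_eq inner_add_left eb)
  finally show "emeasure lborel (cell h z) \<le> ennreal (h ^ CARD('n))" .
  have "ennreal (h ^ CARD('n)) = emeasure lborel (box l (l + e))"
    using h by (simp add: emeasure_lborel_box_eq inner_add_left eb)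
  also have "\<dots> \<le> emeasure lborel (cell h z)"
    using cell_between_boxes(1)[OF h, of z] by (intro emeasure_mono) (auto simp: l_def e_def)
  finally show "ennreal (h ^ CARD('n)) \<le> emeasure lborel (cell h z)" .
qed

lemma cell_diameter:
  fixes x y :: "real^'n"
  assumes "0 < h" "x \<in> cell h z" "y \<in> cell h z"
  shows "norm (x - y) \<le> real CARD('n) * h"
proof -
  have "\<bar>(x - y) $ i\<bar> \<le> h" for i
  proof -
    have "real_of_int (z i) \<le> x $ i / h" "x $ i / h \<le> real_of_int (z i) + 1"
      "real_of_int (z i) \<le> y $ i / h" "y $ i / h \<le> real_of_int (z i) + 1"
      using assms by (auto simp: cell_def floor_eq_iff less_imp_le)
    then have "x $ i / h - y $ i / h \<le> 1" "y $ i / h - x $ i / h \<le> 1" by linarith+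
    then show ?thesis using \<open>0 < h\<close> by (auto simp: field_simps abs_le_iff)
  qed
  then have "(\<Sum>i\<in>UNIV. \<bar>(x - y) $ i\<bar>) \<le> (\<Sum>i\<in>(UNIV :: 'n set). h)"
    by (intro sum_mono)
  then show ?thesis using norm_le_l1_cart[of "x - y"] by simp
qed

definition cell_index :: "real \<Rightarrow> real^'n \<Rightarrow> 'n \<Rightarrow> int" where
  "cell_index h x = (\<lambda>i. \<lfloor>x $ i / h\<rfloor>)"

lemma in_cell_index: "x \<in> cell h (cell_index h x)"
  by (simp add: cell_def cell_index_def)

lemma finite_cell_index:
  fixes \<Omega> :: "(real^'n) set"
  assumes "bounded \<Omega>" "0 < h"
  shows "finite (cell_index h ` \<Omega>)"
proof -
  obtain B where B: "\<And>x. x \<in> \<Omega> \<Longrightarrow> norm x \<le> B"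
    using assms(1) by (auto simp: bounded_iff)
  have "cell_index h ` \<Omega> \<subseteq> PiE UNIV (\<lambda>_. {\<lfloor>- B / h\<rfloor>..\<lfloor>B / h\<rfloor>})"
  proof (rule subsetI, elim imageE)
    fix f x assume x: "x \<in> \<Omega>" and f: "f = cell_index h x"
    have "f i \<in> {\<lfloor>- B / h\<rfloor>..\<lfloor>B / h\<rfloor>}" for i
    proof -
      have "\<bar>x $ i\<bar> \<le> B" using B[OF x] component_le_norm_cart[of x i] by linarith
      then have "- B / h \<le> x $ i / h" "x $ i / h \<le> B / h"
        using \<open>0 < h\<close> by (auto simp: field_simps abs_le_iff)
      then show ?thesis unfolding f cell_index_def by (auto intro: floor_mono)
    qed
    then show "f \<in> PiE UNIV (\<lambda>_. {\<lfloor>- B / h\<rfloor>..\<lfloor>B / h\<rfloor>})" by auto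
  qed
  then show ?thesis
    by (rule finite_subset) (auto intro: finite_PiE)
qed

text \<open>On the cell \<open>C\<close> of a point \<open>x\<close>, the value \<open>w x\<close> is the average of \<open>w\<close> plus the average over \<open>y\<close>
of \<open>w x - w y\<close>. The weight \<open>\<eta>\<close> splits \<open>\<bar>w x - w y\<bar>\<close> into a small constant and its square. As the
cell has diameter at most \<open>N h\<close>, the square is at most \<open>(N h)\<^bsup>N + 2 s\<^esup>\<close> times the Gagliardo density.
The second term of the bound is of order \<open>h\<^bsup>2 s\<^esup> / \<eta>\<close>, and the third one sees only finitely many
numbers.\<close>

lemma L1_le_gagliardo_plus_cell_averages:
  fixes w :: "real^'n \<Rightarrow> complex"
  assumes w [measurable]: "w \<in> borel_measurable borel" and w0: "\<And>x. x \<notin> \<Omega> \<Longrightarrow> w x = 0"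
    and int: "integrable lborel w"
    and \<Omega>: "open \<Omega>" "bounded \<Omega>" and s: "0 < s" and h: "0 < h" and \<eta>: "0 < \<eta>"
    and K: "gagliardo_sq \<Omega> s w \<le> ennreal K" "0 \<le> K"
  defines "N \<equiv> real CARD('n)"
  shows "(\<integral>x. cmod (w x) \<partial>lborel) \<le> \<eta> / 2 * measure lborel \<Omega>
    + (N * h) powr (N + 2 * s) / (2 * \<eta> * h powr N) * K
    + measure lborel \<Omega> / h powr N * (\<Sum>z\<in>cell_index h ` \<Omega>. cmod (\<integral>x. indicator (cell h z) x *\<^sub>R w x \<partial>lborel))"
proof -
  define V where "V = measure lborel \<Omega>"
  define S where "S = (\<Sum>z\<in>cell_index h ` \<Omega>. cmod (\<integral>x. indicator (cell h z) x *\<^sub>R w x \<partial>lborel))"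
  define c where "c = h powr N"
  define D where "D = (N * h) powr (N + 2 * s)"
  have c: "0 < c" "c = h ^ CARD('n)" using h by (auto simp: c_def N_def powr_realpow)
  have D: "0 \<le> D" by (simp add: D_def)
  have S: "0 \<le> S" by (auto simp: S_def intro: sum_nonneg)
  have [measurable]: "\<Omega> \<in> sets borel" using \<Omega> by auto
  have \<Omega>_fin: "emeasure lborel \<Omega> = ennreal V"
    using emeasure_bounded_finite[OF \<Omega>(2)] by (simp add: V_def emeasure_eq_ennreal_measure)
  define F where "F x y = ennreal (1 / norm (x - y) ^ CARD('n)) * (ennreal ((cmod (Ds s w (x, y)))\<^sup>2) * indicator (Q_set \<Omega>) (x, y))" for x y
  have Ds_meas: "Ds s w \<in> borel_measurable borel"
    unfolding Ds_eq_DsA by (intro measurable_DsA_borel w) simp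
  have F_meas [measurable]: "(\<lambda>(x, y). F x y) \<in> borel_measurable (borel \<Otimes>\<^sub>M borel)"
  proof -
    have [measurable]: "Q_set \<Omega> \<in> sets (borel :: ((real^'n) \<times> (real^'n)) measure)" using \<Omega> by simp
    have "(\<lambda>z. ennreal (1 / norm (fst z - snd z) ^ CARD('n)) * (ennreal ((cmod (Ds s w z))\<^sup>2) * indicator (Q_set \<Omega>) z)) \<in> borel_measurable borel"
      using borel_kernel[where 'n='n] Ds_meas by measurable
    then show ?thesis by (simp add: F_def case_prod_beta' borel_prod)
  qed
  have F_int: "(\<integral>\<^sup>+x. \<integral>\<^sup>+y. F x y \<partial>lborel \<partial>lborel) = gagliardo_sq \<Omega> s w"
    unfolding F_def gagliardo_sq_eq[OF \<Omega>(1)]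
    by (rule nn_integral_pair_measure_on[symmetric, OF \<Omega>(1)]) (use Ds_meas in measurable)
  have cell_int: "integrable lborel (\<lambda>y. indicator (cell h z) y *\<^sub>R w y)" for z
    using int by (intro integrable_mult_indicator) auto
  have ind_int: "integrable lborel (\<lambda>y. indicator (cell h z) y *\<^sub>R (b :: complex))" for z b
    using h by (intro integrable_scaleR_left) (auto simp: integrable_indicator_iff emeasure_cell)
  have point: "ennreal (cmod (w x)) \<le> ennreal (\<eta> / 2 + S / c) * indicator \<Omega> x
      + ennreal (D / (2 * \<eta> * c)) * (\<integral>\<^sup>+y. F x y \<partial>lborel)" for x
  proof (cases "x \<in> \<Omega>")
    case True
    define z where "z = cell_index h x"
    define I where "I = (\<integral>y. indicator (cell h z) y *\<^sub>R w y \<partial>lborel)"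
    have xz: "x \<in> cell h z" by (simp add: z_def in_cell_index)
    have "(\<integral>y. indicator (cell h z) y *\<^sub>R (w x - w y) \<partial>lborel)
        = (\<integral>y. indicator (cell h z) y *\<^sub>R w x \<partial>lborel) - I"
      unfolding I_def scaleR_diff_right by (rule Bochner_Integration.integral_diff[OF ind_int cell_int])
    also have "(\<integral>y. indicator (cell h z) y *\<^sub>R w x \<partial>lborel) = complex_of_real c * w x"
      using h by (simp add: measure_def emeasure_cell c scaleR_conv_of_real)
    finally have eq: "complex_of_real c * w x = (\<integral>y. indicator (cell h z) y *\<^sub>R (w x - w y) \<partial>lborel) + I"
      by simp
    have IS: "cmod I \<le> S"
      unfolding I_def S_def using finite_cell_index[OF \<Omega>(2) h] True
      by (intro member_le_sum) (auto simp: z_def)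
    have split_difference: "ennreal (norm (indicator (cell h z) y *\<^sub>R (w x - w y))) \<le>
        ennreal (\<eta> / 2) * indicator (cell h z) y + ennreal (D / (2 * \<eta>)) * F x y" for y
    proof (cases "y \<in> cell h z \<and> y \<noteq> x")
      case True
      then have d: "0 < norm (x - y)" "norm (x - y) \<le> N * h"
        using cell_diameter[OF h xz, of y] by (auto simp: N_def)
      define b where "b = cmod (w x - w y)"
      have "0 \<le> (b - \<eta>)\<^sup>2 / (2 * \<eta>)" using \<eta> by simp
      then have "b \<le> \<eta> / 2 + b\<^sup>2 / (2 * \<eta>)" using \<eta> by (simp add: power2_eq_square field_simps)
      also have "b\<^sup>2 / (2 * \<eta>) \<le> D / (2 * \<eta>) * (1 / norm (x - y) ^ CARD('n) * (cmod (Ds s w (x, y)))\<^sup>2)"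
      proof -
        have "norm (x - y) powr (N + 2 * s) \<le> D"
          unfolding D_def using d s by (intro powr_mono2) (auto simp: N_def)
        moreover have "norm (x - y) powr (N + 2 * s) = norm (x - y) ^ CARD('n) * (norm (x - y) powr s)\<^sup>2"
        proof -
          have "2 * s = s + s" by simp
          then have "norm (x - y) powr (2 * s) = (norm (x - y) powr s)\<^sup>2"
            by (simp only: powr_add power2_eq_square)
          then show ?thesis using d by (simp only: powr_add N_def powr_realpow)
        qed
        ultimately have le: "norm (x - y) ^ CARD('n) * (norm (x - y) powr s)\<^sup>2 \<le> D" by simp
        have pos: "0 < norm (x - y) ^ CARD('n) * (norm (x - y) powr s)\<^sup>2" using d by simp
        have "b\<^sup>2 = (norm (x - y) ^ CARD('n) * (norm (x - y) powr s)\<^sup>2) * (b\<^sup>2 / (norm (x - y) ^ CARD('n) * (norm (x - y) powr s)\<^sup>2))"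
          using pos d by simp
        also have "\<dots> \<le> D * (b\<^sup>2 / (norm (x - y) ^ CARD('n) * (norm (x - y) powr s)\<^sup>2))"
          using le by (intro mult_right_mono) auto
        also have "b\<^sup>2 / (norm (x - y) ^ CARD('n) * (norm (x - y) powr s)\<^sup>2)
            = 1 / norm (x - y) ^ CARD('n) * (cmod (Ds s w (x, y)))\<^sup>2"
          by (simp add: Ds_def b_def norm_divide power_divide)
        finally have "b\<^sup>2 / (2 * \<eta>) \<le> D * (1 / norm (x - y) ^ CARD('n) * (cmod (Ds s w (x, y)))\<^sup>2) / (2 * \<eta>)"
          using \<eta> by (intro divide_right_mono) auto
        then show ?thesis by (simp add: mult.commute)
      qed
      finally have "b \<le> \<eta> / 2 + D / (2 * \<eta>) * (1 / norm (x - y) ^ CARD('n) * (cmod (Ds s w (x, y)))\<^sup>2)" by simp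
      then have "ennreal b \<le> ennreal (\<eta> / 2 + D / (2 * \<eta>) * (1 / norm (x - y) ^ CARD('n) * (cmod (Ds s w (x, y)))\<^sup>2))"
        by (rule ennreal_leI)
      also have "\<dots> = ennreal (\<eta> / 2) + ennreal (D / (2 * \<eta>)) * F x y"
      proof -
        have "(x, y) \<in> Q_set \<Omega>" using \<open>x \<in> \<Omega>\<close> by (simp add: Q_set_def)
        then show ?thesis using \<eta> D by (simp add: F_def flip: ennreal_mult)
      qed
      finally show ?thesis using True by (simp add: b_def)
    qed auto
    have "ennreal (c * cmod (w x)) = ennreal (cmod (complex_of_real c * w x))"
      using c(1) by (simp add: norm_mult)
    also have "\<dots> \<le> ennreal (cmod (\<integral>y. indicator (cell h z) y *\<^sub>R (w x - w y) \<partial>lborel)) + ennreal S"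
      unfolding eq using IS S norm_triangle_ineq[of "\<integral>y. indicator (cell h z) y *\<^sub>R (w x - w y) \<partial>lborel" I]
      by (subst ennreal_plus[symmetric]) (auto intro!: ennreal_leI simp del: ennreal_plus)
    also have "\<dots> \<le> (\<integral>\<^sup>+y. ennreal (norm (indicator (cell h z) y *\<^sub>R (w x - w y))) \<partial>lborel) + ennreal S"
      unfolding scaleR_diff_right
      by (intro add_right_mono integral_norm_bound_ennreal Bochner_Integration.integrable_diff ind_int cell_int)
    also have "\<dots> \<le> (\<integral>\<^sup>+y. ennreal (\<eta> / 2) * indicator (cell h z) y + ennreal (D / (2 * \<eta>)) * F x y \<partial>lborel) + ennreal S"
      by (intro add_right_mono nn_integral_mono split_difference)
    also have "\<dots> = ennreal (\<eta> / 2) * ennreal c + ennreal (D / (2 * \<eta>)) * (\<integral>\<^sup>+y. F x y \<partial>lborel) + ennreal S"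
      using h by (simp add: nn_integral_add nn_integral_cmult nn_integral_cmult_indicator emeasure_cell c)
    finally have "ennreal (1 / c) * ennreal (c * cmod (w x)) \<le> ennreal (1 / c) *
        (ennreal (\<eta> / 2) * ennreal c + ennreal (D / (2 * \<eta>)) * (\<integral>\<^sup>+y. F x y \<partial>lborel) + ennreal S)"
      by (intro mult_left_mono) auto
    also have "\<dots> = ennreal (\<eta> / 2 + S / c) + ennreal (D / (2 * \<eta> * c)) * (\<integral>\<^sup>+y. F x y \<partial>lborel)"
    proof -
      have "ennreal (1 / c) * ennreal (\<eta> / 2) * ennreal c = ennreal (\<eta> / 2)"
        using c(1) \<eta> by (simp flip: ennreal_mult)
      moreover have "ennreal (1 / c) * ennreal (D / (2 * \<eta>)) = ennreal (D / (2 * \<eta> * c))"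
        using c(1) \<eta> D by (simp flip: ennreal_mult add: field_simps)
      moreover have "ennreal (1 / c) * ennreal S = ennreal (S / c)"
        using c(1) S by (simp flip: ennreal_mult)
      moreover have "ennreal (\<eta> / 2 + S / c) = ennreal (\<eta> / 2) + ennreal (S / c)"
        using c(1) S \<eta> by (intro ennreal_plus) auto
      ultimately show ?thesis
        by (simp only: distrib_left add_ac flip: mult.assoc)
    qed
    also have "ennreal (1 / c) * ennreal (c * cmod (w x)) = ennreal (cmod (w x))"
      using c(1) by (simp flip: ennreal_mult)
    finally show ?thesis using True by simp
  qed (simp add: w0)
  have "ennreal (\<integral>x. cmod (w x) \<partial>lborel) = (\<integral>\<^sup>+x. ennreal (cmod (w x)) \<partial>lborel)"
    using int by (intro nn_integral_eq_integral[symmetric]) auto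
  also have "\<dots> \<le> (\<integral>\<^sup>+x. ennreal (\<eta> / 2 + S / c) * indicator \<Omega> x
      + ennreal (D / (2 * \<eta> * c)) * (\<integral>\<^sup>+y. F x y \<partial>lborel) \<partial>lborel)"
    by (intro nn_integral_mono point)
  also have "\<dots> = ennreal (\<eta> / 2 + S / c) * ennreal V + ennreal (D / (2 * \<eta> * c)) * gagliardo_sq \<Omega> s w"
    by (simp add: nn_integral_add nn_integral_cmult nn_integral_cmult_indicator \<Omega>_fin F_int)
  also have "\<dots> \<le> ennreal (\<eta> / 2 + S / c) * ennreal V + ennreal (D / (2 * \<eta> * c)) * ennreal K"
    by (intro add_left_mono mult_left_mono K) auto
  also have "\<dots> = ennreal ((\<eta> / 2 + S / c) * V + D / (2 * \<eta> * c) * K)"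
    using \<eta> c(1) S D K by (simp add: V_def ennreal_mult[symmetric] ennreal_plus[symmetric] del: ennreal_plus)
  finally have "(\<integral>x. cmod (w x) \<partial>lborel) \<le> (\<eta> / 2 + S / c) * V + D / (2 * \<eta> * c) * K"
    using \<eta> c(1) S D K by (subst (asm) ennreal_le_iff) (auto simp: V_def)
  also have "\<dots> = \<eta> / 2 * V + D / (2 * \<eta> * c) * K + V / c * S"
    by (simp add: algebra_simps)
  finally show ?thesis unfolding V_def S_def c_def D_def .
qed

lemma nn_integral_norm_diff_squared_le:
  fixes f h :: "'a \<Rightarrow> complex"
  assumes [measurable]: "f \<in> borel_measurable M" "h \<in> borel_measurable M"
  shows "(\<integral>\<^sup>+x. ennreal ((cmod (f x - h x))\<^sup>2) \<partial>M)
    \<le> 2 * (\<integral>\<^sup>+x. ennreal ((cmod (f x))\<^sup>2) \<partial>M) + 2 * (\<integral>\<^sup>+x. ennreal ((cmod (h x))\<^sup>2) \<partial>M)"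
proof -
  have "ennreal ((cmod (a - b))\<^sup>2) \<le> 2 * ennreal ((cmod a)\<^sup>2) + 2 * ennreal ((cmod b)\<^sup>2)" for a b
  proof -
    have "(cmod (a - b))\<^sup>2 \<le> (cmod a + cmod b)\<^sup>2"
      by (intro power_mono norm_triangle_ineq4) auto
    also have "\<dots> \<le> 2 * (cmod a)\<^sup>2 + 2 * (cmod b)\<^sup>2"
      using zero_le_power2[of "cmod a - cmod b"] by (simp add: power2_eq_square algebra_simps)
    finally have "ennreal ((cmod (a - b))\<^sup>2) \<le> ennreal (2 * (cmod a)\<^sup>2 + 2 * (cmod b)\<^sup>2)"
      by (rule ennreal_leI)
    then show ?thesis by (simp add: ennreal_mult)
  qed
  then have "(\<integral>\<^sup>+x. ennreal ((cmod (f x - h x))\<^sup>2) \<partial>M)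
      \<le> (\<integral>\<^sup>+x. 2 * ennreal ((cmod (f x))\<^sup>2) + 2 * ennreal ((cmod (h x))\<^sup>2) \<partial>M)"
    by (intro nn_integral_mono)
  then show ?thesis by (simp add: nn_integral_add nn_integral_cmult)
qed

lemma gagliardo_sq_diff_le:
  assumes "open \<Omega>" "u \<in> borel_measurable lebesgue" "v \<in> borel_measurable lebesgue"
  shows "gagliardo_sq \<Omega> s (\<lambda>x. u x - v x) \<le> 2 * gagliardo_sq \<Omega> s u + 2 * gagliardo_sq \<Omega> s v"
  using nn_integral_norm_diff_squared_le[OF measurable_Ds[OF assms(2)] measurable_Ds[OF assms(3)]] assms(1)
  by (simp add: gagliardo_sq_eq Ds_eq_DsA DsA_diff)

lemma gagliardo_sq_cong:
  assumes "open \<Omega>" "AE x in lebesgue. u x = v x"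
  shows "gagliardo_sq \<Omega> s u = gagliardo_sq \<Omega> s v"
  unfolding gagliardo_sq_eq[OF assms(1)] Ds_eq_DsA
  by (rule nn_integral_cong_AE, rule eventually_mono[OF AE_pair_measure_on[OF assms(1) AE_DsA_cong[OF assms(2), of "\<lambda>_. 0" s]]]) simp

text \<open>The integrals over the countably many cells of side \<open>1/(i+1)\<close> are bounded, so a diagonal subsequence
makes all of them converge. In \<open>L1_le_gagliardo_plus_cell_averages\<close>, applied to differences, first
\<open>\<eta>\<close> and then the side is chosen small; for these, the sum over the finitely many cells that meet
the domain tends to 0.\<close>

lemma fractional_rellich:
  fixes u :: "nat \<Rightarrow> real^'n \<Rightarrow> complex"
  assumes \<Omega>: "open \<Omega>" "bounded \<Omega>" and s: "0 < s"
    and u: "\<And>k. u k \<in> borel_measurable lebesgue" "\<And>k. vanishes_outside \<Omega> (u k)"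
    and K: "0 \<le> K" "\<And>k. L2_sq \<Omega> (u k) \<le> ennreal K" "\<And>k. gagliardo_sq \<Omega> s (u k) \<le> ennreal K"
  obtains r :: "nat \<Rightarrow> nat" where "strict_mono r"
    "\<And>k. integrable (lebesgue_on \<Omega>) (u k)"
    "\<And>\<epsilon>. 0 < \<epsilon> \<Longrightarrow> \<exists>n. \<forall>j\<ge>n. \<forall>k\<ge>n. (\<integral>x. cmod (u (r j) x - u (r k) x) \<partial>lebesgue_on \<Omega>) \<le> \<epsilon>"
proof -
  have "\<exists>v. v \<in> borel_measurable borel \<and> (\<forall>x. x \<notin> \<Omega> \<longrightarrow> v x = 0) \<and> (AE x in lebesgue. u k x = v x)" for k
    using ex_borel_representative_vanishing[OF u \<Omega>(1), of k] by metis
  then obtain v where v [measurable]: "\<And>k. v k \<in> borel_measurable borel"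
    and v0: "\<And>k x. x \<notin> \<Omega> \<Longrightarrow> v k x = 0" and uv: "\<And>k. AE x in lebesgue. u k x = v k x"
    by metis
  define V where "V = measure lborel \<Omega>"
  have V: "0 \<le> V" by (simp add: V_def)
  have [measurable]: "\<Omega> \<in> sets borel" using \<Omega> by auto
  have \<Omega>_fin: "emeasure lborel \<Omega> = ennreal V"
    using emeasure_bounded_finite[OF \<Omega>(2)] by (simp add: V_def emeasure_eq_ennreal_measure)
  have L1: "(\<integral>\<^sup>+x. ennreal (cmod (v k x)) \<partial>lborel) \<le> ennreal (V + K)" for k
  proof -
    have "(\<integral>\<^sup>+x. ennreal (cmod (v k x)) \<partial>lborel)
        \<le> (\<integral>\<^sup>+x. indicator \<Omega> x + ennreal ((cmod (v k x))\<^sup>2) * indicator \<Omega> x \<partial>lborel)"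
    proof (intro nn_integral_mono)
      fix x
      have "cmod (v k x) \<le> 1 + (cmod (v k x))\<^sup>2"
        using zero_le_power2[of "cmod (v k x) - 1"] norm_ge_zero[of "v k x"]
        unfolding power2_diff power_one mult_1_right by linarith
      then have "ennreal (cmod (v k x)) \<le> 1 + ennreal ((cmod (v k x))\<^sup>2)"
        by (metis ennreal_leI ennreal_plus ennreal_1 zero_le_one zero_le_power2)
      then show "ennreal (cmod (v k x)) \<le> indicator \<Omega> x + ennreal ((cmod (v k x))\<^sup>2) * indicator \<Omega> x"
        using v0[of x k] by (auto split: split_indicator)
    qed
    also have "\<dots> = ennreal V + (\<integral>\<^sup>+x. ennreal ((cmod (v k x))\<^sup>2) * indicator \<Omega> x \<partial>lborel)"
      by (simp add: nn_integral_add \<Omega>_fin)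
    also have "(\<integral>\<^sup>+x. ennreal ((cmod (v k x))\<^sup>2) * indicator \<Omega> x \<partial>lborel) = L2_sq \<Omega> (u k)"
      unfolding L2_sq_def nn_integral_completion[symmetric, of lborel]
      by (rule nn_integral_cong_AE, rule eventually_mono[OF uv[of k]]) simp
    also have "ennreal V + L2_sq \<Omega> (u k) \<le> ennreal V + ennreal K"
      by (intro add_left_mono K)
    finally show ?thesis using V K(1) by simp
  qed
  have int: "integrable lborel (v k)" for k
    using L1[of k] by (intro integrableI_bounded) (auto intro: le_less_trans)
  have intu: "integrable (lebesgue_on \<Omega>) (u k)" for k
  proof -
    have "integrable lebesgue (v k)" using int integrable_completion[of "v k" lborel] by simp
    then have "integrable lebesgue (u k)"
      by (rule integrable_cong_AE_imp[OF _ u(1)]) (rule eventually_mono[OF uv[of k]], simp)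
    then show ?thesis
      using \<Omega> by (subst integrable_restrict_space) (auto intro: integrable_mult_indicator)
  qed
  define T where "T k = (\<lambda>(i, z). \<integral>x. indicator (cell (inverse (real (Suc i))) z) x *\<^sub>R v k x \<partial>lborel)" for k
  have T_bound: "norm (T k iz) \<le> V + K" for k iz
  proof -
    have "norm (\<integral>x. indicator (cell h z) x *\<^sub>R v k x \<partial>lborel) \<le> V + K" for h z
    proof -
      have "ennreal (norm (\<integral>x. indicator (cell h z) x *\<^sub>R v k x \<partial>lborel))
          \<le> (\<integral>\<^sup>+x. ennreal (norm (indicator (cell h z) x *\<^sub>R v k x)) \<partial>lborel)"
        by (intro integral_norm_bound_ennreal integrable_mult_indicator int) auto
      also have "\<dots> \<le> (\<integral>\<^sup>+x. ennreal (cmod (v k x)) \<partial>lborel)"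
        by (intro nn_integral_mono) (auto split: split_indicator)
      also have "\<dots> \<le> ennreal (V + K)" by (rule L1)
      finally show ?thesis using V K(1) by (subst (asm) ennreal_le_iff) auto
    qed
    then show ?thesis by (auto simp: T_def split: prod.split)
  qed
  obtain r where r: "strict_mono r" "\<And>iz. \<exists>l. (\<lambda>k. T (r k) iz) \<longlonglongrightarrow> l"
    using function_convergent_subsequence[of UNIV T "V + K"] T_bound by auto
  show thesis
  proof (rule that[OF r(1) intu])
    fix \<epsilon> :: real assume \<epsilon>: "0 < \<epsilon>"
    define \<eta> where "\<eta> = 2 * \<epsilon> / (3 * (V + 1))"
    have \<eta>: "0 < \<eta>" "\<eta> / 2 * V \<le> \<epsilon> / 3" using \<epsilon> V by (auto simp: \<eta>_def field_simps)
    define N where "N = real CARD('n)"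
    have N: "0 < N" by (simp add: N_def)
    define b where "b i = (N * inverse (real (Suc i))) powr (N + 2 * s) / (2 * \<eta> * inverse (real (Suc i)) powr N) * (4 * K)" for i
    have "b \<longlonglongrightarrow> 0"
    proof -
      have "(\<lambda>i. inverse (real (Suc i)) powr (2 * s)) \<longlonglongrightarrow> 0"
        using s by (intro tendsto_zero_powrI[OF LIMSEQ_inverse_real_of_nat tendsto_const]) auto
      then have "(\<lambda>i. N powr (N + 2 * s) / (2 * \<eta>) * (4 * K) * inverse (real (Suc i)) powr (2 * s)) \<longlonglongrightarrow> 0"
        by (rule tendsto_mult_right_zero)
      moreover have "b i = N powr (N + 2 * s) / (2 * \<eta>) * (4 * K) * inverse (real (Suc i)) powr (2 * s)" for i
      proof -
        define h where "h = inverse (real (Suc i))"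
        have h: "0 < h" by (simp add: h_def)
        have "(N * h) powr (N + 2 * s) = N powr (N + 2 * s) * (h powr N * h powr (2 * s))"
          using N h by (simp add: powr_mult flip: powr_add)
        then show ?thesis using h \<eta> unfolding b_def h_def[symmetric] by simp
      qed
      ultimately show ?thesis by presburger
    qed
    then obtain i where i: "b i < \<epsilon> / 3"
      using order_tendstoD(2)[of b 0 sequentially "\<epsilon> / 3"] \<epsilon> by (auto simp: eventually_sequentially)
    define h where "h = inverse (real (Suc i))"
    have h: "0 < h" by (simp add: h_def)
    define Z where "Z = cell_index h ` \<Omega>"
    have Z: "finite Z" unfolding Z_def by (rule finite_cell_index[OF \<Omega>(2) h])
    define d where "d = \<epsilon> * h powr N / (3 * (V + 1) * (real (card Z) + 1))"
    have d: "0 < d" using \<epsilon> h V by (auto simp: d_def)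
    have "\<forall>z. \<exists>n. \<forall>j\<ge>n. \<forall>k\<ge>n. dist (T (r j) (i, z)) (T (r k) (i, z)) < d"
    proof
      fix z
      have "Cauchy (\<lambda>k. T (r k) (i, z))" using r(2) LIMSEQ_imp_Cauchy by blast
      then show "\<exists>n. \<forall>j\<ge>n. \<forall>k\<ge>n. dist (T (r j) (i, z)) (T (r k) (i, z)) < d"
        using d by (simp add: Cauchy_def)
    qed
    then obtain n where n: "\<And>z j k. n z \<le> j \<Longrightarrow> n z \<le> k \<Longrightarrow> dist (T (r j) (i, z)) (T (r k) (i, z)) < d"
      by metis
    define n0 where "n0 = (\<Sum>z\<in>Z. n z)"
    have n0: "n z \<le> n0" if "z \<in> Z" for z unfolding n0_def by (rule member_le_sum[OF that]) (auto simp: Z)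
    show "\<exists>n. \<forall>j\<ge>n. \<forall>k\<ge>n. (\<integral>x. cmod (u (r j) x - u (r k) x) \<partial>lebesgue_on \<Omega>) \<le> \<epsilon>"
    proof (intro exI allI impI)
      fix j k assume jk: "n0 \<le> j" "n0 \<le> k"
      define w where "w x = v (r j) x - v (r k) x" for x
      have w [measurable]: "w \<in> borel_measurable borel" unfolding w_def by measurable
      have lv: "v k \<in> borel_measurable lebesgue" for k
        using v by (intro measurable_completion) simp
      have "gagliardo_sq \<Omega> s w \<le> 2 * gagliardo_sq \<Omega> s (v (r j)) + 2 * gagliardo_sq \<Omega> s (v (r k))"
        unfolding w_def by (rule gagliardo_sq_diff_le[OF \<Omega>(1) lv lv])
      also have "\<dots> \<le> 2 * ennreal K + 2 * ennreal K"
        using K(3)[of "r j"] K(3)[of "r k"] gagliardo_sq_cong[OF \<Omega>(1) uv, of s]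
        by (intro add_mono mult_left_mono) auto
      also have "\<dots> = ennreal (4 * K)"
      proof -
        have "2 * ennreal K = ennreal (2 * K)" using K(1) by (simp add: ennreal_mult)
        then show ?thesis using K(1) by (simp flip: ennreal_plus)
      qed
      finally have gw: "gagliardo_sq \<Omega> s w \<le> ennreal (4 * K)" .
      have intw: "integrable lborel w" unfolding w_def using int by auto
      have "(\<Sum>z\<in>Z. cmod (\<integral>x. indicator (cell h z) x *\<^sub>R w x \<partial>lborel)) \<le> (\<Sum>z\<in>Z. d)"
      proof (intro sum_mono)
        fix z assume "z \<in> Z"
        have "(\<integral>x. indicator (cell h z) x *\<^sub>R w x \<partial>lborel) = T (r j) (i, z) - T (r k) (i, z)"
          unfolding w_def T_def h_def scaleR_diff_right prod.case
          by (intro Bochner_Integration.integral_diff integrable_mult_indicator int) auto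
        then show "cmod (\<integral>x. indicator (cell h z) x *\<^sub>R w x \<partial>lborel) \<le> d"
          using n[of z j k] n0[OF \<open>z \<in> Z\<close>] jk by (simp add: dist_norm)
      qed
      then have S: "(\<Sum>z\<in>Z. cmod (\<integral>x. indicator (cell h z) x *\<^sub>R w x \<partial>lborel)) \<le> real (card Z) * d" by simp
      have "V / h powr N * (\<Sum>z\<in>Z. cmod (\<integral>x. indicator (cell h z) x *\<^sub>R w x \<partial>lborel)) \<le> V / h powr N * (real (card Z) * d)"
        using V by (intro mult_left_mono S) auto
      also have "\<dots> = \<epsilon> / 3 * (V / (V + 1) * (real (card Z) / (real (card Z) + 1)))"
        using V h by (simp add: d_def field_simps)
      also have "\<dots> \<le> \<epsilon> / 3 * (1 * 1)"
        using \<epsilon> V by (intro mult_left_mono mult_mono) (auto simp: divide_le_eq)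
      finally have avg: "V / h powr N * (\<Sum>z\<in>Z. cmod (\<integral>x. indicator (cell h z) x *\<^sub>R w x \<partial>lborel)) \<le> \<epsilon> / 3" by simp
      have "(\<integral>x. cmod (u (r j) x - u (r k) x) \<partial>lebesgue_on \<Omega>) = (\<integral>x. indicator \<Omega> x *\<^sub>R cmod (u (r j) x - u (r k) x) \<partial>lebesgue)"
        using \<Omega> by (simp add: integral_restrict_space)
      also have "\<dots> = (\<integral>x. cmod (w x) \<partial>lebesgue)"
      proof (rule integral_cong_AE)
        show "AE x in lebesgue. indicator \<Omega> x *\<^sub>R cmod (u (r j) x - u (r k) x) = cmod (w x)"
          using uv[of "r j"] uv[of "r k"]
          by eventually_elim (auto simp: w_def v0 split: split_indicator)
        show "(\<lambda>x. indicator \<Omega> x *\<^sub>R cmod (u (r j) x - u (r k) x)) \<in> borel_measurable lebesgue"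
          using u(1)[of "r j"] u(1)[of "r k"] \<Omega>(1)
          by (intro borel_measurable_scaleR borel_measurable_indicator borel_measurable_norm borel_measurable_diff) auto
        show "(\<lambda>x. cmod (w x)) \<in> borel_measurable lebesgue"
          using lv unfolding w_def by measurable
      qed
      also have "\<dots> = (\<integral>x. cmod (w x) \<partial>lborel)"
        by (rule integral_completion) measurable
      also have "\<dots> \<le> \<eta> / 2 * V + b i + V / h powr N * (\<Sum>z\<in>Z. cmod (\<integral>x. indicator (cell h z) x *\<^sub>R w x \<partial>lborel))"
        unfolding V_def b_def Z_def N_def h_def[symmetric]
        by (rule L1_le_gagliardo_plus_cell_averages[OF w _ intw \<Omega> s h \<eta>(1) gw]) (use K(1) v0 in \<open>auto simp: w_def\<close>)
      also have "\<dots> \<le> \<epsilon> / 3 + \<epsilon> / 3 + \<epsilon> / 3"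
        using \<eta>(2) i avg by linarith
      finally show "(\<integral>x. cmod (u (r j) x - u (r k) x) \<partial>lebesgue_on \<Omega>) \<le> \<epsilon>" by simp
    qed
  qed
qed

section \<open>Limits of integrals and inequalities for powers\<close>

text \<open>Among the dominating functions only the vanishing part \<open>h k\<close> depends on the index. The excess of
\<open>\<bar>f k - f0\<bar>\<close> over \<open>h k\<close> is dominated by a fixed integrable function and tends to 0 almost
everywhere, so dominated convergence applies to it, while the integrals of \<open>h k\<close> tend to 0 by
assumption.\<close>

lemma tendsto_integral_dominated_by_vanishing:
  fixes f :: "nat \<Rightarrow> 'a \<Rightarrow> 'b::{banach, second_countable_topology}"
  assumes f: "\<And>k. integrable M (f k)" and f0: "integrable M f0"
    and h: "\<And>k. integrable M (h k)" and H: "integrable M H"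
    and lim: "AE x in M. (\<lambda>k. f k x) \<longlonglongrightarrow> f0 x"
    and bound: "\<And>k x. norm (f k x) \<le> H x + h k x"
    and h_nonneg: "\<And>k x. 0 \<le> h k x"
    and h_lim: "(\<lambda>k. \<integral>x. h k x \<partial>M) \<longlonglongrightarrow> 0"
  shows "(\<lambda>k. \<integral>x. f k x \<partial>M) \<longlonglongrightarrow> (\<integral>x. f0 x \<partial>M)"
proof -
  define e where "e k x = max 0 (norm (f k x - f0 x) - h k x)" for k x
  have meas [measurable]: "f k \<in> borel_measurable M" "f0 \<in> borel_measurable M" "h k \<in> borel_measurable M" for k
    using f f0 h by auto
  have e_le: "norm (e k x) \<le> norm (f0 x) + \<bar>H x\<bar>" for k x
    using bound[of k x] norm_triangle_ineq4[of "f k x" "f0 x"] by (auto simp: e_def)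
  have dom: "integrable M (\<lambda>x. norm (f0 x) + \<bar>H x\<bar>)"
    using f0 H by auto
  have e_int: "integrable M (e k)" for k
    by (rule Bochner_Integration.integrable_bound[OF dom])
       (use e_le in \<open>auto simp: e_def[abs_def]\<close>)
  have "(\<lambda>k. \<integral>x. e k x \<partial>M) \<longlonglongrightarrow> (\<integral>x. 0 \<partial>M)"
  proof (rule integral_dominated_convergence[OF _ _ dom])
    show "AE x in M. (\<lambda>k. e k x) \<longlonglongrightarrow> 0"
      using lim
    proof eventually_elim
      case (elim x)
      then have "(\<lambda>k. norm (f k x - f0 x)) \<longlonglongrightarrow> 0"
        using LIM_zero tendsto_norm_zero by blast
      then show ?case
        by (rule Lim_null_comparison[rotated]) (use h_nonneg in \<open>auto simp: e_def\<close>)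
    qed
  qed (use e_le in \<open>auto simp: e_def[abs_def]\<close>)
  then have lim0: "(\<lambda>k. (\<integral>x. e k x \<partial>M) + (\<integral>x. h k x \<partial>M)) \<longlonglongrightarrow> 0"
    using tendsto_add[OF _ h_lim] by fastforce
  have "norm ((\<integral>x. f k x \<partial>M) - (\<integral>x. f0 x \<partial>M)) \<le> (\<integral>x. e k x \<partial>M) + (\<integral>x. h k x \<partial>M)" for k
  proof -
    have "norm ((\<integral>x. f k x \<partial>M) - (\<integral>x. f0 x \<partial>M)) = norm (\<integral>x. f k x - f0 x \<partial>M)"
      using f f0 by simp
    also have "\<dots> \<le> (\<integral>x. norm (f k x - f0 x) \<partial>M)"
      by (rule integral_norm_bound)
    also have "\<dots> \<le> (\<integral>x. e k x + h k x \<partial>M)"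
      using f f0 h e_int by (intro integral_mono) (auto simp: e_def)
    finally show ?thesis using e_int h by simp
  qed
  then have "(\<lambda>k. (\<integral>x. f k x \<partial>M) - (\<integral>x. f0 x \<partial>M)) \<longlonglongrightarrow> 0"
    by (intro Lim_null_comparison[OF _ lim0]) auto
  then show ?thesis by (simp add: LIM_zero_cancel)
qed

lemma nn_integral_le_of_AE_limit:
  fixes f :: "nat \<Rightarrow> 'a \<Rightarrow> ennreal"
  assumes [measurable]: "\<And>k. f k \<in> borel_measurable M"
    and lim: "AE x in M. (\<lambda>k. f k x) \<longlonglongrightarrow> f0 x"
    and bound: "\<And>k. n \<le> k \<Longrightarrow> (\<integral>\<^sup>+x. f k x \<partial>M) \<le> C"
  shows "(\<integral>\<^sup>+x. f0 x \<partial>M) \<le> C"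
proof -
  have "(\<integral>\<^sup>+x. f0 x \<partial>M) = (\<integral>\<^sup>+x. liminf (\<lambda>k. f k x) \<partial>M)"
    by (rule nn_integral_cong_AE, rule eventually_mono[OF lim]) (simp add: lim_imp_Liminf)
  also have "\<dots> \<le> liminf (\<lambda>k. \<integral>\<^sup>+x. f k x \<partial>M)"
    by (rule nn_integral_liminf) simp
  also have "\<dots> \<le> C"
    using bound by (intro Liminf_le) (auto simp: eventually_sequentially)
  finally show ?thesis .
qed

text \<open>Of the two factors, the one that is larger after weighting bounds the product: the two cases are
\<open>b \<le> \<eta> a\<close> and \<open>b > \<eta> a\<close>.\<close>

lemma powr_mult_le_weighted:
  fixes a b p \<eta> :: real
  assumes "0 \<le> a" "0 \<le> b" "0 < p" "0 < \<eta>"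
  shows "a powr p * b \<le> \<eta> * a powr (p + 1) + \<eta> powr (- p) * b powr (p + 1)"
proof (cases "b \<le> \<eta> * a")
  case True
  have "a powr p * b \<le> a powr p * (\<eta> * a)" using True by (intro mult_left_mono) auto
  also have "\<dots> = \<eta> * a powr (p + 1)" using assms by (cases "a = 0") (auto simp: powr_add)
  finally show ?thesis by (simp add: add_increasing2)
next
  case False
  then have b: "0 < b" using assms by (smt (verit) mult_nonneg_nonneg)
  have "a powr p \<le> (b / \<eta>) powr p"
    using False assms by (intro powr_mono2) (auto simp: field_simps)
  then have "a powr p * b \<le> (b / \<eta>) powr p * b" using b by (intro mult_right_mono) auto
  also have "\<dots> = \<eta> powr (- p) * b powr (p + 1)"
    using b assms by (simp add: powr_divide powr_add powr_minus field_simps)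
  finally show ?thesis using assms by (simp add: add_increasing)
qed

lemma powr_add_le:
  fixes a b r :: real
  assumes "0 \<le> a" "0 \<le> b" "0 \<le> r"
  shows "(a + b) powr r \<le> 2 powr r * (a powr r + b powr r)"
proof -
  have "(a + b) powr r \<le> (2 * max a b) powr r" using assms by (intro powr_mono2) auto
  also have "\<dots> = 2 powr r * (max a b) powr r" using assms by (simp add: powr_mult)
  also have "\<dots> \<le> 2 powr r * (a powr r + b powr r)"
    by (intro mult_left_mono) (auto simp: max_def)
  finally show ?thesis .
qed

lemma norm_powr_add_le:
  "0 \<le> r \<Longrightarrow> cmod (a + b) powr r \<le> 2 powr r * (cmod a powr r + cmod b powr r)"
  by (rule order_trans[OF powr_mono2[OF _ _ norm_triangle_ineq] powr_add_le]) auto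

text \<open>Below the threshold \<open>l\<close> the power is controlled by the first one, above it by a higher one whose
coefficient is small when \<open>l\<close> is large. Boundedness of a higher power thus lifts convergence in
\<open>L\<^sup>1\<close> to convergence in \<open>L\<^bsup>p+1\<^esup>\<close>.\<close>

lemma powr_interpolation:
  fixes t l p m :: real
  assumes "0 \<le> t" "0 < l" "0 < p" "p + 1 \<le> m"
  shows "t powr (p + 1) \<le> l powr p * t + l powr (p + 1 - m) * t powr m"
proof (cases "t \<le> l")
  case True
  have "t powr (p + 1) = t powr p * t" using assms by (cases "t = 0") (auto simp: powr_add)
  also have "\<dots> \<le> l powr p * t" using True assms by (intro mult_right_mono powr_mono2) auto
  finally show ?thesis by (simp add: add_increasing2)
next
  case False
  then have "t powr (p + 1) = t powr (p + 1 - m) * t powr m" using assms by (simp flip: powr_add)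
  also have "\<dots> \<le> l powr (p + 1 - m) * t powr m"
    using False assms by (intro mult_right_mono powr_mono2') auto
  finally show ?thesis using assms by (simp add: add_increasing)
qed

lemma powr_le_one_plus_powr:
  fixes t a b :: real
  assumes "0 \<le> t" "0 \<le> a" "a \<le> b"
  shows "t powr a \<le> 1 + t powr b"
proof (cases "t \<le> 1")
  case True
  then have "t powr a \<le> 1" using assms by (intro powr_le1) auto
  then show ?thesis by (simp add: add_increasing2)
next
  case False
  then show ?thesis using assms by (intro add_increasing powr_mono) auto
qed

lemma norm_source: "cmod (source p z) = cmod z powr p"
  by (cases "z = 0") (auto simp: source_def norm_mult norm_divide powr_diff)

lemma isCont_source:
  assumes "0 < p" shows "isCont (source p) z"
proof (cases "z = 0")
  case True
  have "((\<lambda>z::complex. cmod z powr p) \<longlongrightarrow> 0) (at 0)"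
    using assms by (intro tendsto_zero_powrI[where b = p] tendsto_norm_zero tendsto_ident_at tendsto_const) auto
  then have "(source p \<longlongrightarrow> 0) (at 0)"
    by (simp add: norm_source flip: tendsto_norm_zero_iff[of "source p"])
  then show ?thesis using True by (simp add: isCont_def source_def)
next
  case False
  then show ?thesis
    unfolding source_def[abs_def] by (intro continuous_intros) auto
qed

lemma measurable_source: "0 < p \<Longrightarrow> source p \<in> borel_measurable borel"
  by (intro borel_measurable_continuous_onI continuous_at_imp_continuous_on) (auto intro: isCont_source)

section \<open>The energy space\<close>

text \<open>The inclusion of the magnetic Orlicz space in \<open>H\<^sub>0\<^sup>s\<close> makes every difference of two elements of
the former an admissible test function for the evolution equation and bounds the terms with the
time derivative that this test produces.\<close>

locale nonlocal_problem = N_function g q p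
  for g :: "real \<Rightarrow> real" and q p :: real +
  fixes \<Omega> :: "(real^'n) set" and A :: "real^'n \<Rightarrow> real^'n" and s :: real
  assumes open_domain: "open \<Omega>" and bounded_domain: "bounded \<Omega>"
    and continuous_potential: "continuous_on UNIV A"
    and s_pos: "0 < s"
    and subcritical: "ereal (p + 1) < critical_exponent CARD('n) s q"
    and W_subset_H: "WA0_space \<Omega> A s g \<subseteq> H0s_space \<Omega> s"
begin

abbreviation "\<mu> \<equiv> pair_measure_on \<Omega>"
abbreviation "\<L> \<equiv> lebesgue_on \<Omega>"
abbreviation "D \<equiv> DsA A s"
abbreviation "W \<equiv> WA0_space \<Omega> A s g"

lemma finite_measure_domain: "finite_measure \<L>"
proof
  have "emeasure lebesgue \<Omega> < \<infinity>"
    using emeasure_bounded_finite[OF bounded_domain] open_domain by simp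
  then show "emeasure \<L> (space \<L>) \<noteq> \<infinity>"
    using open_domain by (simp add: emeasure_restrict_space)
qed

lemma W_properties:
  assumes "u \<in> W"
  shows W_measurable: "u \<in> borel_measurable lebesgue"
    and W_measurable_on: "u \<in> borel_measurable \<L>"
    and W_measurable_DsA: "D u \<in> borel_measurable \<mu>"
    and W_vanishes: "vanishes_outside \<Omega> u"
    and W_integrable_modular: "integrable \<mu> (\<lambda>z. G (cmod (D u z)))"
    and W_integrable_G: "integrable \<L> (\<lambda>x. G (cmod (u x)))"
    and W_L2_finite: "L2_sq \<Omega> u < \<infinity>"
    and W_gagliardo_finite: "gagliardo_sq \<Omega> s u < \<infinity>"
proof -
  show v: "vanishes_outside \<Omega> u" and m: "u \<in> borel_measurable \<L>"
    using assms by (auto simp: WA0_space_def LG_space_def)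
  show l: "u \<in> borel_measurable lebesgue" by (rule measurable_of_vanishing[OF m v open_domain])
  show d: "D u \<in> borel_measurable \<mu>" by (rule measurable_DsA[OF l continuous_potential])
  show "integrable \<mu> (\<lambda>z. G (cmod (D u z)))" "integrable \<L> (\<lambda>x. G (cmod (u x)))"
    using assms integrable_G_iff[OF d] integrable_G_iff[OF m]
    by (auto simp: WA0_space_def LG_space_def rho_sGA_eq[OF open_domain] rho_G_eq[OF open_domain])
  show "L2_sq \<Omega> u < \<infinity>" "gagliardo_sq \<Omega> s u < \<infinity>"
    using assms W_subset_H by (auto simp: H0s_space_def L2_space_def)
qed

lemma in_W_intro:
  assumes "u \<in> borel_measurable lebesgue" "vanishes_outside \<Omega> u"
    "integrable \<mu> (\<lambda>z. G (cmod (D u z)))" "integrable \<L> (\<lambda>x. G (cmod (u x)))"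
  shows "u \<in> W"
  using assms integrable_G_iff[OF measurable_DsA[OF assms(1) continuous_potential]]
    integrable_G_iff[OF measurable_lebesgue_on[OF assms(1)]] measurable_lebesgue_on[OF assms(1)]
  by (auto simp: WA0_space_def LG_space_def rho_sGA_eq[OF open_domain] rho_G_eq[OF open_domain])

lemma W_diff:
  assumes "u \<in> W" "v \<in> W" shows "(\<lambda>x. u x - v x) \<in> W"
proof (rule in_W_intro)
  note u = W_properties[OF assms(1)] and v = W_properties[OF assms(2)]
  show "(\<lambda>x. u x - v x) \<in> borel_measurable lebesgue" using u v by auto
  show "vanishes_outside \<Omega> (\<lambda>x. u x - v x)"
    using u(4) v(4) unfolding vanishes_outside_def by eventually_elim auto
  show "integrable \<mu> (\<lambda>z. G (cmod (D (\<lambda>x. u x - v x) z)))"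
    unfolding DsA_diff using u v by (intro integrable_G_diff)
  show "integrable \<L> (\<lambda>x. G (cmod (u x - v x)))"
    using u v by (intro integrable_G_diff)
qed

definition modular :: "(real^'n \<Rightarrow> complex) \<Rightarrow> real" where
  "modular u = (\<integral>z. G (cmod (D u z)) \<partial>\<mu>)"

lemma modular_nonneg: "0 \<le> modular u"
  by (simp add: modular_def)

lemma nn_modular: "u \<in> W \<Longrightarrow> (\<integral>\<^sup>+z. ennreal (G (cmod (D u z))) \<partial>\<mu>) = ennreal (modular u)"
  unfolding modular_def by (rule nn_integral_G) (rule W_properties)

lemma modular_diff_le:
  assumes "u \<in> W" "v \<in> W"
  shows "modular (\<lambda>x. u x - v x) \<le> doubling * (modular u + modular v)"
proof -
  have "modular (\<lambda>x. u x - v x) \<le> (\<integral>z. doubling * (G (cmod (D u z)) + G (cmod (D v z))) \<partial>\<mu>)"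
    unfolding modular_def
  proof (rule integral_mono)
    show "integrable \<mu> (\<lambda>z. G (cmod (D (\<lambda>x. u x - v x) z)))"
      using W_integrable_modular[OF W_diff[OF assms]] .
    show "integrable \<mu> (\<lambda>z. doubling * (G (cmod (D u z)) + G (cmod (D v z))))"
      using W_integrable_modular[OF assms(1)] W_integrable_modular[OF assms(2)] by auto
  qed (simp add: DsA_diff G_norm_diff)
  also have "\<dots> = doubling * (modular u + modular v)"
    using W_integrable_modular[OF assms(1)] W_integrable_modular[OF assms(2)] by (simp add: modular_def)
  finally show ?thesis .
qed

lemma seminorm_scaling:
  "rho_sGA \<Omega> A s g (\<lambda>x. u x / complex_of_real l)
    = (\<integral>\<^sup>+z. ennreal (G (cmod (D u z / complex_of_real l))) \<partial>\<mu>)"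
  by (simp add: rho_sGA_eq[OF open_domain] DsA_divide)

lemma rho_G_scaling:
  "rho_G \<Omega> g (\<lambda>x. u x / complex_of_real l)
    = (\<integral>\<^sup>+x. ennreal (G (cmod (u x / complex_of_real l))) \<partial>\<L>)"
  by (simp add: rho_G_eq[OF open_domain])

lemma seminorm_nonneg: "u \<in> W \<Longrightarrow> 0 \<le> seminorm_sGA \<Omega> A s g u"
  unfolding seminorm_sGA_def luxemburg_def
  by (rule luxemburg_nonneg[OF W_measurable_DsA W_integrable_modular seminorm_scaling]) auto

lemma norm_G_nonneg: "u \<in> W \<Longrightarrow> 0 \<le> luxemburg (rho_G \<Omega> g) u"
  unfolding luxemburg_def
  by (rule luxemburg_nonneg[OF W_measurable_on W_integrable_G rho_G_scaling]) auto

lemma modular_le_of_seminorm_less: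
  "u \<in> W \<Longrightarrow> seminorm_sGA \<Omega> A s g u < C \<Longrightarrow> modular u \<le> max 1 C powr (p + 1)"
  unfolding seminorm_sGA_def luxemburg_def modular_def
  by (rule modular_le_of_luxemburg_less[OF W_measurable_DsA W_integrable_modular seminorm_scaling]) auto

lemma seminorm_le_of_modular:
  "u \<in> W \<Longrightarrow> 0 < l \<Longrightarrow> l \<le> 1 \<Longrightarrow> modular u \<le> l powr (p + 1) \<Longrightarrow> seminorm_sGA \<Omega> A s g u \<le> l"
  unfolding seminorm_sGA_def luxemburg_def modular_def
  by (rule luxemburg_le_of_modular[OF W_measurable_DsA W_integrable_modular seminorm_scaling]) auto

lemma seminorm_tendsto_0:
  assumes "\<And>k. u k \<in> W" and lim: "(\<lambda>k. modular (u k)) \<longlonglongrightarrow> 0"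
  shows "(\<lambda>k. seminorm_sGA \<Omega> A s g (u k)) \<longlonglongrightarrow> 0"
proof (rule order_tendstoI)
  fix a :: real assume "a < 0"
  then show "\<forall>\<^sub>F k in sequentially. a < seminorm_sGA \<Omega> A s g (u k)"
    using seminorm_nonneg[OF assms(1)] by (intro always_eventually allI) (auto intro: less_le_trans)
next
  fix a :: real assume "0 < a"
  define l where "l = min 1 (a / 2)"
  have l: "0 < l" "l \<le> 1" "l < a" using \<open>0 < a\<close> by (auto simp: l_def)
  have "\<forall>\<^sub>F k in sequentially. modular (u k) < l powr (p + 1)"
    using l by (intro order_tendstoD(2)[OF lim]) auto
  then show "\<forall>\<^sub>F k in sequentially. seminorm_sGA \<Omega> A s g (u k) < a"
    by eventually_elim (use l seminorm_le_of_modular[OF assms(1)] in \<open>auto intro: le_less_trans less_imp_le\<close>)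
qed

lemma higher_integrability:
  obtains m C where "p + 1 < m" "\<And>M. 0 \<le> C M"
    "\<And>u. u \<in> W \<Longrightarrow> integrable \<L> (\<lambda>x. cmod (u x) powr m)"
    "\<And>u M. u \<in> W \<Longrightarrow> modular u \<le> M \<Longrightarrow> (\<integral>x. cmod (u x) powr m \<partial>\<L>) \<le> C M"
proof -
  obtain m C where m: "p + 1 < m" and C: "\<And>M. 0 \<le> C M" and
    sob: "\<And>M u. \<lbrakk>0 \<le> M; u \<in> borel_measurable lebesgue; vanishes_outside \<Omega> u;
        (\<integral>\<^sup>+z. ennreal (G (cmod (D u z))) \<partial>\<mu>) \<le> ennreal M\<rbrakk>
      \<Longrightarrow> (\<integral>\<^sup>+x. ennreal (cmod (u x) powr m) \<partial>\<L>) \<le> ennreal (C M)"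
    using subcritical_sobolev[OF open_domain bounded_domain continuous_potential s_pos subcritical] by metis
  have nn: "(\<integral>\<^sup>+x. ennreal (cmod (u x) powr m) \<partial>\<L>) \<le> ennreal (C M)" if "u \<in> W" "modular u \<le> M" for u M
    using that order_trans[OF modular_nonneg that(2)] W_measurable[OF that(1)] W_vanishes[OF that(1)]
    by (intro sob) (auto simp: nn_modular ennreal_leI)
  have int: "integrable \<L> (\<lambda>x. cmod (u x) powr m)" if "u \<in> W" for u
  proof (rule integrableI_bounded)
    show "(\<lambda>x. cmod (u x) powr m) \<in> borel_measurable \<L>" using W_measurable_on[OF that] by measurable
    show "(\<integral>\<^sup>+x. ennreal (norm (cmod (u x) powr m)) \<partial>\<L>) < \<infinity>"
      using nn[OF that order_refl] by (auto intro: le_less_trans)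
  qed
  show thesis
  proof (rule that[OF m C int])
    fix u M assume u: "u \<in> W" "modular u \<le> M"
    have "ennreal (\<integral>x. cmod (u x) powr m \<partial>\<L>) \<le> ennreal (C M)"
      using nn[OF u] nn_integral_eq_integral[OF int[OF u(1)]] by simp
    then show "(\<integral>x. cmod (u x) powr m \<partial>\<L>) \<le> C M" using C by simp
  qed
qed

lemma integrable_one_domain: "integrable \<L> (\<lambda>_. 1 :: real)"
  using finite_measure.integrable_const[OF finite_measure_domain] .

lemma integrable_powr:
  assumes "u \<in> W" shows "integrable \<L> (\<lambda>x. cmod (u x) powr (p + 1))"
proof -
  obtain m C where m: "p + 1 < m" and int: "\<And>u. u \<in> W \<Longrightarrow> integrable \<L> (\<lambda>x. cmod (u x) powr m)"
    by (rule higher_integrability) blast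
  show ?thesis
  proof (rule Bochner_Integration.integrable_bound)
    show "integrable \<L> (\<lambda>x. 1 + cmod (u x) powr m)"
      using int[OF assms] integrable_one_domain by auto
    show "AE x in \<L>. norm (cmod (u x) powr (p + 1)) \<le> norm (1 + cmod (u x) powr m)"
      using powr_le_one_plus_powr[of "cmod (u x)" "p + 1" m for x] m p_pos by (intro AE_I2) auto
    show "(\<lambda>x. cmod (u x) powr (p + 1)) \<in> borel_measurable \<L>" using W_measurable_on[OF assms] by measurable
  qed
qed

lemma integrable_powr_mult:
  assumes "u \<in> W" "v \<in> W" shows "integrable \<L> (\<lambda>x. cmod (u x) powr p * cmod (v x))"
proof (rule Bochner_Integration.integrable_bound)
  show "integrable \<L> (\<lambda>x. cmod (u x) powr (p + 1) + cmod (v x) powr (p + 1))"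
    using integrable_powr[OF assms(1)] integrable_powr[OF assms(2)] by auto
  show "AE x in \<L>. norm (cmod (u x) powr p * cmod (v x)) \<le> norm (cmod (u x) powr (p + 1) + cmod (v x) powr (p + 1))"
  proof (intro AE_I2)
    fix x show "norm (cmod (u x) powr p * cmod (v x)) \<le> norm (cmod (u x) powr (p + 1) + cmod (v x) powr (p + 1))"
      using powr_mult_le_weighted[of "cmod (u x)" "cmod (v x)" p 1] p_pos by (simp add: abs_mult)
  qed
  show "(\<lambda>x. cmod (u x) powr p * cmod (v x)) \<in> borel_measurable \<L>"
    using W_measurable_on[OF assms(1)] W_measurable_on[OF assms(2)] by measurable
qed

lemma integrable_source_mult:
  assumes "u \<in> W" "v \<in> W" shows "integrable \<L> (\<lambda>x. source p (u x) * cnj (v x))"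
proof (rule Bochner_Integration.integrable_bound[OF integrable_powr_mult[OF assms]])
  have [measurable]: "source p \<in> borel_measurable borel" by (rule measurable_source[OF p_pos])
  show "(\<lambda>x. source p (u x) * cnj (v x)) \<in> borel_measurable \<L>"
    using W_measurable_on[OF assms(1)] W_measurable_on[OF assms(2)] by measurable
qed (simp add: norm_mult norm_source)

lemma integrable_flux_W:
  assumes "u \<in> W" "v \<in> W" shows "integrable \<mu> (\<lambda>z. flux g (D u z) * cnj (D v z))"
  using W_properties[OF assms(1)] W_properties[OF assms(2)] by (intro integrable_flux_mult)

lemma energy_deriv_eq:
  "energy_deriv \<Omega> A s g p u v =
    Re (\<integral>z. flux g (D u z) * cnj (D v z) \<partial>\<mu>) - Re (\<integral>x. source p (u x) * cnj (v x) \<partial>\<L>)"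
  by (simp add: energy_deriv_def LINT_Q_eq[OF open_domain] LINT_Omega_eq[OF open_domain])

text \<open>Monotonicity of the flux bounds the modular of \<open>u - v\<close> by the difference of the flux terms tested with
\<open>u - v\<close>; the derivative of the energy is that term minus the source term.\<close>

lemma modular_diff_le_residual:
  assumes u: "u \<in> W" and v: "v \<in> W"
  defines "w \<equiv> \<lambda>x. u x - v x"
  shows "modular w \<le> doubling * (\<bar>energy_deriv \<Omega> A s g p u w\<bar> + \<bar>energy_deriv \<Omega> A s g p v w\<bar>
    + ((\<integral>x. cmod (u x) powr p * cmod (w x) \<partial>\<L>) + (\<integral>x. cmod (v x) powr p * cmod (w x) \<partial>\<L>)))"
proof -
  have w: "w \<in> W" unfolding w_def by (rule W_diff[OF u v])
  note flux_int = integrable_flux_W[OF u w] integrable_flux_W[OF v w]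
  note source_int = integrable_source_mult[OF u w] integrable_source_mult[OF v w]
  have "modular w \<le> (\<integral>z. doubling * Re (flux g (D u z) * cnj (D w z) - flux g (D v z) * cnj (D w z)) \<partial>\<mu>)"
    unfolding modular_def
  proof (rule integral_mono)
    show "integrable \<mu> (\<lambda>z. G (cmod (D w z)))" using W_integrable_modular[OF w] .
    show "integrable \<mu> (\<lambda>z. doubling * Re (flux g (D u z) * cnj (D w z) - flux g (D v z) * cnj (D w z)))"
      using flux_int by (intro integrable_mult_right integrable_Re Bochner_Integration.integrable_diff)
    show "G (cmod (D w z)) \<le> doubling * Re (flux g (D u z) * cnj (D w z) - flux g (D v z) * cnj (D w z))" for z
      using flux_monotone[of "D u z" "D v z"] by (simp add: w_def DsA_diff left_diff_distrib)
  qed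
  also have "\<dots> = doubling * (Re (\<integral>z. flux g (D u z) * cnj (D w z) \<partial>\<mu>) - Re (\<integral>z. flux g (D v z) * cnj (D w z) \<partial>\<mu>))"
    unfolding integral_mult_right_zero integral_Re[OF Bochner_Integration.integrable_diff[OF flux_int]]
      Bochner_Integration.integral_diff[OF flux_int] by simp
  also have "\<dots> = doubling * (energy_deriv \<Omega> A s g p u w - energy_deriv \<Omega> A s g p v w
      + (Re (\<integral>x. source p (u x) * cnj (w x) \<partial>\<L>) - Re (\<integral>x. source p (v x) * cnj (w x) \<partial>\<L>)))"
    by (simp add: energy_deriv_eq)
  also have "\<dots> \<le> doubling * (\<bar>energy_deriv \<Omega> A s g p u w\<bar> + \<bar>energy_deriv \<Omega> A s g p v w\<bar>
    + ((\<integral>x. cmod (u x) powr p * cmod (w x) \<partial>\<L>) + (\<integral>x. cmod (v x) powr p * cmod (w x) \<partial>\<L>)))"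
  proof -
    have "\<bar>Re (\<integral>x. source p (f x) * cnj (w x) \<partial>\<L>)\<bar> \<le> (\<integral>x. cmod (f x) powr p * cmod (w x) \<partial>\<L>)" if "f \<in> W" for f
    proof -
      have "\<bar>Re (\<integral>x. source p (f x) * cnj (w x) \<partial>\<L>)\<bar> \<le> (\<integral>x. norm (source p (f x) * cnj (w x)) \<partial>\<L>)"
        by (rule order_trans[OF abs_Re_le_cmod integral_norm_bound])
      then show ?thesis by (simp add: norm_mult norm_source)
    qed
    from this[OF u] this[OF v] show ?thesis
      using doubling_ge_1 by (intro mult_left_mono) linarith+
  qed
  finally show ?thesis .
qed

end

section \<open>Compactness of Palais-Smale sequences\<close>

context nonlocal_problem
begin

lemma norm_s2_squared: "(norm_s2 \<Omega> s u)\<^sup>2 = enn2real (L2_sq \<Omega> u) + enn2real (gagliardo_sq \<Omega> s u)"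
  by (simp add: norm_s2_def)

lemma L2_gagliardo_le:
  assumes "u \<in> W" "(norm_s2 \<Omega> s u)\<^sup>2 \<le> K"
  shows "L2_sq \<Omega> u \<le> ennreal K" "gagliardo_sq \<Omega> s u \<le> ennreal K"
proof -
  have "enn2real (L2_sq \<Omega> u) \<le> K" "enn2real (gagliardo_sq \<Omega> s u) \<le> K"
    using assms(2) enn2real_nonneg[of "L2_sq \<Omega> u"] enn2real_nonneg[of "gagliardo_sq \<Omega> s u"]
    unfolding norm_s2_squared by linarith+
  then show "L2_sq \<Omega> u \<le> ennreal K" "gagliardo_sq \<Omega> s u \<le> ennreal K"
    using W_L2_finite[OF assms(1)] W_gagliardo_finite[OF assms(1)] by (metis ennreal_enn2real ennreal_leI infinity_ennreal_def)+
qed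

lemma norm_s2_diff_squared_le:
  assumes u: "u \<in> W" and v: "v \<in> W"
  shows "(norm_s2 \<Omega> s (\<lambda>x. u x - v x))\<^sup>2 \<le> 2 * (norm_s2 \<Omega> s u)\<^sup>2 + 2 * (norm_s2 \<Omega> s v)\<^sup>2"
proof -
  have real: "enn2real a \<le> 2 * enn2real b + 2 * enn2real c" if "a \<le> 2 * b + 2 * c" "b < \<infinity>" "c < \<infinity>" for a b c
  proof -
    have "2 * b + 2 * c = ennreal (2 * enn2real b + 2 * enn2real c)"
      using that by (cases b; cases c) (auto simp: ennreal_mult)
    then show ?thesis using enn2real_mono[OF that(1)] by (simp del: ennreal_plus)
  qed
  have "L2_sq \<Omega> (\<lambda>x. u x - v x) \<le> 2 * L2_sq \<Omega> u + 2 * L2_sq \<Omega> v"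
    unfolding L2_sq_eq[OF open_domain]
    by (rule nn_integral_norm_diff_squared_le[OF W_measurable_on[OF u] W_measurable_on[OF v]])
  from real[OF this] real[OF gagliardo_sq_diff_le[OF open_domain W_measurable[OF u] W_measurable[OF v], of s]]
  show ?thesis
    using W_L2_finite[OF u] W_gagliardo_finite[OF u] W_L2_finite[OF v] W_gagliardo_finite[OF v] unfolding norm_s2_squared by simp
qed

lemma power_integral_bounded:
  obtains P where "0 \<le> P" "\<And>u. u \<in> W \<Longrightarrow> modular u \<le> M \<Longrightarrow> (\<integral>x. cmod (u x) powr (p + 1) \<partial>\<L>) \<le> P"
proof -
  obtain m C where m: "p + 1 < m" and C: "\<And>M. 0 \<le> C M"
    and int: "\<And>u. u \<in> W \<Longrightarrow> integrable \<L> (\<lambda>x. cmod (u x) powr m)"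
    and le: "\<And>u M. u \<in> W \<Longrightarrow> modular u \<le> M \<Longrightarrow> (\<integral>x. cmod (u x) powr m \<partial>\<L>) \<le> C M"
    by (rule higher_integrability) blast
  define V where "V = (\<integral>x. (1 :: real) \<partial>\<L>)"
  show thesis
  proof
    show "0 \<le> V + C M" using C[of M] by (simp add: V_def)
    fix u assume u: "u \<in> W" "modular u \<le> M"
    have "(\<integral>x. cmod (u x) powr (p + 1) \<partial>\<L>) \<le> (\<integral>x. 1 + cmod (u x) powr m \<partial>\<L>)"
      using int[OF u(1)] integrable_one_domain m p_pos
      by (intro integral_mono integrable_powr[OF u(1)] Bochner_Integration.integrable_add powr_le_one_plus_powr) auto
    also have "\<dots> = V + (\<integral>x. cmod (u x) powr m \<partial>\<L>)"
      unfolding V_def by (rule Bochner_Integration.integral_add[OF integrable_one_domain int[OF u(1)]])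
    also have "\<dots> \<le> V + C M" using le[OF u] by simp
    finally show "(\<integral>x. cmod (u x) powr (p + 1) \<partial>\<L>) \<le> V + C M" .
  qed
qed

text \<open>The threshold in \<open>powr_interpolation\<close> is chosen first, so that the higher power contributes at most
\<open>\<epsilon>/2\<close>. It is bounded uniformly because the modulars of the differences are.\<close>

lemma power_Cauchy_of_L1_Cauchy:
  assumes w: "\<And>k. w k \<in> W" and M: "\<And>k. modular (w k) \<le> M"
    and int: "\<And>k. integrable \<L> (w k)"
    and L1: "\<And>\<epsilon>. 0 < \<epsilon> \<Longrightarrow> \<exists>n. \<forall>j\<ge>n. \<forall>k\<ge>n. (\<integral>x. cmod (w j x - w k x) \<partial>\<L>) \<le> \<epsilon>"
    and "0 < \<epsilon>"
  shows "\<exists>n::nat. \<forall>j\<ge>n. \<forall>k\<ge>n. (\<integral>x. cmod (w j x - w k x) powr (p + 1) \<partial>\<L>) \<le> \<epsilon>"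
proof -
  obtain m C where m: "p + 1 < m" and C: "\<And>M. 0 \<le> C M"
    and mint: "\<And>u. u \<in> W \<Longrightarrow> integrable \<L> (\<lambda>x. cmod (u x) powr m)"
    and le: "\<And>u M. u \<in> W \<Longrightarrow> modular u \<le> M \<Longrightarrow> (\<integral>x. cmod (u x) powr m \<partial>\<L>) \<le> C M"
    by (rule higher_integrability) blast
  define B where "B = C (doubling * (M + M))"
  have "((\<lambda>l::real. l powr (p + 1 - m) * B) \<longlongrightarrow> 0) at_top"
    using m by (intro tendsto_mult_left_zero tendsto_neg_powr filterlim_ident) auto
  then have "\<forall>\<^sub>F l in at_top. l powr (p + 1 - m) * B < \<epsilon> / 2"
    using \<open>0 < \<epsilon>\<close> by (intro order_tendstoD(2)) auto
  then have "\<forall>\<^sub>F l in at_top. 0 < l \<and> l powr (p + 1 - m) * B < \<epsilon> / 2"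
    using eventually_gt_at_top[of 0] by eventually_elim auto
  then obtain l where l: "0 < l" "l powr (p + 1 - m) * B < \<epsilon> / 2"
    unfolding eventually_at_top_linorder by blast
  obtain n where n: "\<And>j k. n \<le> j \<Longrightarrow> n \<le> k \<Longrightarrow> (\<integral>x. cmod (w j x - w k x) \<partial>\<L>) \<le> \<epsilon> / (2 * l powr p)"
    using L1[of "\<epsilon> / (2 * l powr p)"] \<open>0 < \<epsilon>\<close> l(1) by auto
  have "(\<integral>x. cmod (w j x - w k x) powr (p + 1) \<partial>\<L>) \<le> \<epsilon>" if jk: "n \<le> j" "n \<le> k" for j k
  proof -
    let ?v = "\<lambda>x. w j x - w k x"
    have v: "?v \<in> W" by (rule W_diff[OF w w])
    have vint: "integrable \<L> (\<lambda>x. cmod (?v x))" using int by auto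
    have "modular ?v \<le> doubling * (M + M)"
      using doubling_ge_1 M by (intro order_trans[OF modular_diff_le[OF w w]] mult_left_mono add_mono) auto
    then have B: "(\<integral>x. cmod (?v x) powr m \<partial>\<L>) \<le> B" unfolding B_def by (rule le[OF v])
    have "(\<integral>x. cmod (?v x) powr (p + 1) \<partial>\<L>) \<le> (\<integral>x. l powr p * cmod (?v x) + l powr (p + 1 - m) * cmod (?v x) powr m \<partial>\<L>)"
      using vint mint[OF v] m l(1) p_pos
      by (intro integral_mono integrable_powr[OF v] Bochner_Integration.integrable_add integrable_mult_right powr_interpolation) auto
    also have "\<dots> = l powr p * (\<integral>x. cmod (?v x) \<partial>\<L>) + l powr (p + 1 - m) * (\<integral>x. cmod (?v x) powr m \<partial>\<L>)"
      using vint mint[OF v] by simp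
    also have "\<dots> \<le> l powr p * (\<epsilon> / (2 * l powr p)) + l powr (p + 1 - m) * B"
      by (intro add_mono mult_left_mono n jk B) auto
    also have "\<dots> \<le> \<epsilon>" using l by simp
    finally show ?thesis .
  qed
  then show ?thesis by blast
qed

text \<open>In \<open>modular_diff_le_residual\<close> the residuals vanish because the \<open>H\<^sub>0\<^sup>s\<close> norms of the differences are
bounded. The weighted Young inequality splits each source term into a small multiple of a
bounded integral and a large multiple of one that tends to 0.\<close>

lemma modular_Cauchy:
  assumes w: "\<And>k. w k \<in> W" and M: "\<And>k. modular (w k) \<le> M"
    and K: "\<And>k. (norm_s2 \<Omega> s (w k))\<^sup>2 \<le> K"
    and residual: "\<And>k \<phi>. \<phi> \<in> W \<Longrightarrow> \<bar>energy_deriv \<Omega> A s g p (w k) \<phi>\<bar> \<le> \<delta> k * (1 + (norm_s2 \<Omega> s \<phi>)\<^sup>2)"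
    and \<delta>: "\<delta> \<longlonglongrightarrow> 0" "\<And>k. 0 \<le> \<delta> k"
    and power: "\<And>\<epsilon>. 0 < \<epsilon> \<Longrightarrow> \<exists>n. \<forall>j\<ge>n. \<forall>k\<ge>n. (\<integral>x. cmod (w j x - w k x) powr (p + 1) \<partial>\<L>) \<le> \<epsilon>"
    and "0 < \<epsilon>"
  shows "\<exists>n::nat. \<forall>j\<ge>n. \<forall>k\<ge>n. modular (\<lambda>x. w j x - w k x) \<le> \<epsilon>"
proof -
  obtain P where P: "0 \<le> P" "\<And>u. u \<in> W \<Longrightarrow> modular u \<le> M \<Longrightarrow> (\<integral>x. cmod (u x) powr (p + 1) \<partial>\<L>) \<le> P"
    using power_integral_bounded[of M] by metis
  have d: "0 < doubling" using doubling_ge_1 by simp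
  have K0: "0 \<le> K" using order_trans[OF zero_le_power2 K] .
  \<comment> \<open>Each of the two residuals contributes \<open>e\<close>, each of the two source terms \<open>2 e\<close>.\<close>
  define e where "e = \<epsilon> / (6 * doubling)"
  have e: "0 < e" using \<open>0 < \<epsilon>\<close> d by (simp add: e_def)
  define \<eta> where "\<eta> = e / (P + 1)"
  have \<eta>: "0 < \<eta>" "\<eta> * P \<le> e" using e P(1) by (auto simp: \<eta>_def field_simps)
  obtain n1 where n1: "\<And>j k. n1 \<le> j \<Longrightarrow> n1 \<le> k \<Longrightarrow> (\<integral>x. cmod (w j x - w k x) powr (p + 1) \<partial>\<L>) \<le> e / \<eta> powr (-p)"
    using power[of "e / \<eta> powr (-p)"] e \<eta> by auto
  have "\<forall>\<^sub>F k in sequentially. \<delta> k < e / (1 + 4 * K)"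
    using e K0 by (intro order_tendstoD(2)[OF \<delta>(1)]) auto
  then obtain n2 where n2: "\<And>k. n2 \<le> k \<Longrightarrow> \<delta> k < e / (1 + 4 * K)" by (auto simp: eventually_sequentially)
  have "modular (\<lambda>x. w j x - w k x) \<le> \<epsilon>" if "n1 + n2 \<le> j" "n1 + n2 \<le> k" for j k
  proof -
    let ?v = "\<lambda>x. w j x - w k x"
    have v: "?v \<in> W" by (rule W_diff[OF w w])
    have "(norm_s2 \<Omega> s ?v)\<^sup>2 \<le> 4 * K"
      using norm_s2_diff_squared_le[OF w w, of j k] K[of j] K[of k] by linarith
    then have res: "\<bar>energy_deriv \<Omega> A s g p (w i) ?v\<bar> \<le> e" if "n2 \<le> i" for i
    proof -
      have "\<bar>energy_deriv \<Omega> A s g p (w i) ?v\<bar> \<le> \<delta> i * (1 + (norm_s2 \<Omega> s ?v)\<^sup>2)" by (rule residual[OF v])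
      also have "\<dots> \<le> e / (1 + 4 * K) * (1 + 4 * K)"
        using n2[OF that] \<delta>(2)[of i] \<open>(norm_s2 \<Omega> s ?v)\<^sup>2 \<le> 4 * K\<close> e K0
        by (intro mult_mono) auto
      also have "\<dots> = e" using K0 by simp
      finally show ?thesis .
    qed
    have src: "(\<integral>x. cmod (w i x) powr p * cmod (?v x) \<partial>\<L>) \<le> 2 * e" for i
    proof -
      have "(\<integral>x. cmod (w i x) powr p * cmod (?v x) \<partial>\<L>)
          \<le> (\<integral>x. \<eta> * cmod (w i x) powr (p + 1) + \<eta> powr (- p) * cmod (?v x) powr (p + 1) \<partial>\<L>)"
        using integrable_powr[OF w[of i]] integrable_powr[OF v] p_pos \<eta>(1)
        by (intro integral_mono integrable_powr_mult[OF w v] Bochner_Integration.integrable_add integrable_mult_right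
            powr_mult_le_weighted) auto
      also have "\<dots> = \<eta> * (\<integral>x. cmod (w i x) powr (p + 1) \<partial>\<L>) + \<eta> powr (- p) * (\<integral>x. cmod (?v x) powr (p + 1) \<partial>\<L>)"
        using integrable_powr[OF w[of i]] integrable_powr[OF v] by simp
      also have "\<dots> \<le> \<eta> * P + \<eta> powr (- p) * (e / \<eta> powr (-p))"
        using \<eta>(1) n1[of j k] that by (intro add_mono mult_left_mono P(2) w M) auto
      also have "\<dots> \<le> 2 * e" using \<eta> by simp
      finally show ?thesis .
    qed
    have "modular ?v \<le> doubling * (\<bar>energy_deriv \<Omega> A s g p (w j) ?v\<bar> + \<bar>energy_deriv \<Omega> A s g p (w k) ?v\<bar>
        + ((\<integral>x. cmod (w j x) powr p * cmod (?v x) \<partial>\<L>) + (\<integral>x. cmod (w k x) powr p * cmod (?v x) \<partial>\<L>)))"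
      by (rule modular_diff_le_residual[OF w w])
    also have "\<dots> \<le> doubling * ((e + e) + (2 * e + 2 * e))"
      using d that by (intro mult_left_mono add_mono res src) auto
    also have "\<dots> = \<epsilon>" using d by (simp add: e_def field_simps)
    finally show ?thesis .
  qed
  then show ?thesis by blast
qed

text \<open>Both modulars of the limit are bounded by Fatou's lemma. For the one without difference quotients
the bound is uniform because \<open>G\<close> grows at most like the power \<open>p + 1\<close>.\<close>

lemma limit_in_W:
  assumes w: "\<And>k. w k \<in> W" and M: "\<And>k. modular (w k) \<le> M"
    and \<psi>: "\<psi> \<in> borel_measurable lebesgue" "vanishes_outside \<Omega> \<psi>"
    and lim: "AE x in lebesgue. (\<lambda>k. w k x) \<longlonglongrightarrow> \<psi> x"
  shows "\<psi> \<in> W"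
proof (rule in_W_intro[OF \<psi>])
  obtain P where P: "0 \<le> P" "\<And>u. u \<in> W \<Longrightarrow> modular u \<le> M \<Longrightarrow> (\<integral>x. cmod (u x) powr (p + 1) \<partial>\<L>) \<le> P"
    using power_integral_bounded[of M] by metis
  have G_lim: "(\<lambda>k. ennreal (G (cmod (a k)))) \<longlonglongrightarrow> ennreal (G (cmod b))" if "a \<longlonglongrightarrow> b" for a :: "nat \<Rightarrow> complex" and b
    using that by (intro tendsto_ennrealI continuous_on_tendsto_compose[of UNIV "\<lambda>z. G (cmod z)"] continuous_on_G_norm) auto
  have "(\<integral>\<^sup>+z. ennreal (G (cmod (D \<psi> z))) \<partial>\<mu>) \<le> ennreal M"
  proof (rule nn_integral_le_of_AE_limit)
    show "AE z in \<mu>. (\<lambda>k. ennreal (G (cmod (D (w k) z)))) \<longlonglongrightarrow> ennreal (G (cmod (D \<psi> z)))"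
      using AE_pair_measure_on_both[OF open_domain lim]
      by eventually_elim (intro G_lim DsA_tendsto, auto)
    show "(\<lambda>z. ennreal (G (cmod (D (w k) z)))) \<in> borel_measurable \<mu>" for k
      using W_measurable_DsA[OF w[of k]] by measurable
    show "(\<integral>\<^sup>+z. ennreal (G (cmod (D (w k) z))) \<partial>\<mu>) \<le> ennreal M" for k
      using M[of k] by (simp add: nn_modular[OF w] ennreal_leI)
  qed
  then show "integrable \<mu> (\<lambda>z. G (cmod (D \<psi> z)))"
    by (subst integrable_G_iff[OF measurable_DsA[OF \<psi>(1) continuous_potential]]) (auto intro: le_less_trans)
  define V where "V = (\<integral>x. (1 :: real) \<partial>\<L>)"
  have "(\<integral>\<^sup>+x. ennreal (G (cmod (\<psi> x))) \<partial>\<L>) \<le> ennreal (V + P)"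
  proof (rule nn_integral_le_of_AE_limit)
    have "AE x in \<L>. (\<lambda>k. w k x) \<longlonglongrightarrow> \<psi> x"
      using lim open_domain by (subst AE_restrict_space_iff) auto
    then show "AE x in \<L>. (\<lambda>k. ennreal (G (cmod (w k x)))) \<longlonglongrightarrow> ennreal (G (cmod (\<psi> x)))"
      by eventually_elim (rule G_lim)
    show "(\<lambda>x. ennreal (G (cmod (w k x)))) \<in> borel_measurable \<L>" for k
      using W_measurable_on[OF w[of k]] by measurable
    show "(\<integral>\<^sup>+x. ennreal (G (cmod (w k x))) \<partial>\<L>) \<le> ennreal (V + P)" for k
    proof -
      have "(\<integral>x. G (cmod (w k x)) \<partial>\<L>) \<le> (\<integral>x. 1 + cmod (w k x) powr (p + 1) \<partial>\<L>)"
        using integrable_one_domain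
        by (intro integral_mono W_integrable_G[OF w] Bochner_Integration.integrable_add integrable_powr[OF w] G_le_powr) auto
      also have "\<dots> = V + (\<integral>x. cmod (w k x) powr (p + 1) \<partial>\<L>)"
        unfolding V_def by (rule Bochner_Integration.integral_add[OF integrable_one_domain integrable_powr[OF w]])
      also have "\<dots> \<le> V + P" using P(2)[OF w M] by simp
      finally show ?thesis using nn_integral_G[OF W_integrable_G[OF w[of k]]] by (simp add: ennreal_leI)
    qed
  qed
  then show "integrable \<L> (\<lambda>x. G (cmod (\<psi> x)))"
    by (subst integrable_G_iff[OF measurable_lebesgue_on[OF \<psi>(1)]]) (auto intro: le_less_trans)
qed

text \<open>For fixed \<open>j\<close>, Fatou's lemma lets \<open>k\<close> tend to infinity in
the Cauchy estimate for \<open>w j - w k\<close>.\<close>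

lemma modular_convergence_of_Cauchy:
  assumes w: "\<And>k. w k \<in> W" and \<psi>: "\<psi> \<in> W"
    and lim: "AE x in lebesgue. (\<lambda>k. w k x) \<longlonglongrightarrow> \<psi> x"
    and Cauchy: "\<And>\<epsilon>. 0 < \<epsilon> \<Longrightarrow> \<exists>n. \<forall>j\<ge>n. \<forall>k\<ge>n. modular (\<lambda>x. w j x - w k x) \<le> \<epsilon>"
  shows "(\<lambda>k. modular (\<lambda>x. w k x - \<psi> x)) \<longlonglongrightarrow> 0"
proof (rule LIMSEQ_I)
  fix \<epsilon> :: real assume "0 < \<epsilon>"
  then obtain n where n: "\<And>j k. n \<le> j \<Longrightarrow> n \<le> k \<Longrightarrow> modular (\<lambda>x. w j x - w k x) \<le> \<epsilon> / 2"
    using Cauchy[of "\<epsilon> / 2"] by auto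
  have "modular (\<lambda>x. w j x - \<psi> x) \<le> \<epsilon> / 2" if "n \<le> j" for j
  proof -
    have "(\<integral>\<^sup>+z. ennreal (G (cmod (D (\<lambda>x. w j x - \<psi> x) z))) \<partial>\<mu>) \<le> ennreal (\<epsilon> / 2)"
    proof (rule nn_integral_le_of_AE_limit)
      show "AE z in \<mu>. (\<lambda>k. ennreal (G (cmod (D (\<lambda>x. w j x - w k x) z)))) \<longlonglongrightarrow> ennreal (G (cmod (D (\<lambda>x. w j x - \<psi> x) z)))"
        using AE_pair_measure_on_both[OF open_domain lim]
      proof eventually_elim
        case (elim z)
        then have "(\<lambda>k. D (\<lambda>x. w j x - w k x) z) \<longlonglongrightarrow> D (\<lambda>x. w j x - \<psi> x) z"
          by (intro DsA_tendsto tendsto_intros) auto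
        then show ?case
          by (intro tendsto_ennrealI continuous_on_tendsto_compose[of UNIV "\<lambda>z. G (cmod z)"] continuous_on_G_norm) auto
      qed
      show "(\<lambda>z. ennreal (G (cmod (D (\<lambda>x. w j x - w k x) z)))) \<in> borel_measurable \<mu>" for k
        using W_measurable_DsA[OF W_diff[OF w[of j] w[of k]]] by measurable
      show "(\<integral>\<^sup>+z. ennreal (G (cmod (D (\<lambda>x. w j x - w k x) z))) \<partial>\<mu>) \<le> ennreal (\<epsilon> / 2)" if "n \<le> k" for k
        using n[OF \<open>n \<le> j\<close> that] by (simp add: nn_modular[OF W_diff[OF w w]] ennreal_leI)
    qed
    then show ?thesis using nn_modular[OF W_diff[OF w[of j] \<psi>]] \<open>0 < \<epsilon>\<close> by simp
  qed
  then show "\<exists>n. \<forall>k\<ge>n. norm (modular (\<lambda>x. w k x - \<psi> x) - 0) < \<epsilon>"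
    using \<open>0 < \<epsilon>\<close> by (intro exI[of _ n] allI impI) (fastforce simp: modular_nonneg)
qed

lemma power_convergence_of_Cauchy:
  assumes w: "\<And>k. w k \<in> W" and \<psi>: "\<psi> \<in> W"
    and lim: "AE x in lebesgue. (\<lambda>k. w k x) \<longlonglongrightarrow> \<psi> x"
    and Cauchy: "\<And>\<epsilon>. 0 < \<epsilon> \<Longrightarrow> \<exists>n. \<forall>j\<ge>n. \<forall>k\<ge>n. (\<integral>x. cmod (w j x - w k x) powr (p + 1) \<partial>\<L>) \<le> \<epsilon>"
  shows "(\<lambda>k. \<integral>x. cmod (w k x - \<psi> x) powr (p + 1) \<partial>\<L>) \<longlonglongrightarrow> 0"
proof (rule LIMSEQ_I)
  fix \<epsilon> :: real assume "0 < \<epsilon>"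
  then obtain n where n: "\<And>j k. n \<le> j \<Longrightarrow> n \<le> k \<Longrightarrow> (\<integral>x. cmod (w j x - w k x) powr (p + 1) \<partial>\<L>) \<le> \<epsilon> / 2"
    using Cauchy[of "\<epsilon> / 2"] by auto
  have "(\<integral>x. cmod (w j x - \<psi> x) powr (p + 1) \<partial>\<L>) \<le> \<epsilon> / 2" if "n \<le> j" for j
  proof -
    have "(\<integral>\<^sup>+x. ennreal (cmod (w j x - \<psi> x) powr (p + 1)) \<partial>\<L>) \<le> ennreal (\<epsilon> / 2)"
    proof (rule nn_integral_le_of_AE_limit)
      have "AE x in \<L>. (\<lambda>k. w k x) \<longlonglongrightarrow> \<psi> x"
        using lim open_domain by (subst AE_restrict_space_iff) auto
      then show "AE x in \<L>. (\<lambda>k. ennreal (cmod (w j x - w k x) powr (p + 1))) \<longlonglongrightarrow> ennreal (cmod (w j x - \<psi> x) powr (p + 1))"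
      proof eventually_elim
        case (elim x)
        show ?case
        proof (intro tendsto_ennrealI)
          have "(\<lambda>k. cmod (w j x - w k x)) \<longlonglongrightarrow> cmod (w j x - \<psi> x)"
            using elim by (intro tendsto_intros)
          then show "(\<lambda>k. cmod (w j x - w k x) powr (p + 1)) \<longlonglongrightarrow> cmod (w j x - \<psi> x) powr (p + 1)"
            using p_pos by (intro tendsto_powr' tendsto_const) auto
        qed
      qed
      show "(\<lambda>x. ennreal (cmod (w j x - w k x) powr (p + 1))) \<in> borel_measurable \<L>" for k
        using W_measurable_on[OF W_diff[OF w[of j] w[of k]]] by measurable
      show "(\<integral>\<^sup>+x. ennreal (cmod (w j x - w k x) powr (p + 1)) \<partial>\<L>) \<le> ennreal (\<epsilon> / 2)" if "n \<le> k" for k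
        using n[OF \<open>n \<le> j\<close> that] nn_integral_eq_integral[OF integrable_powr[OF W_diff[OF w[of j] w[of k]]]]
        by (simp add: ennreal_leI)
    qed
    then show ?thesis
      using nn_integral_eq_integral[OF integrable_powr[OF W_diff[OF w[of j] \<psi>]]] \<open>0 < \<epsilon>\<close> by simp
  qed
  then show "\<exists>n. \<forall>k\<ge>n. norm ((\<integral>x. cmod (w k x - \<psi> x) powr (p + 1) \<partial>\<L>) - 0) < \<epsilon>"
    using \<open>0 < \<epsilon>\<close> by (intro exI[of _ n] allI impI) fastforce
qed

text \<open>The integrands converge almost everywhere. By Young's inequality and the doubling property they are
dominated by a fixed integrable function plus a multiple of \<open>G(\<bar>D(w k - \<psi>)\<bar>)\<close> or
\<open>\<bar>w k - \<psi>\<bar>\<^bsup>p+1\<^esup>\<close>, whose integrals tend to 0.\<close>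

lemma energy_deriv_tendsto:
  assumes w: "\<And>k. w k \<in> W" and \<psi>: "\<psi> \<in> W" and \<phi>: "\<phi> \<in> W"
    and lim: "AE x in lebesgue. (\<lambda>k. w k x) \<longlonglongrightarrow> \<psi> x"
    and modular: "(\<lambda>k. modular (\<lambda>x. w k x - \<psi> x)) \<longlonglongrightarrow> 0"
    and power: "(\<lambda>k. \<integral>x. cmod (w k x - \<psi> x) powr (p + 1) \<partial>\<L>) \<longlonglongrightarrow> 0"
  shows "(\<lambda>k. energy_deriv \<Omega> A s g p (w k) \<phi>) \<longlonglongrightarrow> energy_deriv \<Omega> A s g p \<psi> \<phi>"
proof -
  note wd = W_diff[OF w \<psi>]
  have d: "0 \<le> doubling" using doubling_ge_1 by simp
  have "(\<lambda>k. \<integral>z. flux g (D (w k) z) * cnj (D \<phi> z) \<partial>\<mu>) \<longlonglongrightarrow> (\<integral>z. flux g (D \<psi> z) * cnj (D \<phi> z) \<partial>\<mu>)"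
  proof (rule tendsto_integral_dominated_by_vanishing[where
        h = "\<lambda>k z. p * doubling * G (cmod (D (\<lambda>x. w k x - \<psi> x) z))" and
        H = "\<lambda>z. G (cmod (D \<phi> z)) + p * doubling * G (cmod (D \<psi> z))"])
    show "AE z in \<mu>. (\<lambda>k. flux g (D (w k) z) * cnj (D \<phi> z)) \<longlonglongrightarrow> flux g (D \<psi> z) * cnj (D \<phi> z)"
      using AE_pair_measure_on_both[OF open_domain lim]
    proof eventually_elim
      case (elim z)
      then have "(\<lambda>k. D (w k) z) \<longlonglongrightarrow> D \<psi> z" by (intro DsA_tendsto) auto
      then show ?case by (intro tendsto_mult tendsto_const isCont_tendsto_compose[OF isCont_flux])
    qed
    show "norm (flux g (D (w k) z) * cnj (D \<phi> z)) \<le> G (cmod (D \<phi> z)) + p * doubling * G (cmod (D \<psi> z))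
        + p * doubling * G (cmod (D (\<lambda>x. w k x - \<psi> x) z))" for k z
    proof -
      have "G (cmod (D (w k) z)) \<le> doubling * (G (cmod (D (\<lambda>x. w k x - \<psi> x) z)) + G (cmod (D \<psi> z)))"
        using G_norm_add[of "D (\<lambda>x. w k x - \<psi> x) z" "D \<psi> z"] by (simp add: DsA_diff)
      then have "p * G (cmod (D (w k) z)) \<le> p * (doubling * (G (cmod (D (\<lambda>x. w k x - \<psi> x) z)) + G (cmod (D \<psi> z))))"
        using p_pos by (intro mult_left_mono) auto
      then show ?thesis using norm_flux_mult_le[of "D (w k) z" "D \<phi> z"] by (simp add: algebra_simps)
    qed
    show "(\<lambda>k. \<integral>z. p * doubling * G (cmod (D (\<lambda>x. w k x - \<psi> x) z)) \<partial>\<mu>) \<longlonglongrightarrow> 0"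
      using tendsto_mult_right_zero[OF modular, of "p * doubling"] by (simp add: modular_def)
  qed (use integrable_flux_W[OF w \<phi>] integrable_flux_W[OF \<psi> \<phi>] W_integrable_modular[OF wd] W_integrable_modular[OF \<phi>] W_integrable_modular[OF \<psi>] p_pos d in auto)
  moreover have "(\<lambda>k. \<integral>x. source p (w k x) * cnj (\<phi> x) \<partial>\<L>) \<longlonglongrightarrow> (\<integral>x. source p (\<psi> x) * cnj (\<phi> x) \<partial>\<L>)"
  proof (rule tendsto_integral_dominated_by_vanishing[where
        h = "\<lambda>k x. 2 powr (p + 1) * cmod (w k x - \<psi> x) powr (p + 1)" and
        H = "\<lambda>x. cmod (\<phi> x) powr (p + 1) + 2 powr (p + 1) * cmod (\<psi> x) powr (p + 1)"])
    have "AE x in \<L>. (\<lambda>k. w k x) \<longlonglongrightarrow> \<psi> x"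
      using lim open_domain by (subst AE_restrict_space_iff) auto
    then show "AE x in \<L>. (\<lambda>k. source p (w k x) * cnj (\<phi> x)) \<longlonglongrightarrow> source p (\<psi> x) * cnj (\<phi> x)"
      by eventually_elim (intro tendsto_mult tendsto_const isCont_tendsto_compose[OF isCont_source[OF p_pos]])
    show "norm (source p (w k x) * cnj (\<phi> x)) \<le> cmod (\<phi> x) powr (p + 1) + 2 powr (p + 1) * cmod (\<psi> x) powr (p + 1)
        + 2 powr (p + 1) * cmod (w k x - \<psi> x) powr (p + 1)" for k x
      using powr_mult_le_weighted[of "cmod (w k x)" "cmod (\<phi> x)" p 1] p_pos
        norm_powr_add_le[of "p + 1" "w k x - \<psi> x" "\<psi> x"]
      by (simp add: norm_mult norm_source distrib_left)
    show "(\<lambda>k. \<integral>x. 2 powr (p + 1) * cmod (w k x - \<psi> x) powr (p + 1) \<partial>\<L>) \<longlonglongrightarrow> 0"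
      using tendsto_mult_right_zero[OF power, of "2 powr (p + 1)"] by simp
  qed (use integrable_source_mult[OF w \<phi>] integrable_source_mult[OF \<psi> \<phi>] integrable_powr[OF wd]
        integrable_powr[OF \<phi>] integrable_powr[OF \<psi>] in auto)
  ultimately show ?thesis
    unfolding energy_deriv_eq by (intro tendsto_intros)
qed

text \<open>The first subsequence is Cauchy in \<open>L\<^sup>1\<close>, the second one converges almost everywhere. Outside the
domain all members vanish, so the pointwise limit exists almost everywhere in the whole space.\<close>

lemma palais_smale:
  fixes w :: "nat \<Rightarrow> real^'n \<Rightarrow> complex"
  assumes w: "\<And>k. w k \<in> W" and M: "\<And>k. modular (w k) \<le> M"
    and K: "\<And>k. (norm_s2 \<Omega> s (w k))\<^sup>2 \<le> K"
    and residual: "\<And>k \<phi>. \<phi> \<in> W \<Longrightarrow> \<bar>energy_deriv \<Omega> A s g p (w k) \<phi>\<bar> \<le> \<delta> k * (1 + (norm_s2 \<Omega> s \<phi>)\<^sup>2)"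
    and \<delta>: "\<delta> \<longlonglongrightarrow> 0" "\<And>k. 0 \<le> \<delta> k"
  obtains \<psi> and r :: "nat \<Rightarrow> nat" where "\<psi> \<in> stationary_solutions \<Omega> A s g p" "strict_mono r"
    "(\<lambda>k. seminorm_sGA \<Omega> A s g (\<lambda>x. w (r k) x - \<psi> x)) \<longlonglongrightarrow> 0"
proof -
  obtain r1 :: "nat \<Rightarrow> nat" where r1: "strict_mono r1" and int: "\<And>k. integrable \<L> (w k)"
    and L1: "\<And>\<epsilon>. 0 < \<epsilon> \<Longrightarrow> \<exists>n. \<forall>j\<ge>n. \<forall>k\<ge>n. (\<integral>x. cmod (w (r1 j) x - w (r1 k) x) \<partial>\<L>) \<le> \<epsilon>"
  proof (rule fractional_rellich[where u = w and K = K, OF open_domain bounded_domain s_pos W_measurable[OF w] W_vanishes[OF w]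
        order_trans[OF zero_le_power2 K] L2_gagliardo_le(1)[OF w K] L2_gagliardo_le(2)[OF w K]])
    fix r1 :: "nat \<Rightarrow> nat"
    assume "strict_mono r1" "\<And>k. integrable \<L> (w k)"
      "\<And>\<epsilon>. 0 < \<epsilon> \<Longrightarrow> \<exists>n. \<forall>j\<ge>n. \<forall>k\<ge>n. (\<integral>x. cmod (w (r1 j) x - w (r1 k) x) \<partial>\<L>) \<le> \<epsilon>"
    then show thesis by (rule that)
  qed
  obtain r2 :: "nat \<Rightarrow> nat" where r2: "strict_mono r2" and AE_Cauchy: "AE x in \<L>. Cauchy (\<lambda>k. w (r1 (r2 k)) x)"
  proof (rule cauchy_L1_AE_cauchy_subseq[of \<L> "\<lambda>k. w (r1 k)"])
    fix e :: real assume "0 < e"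
    then obtain n where "\<forall>j\<ge>n. \<forall>k\<ge>n. (\<integral>x. cmod (w (r1 j) x - w (r1 k) x) \<partial>\<L>) \<le> e / 2"
      using L1[of "e / 2"] by auto
    then show "\<exists>n. \<forall>j\<ge>n. \<forall>k\<ge>n. (\<integral>x. cmod (w (r1 j) x - w (r1 k) x) \<partial>\<L>) < e"
      using \<open>0 < e\<close> by (intro exI[of _ n]) fastforce
  qed (use int in auto)
  define r where "r k = r1 (r2 k)" for k
  define v where "v k = w (r k)" for k
  have r: "strict_mono r" unfolding r_def using strict_mono_o[OF r1 r2] by (simp add: o_def)
  have v: "v k \<in> W" and vM: "modular (v k) \<le> M" and vK: "(norm_s2 \<Omega> s (v k))\<^sup>2 \<le> K" and vint: "integrable \<L> (v k)" for k
    using w M K int by (auto simp: v_def)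
  have vL1: "\<exists>n. \<forall>j\<ge>n. \<forall>k\<ge>n. (\<integral>x. cmod (v j x - v k x) \<partial>\<L>) \<le> \<epsilon>" if "0 < \<epsilon>" for \<epsilon>
  proof -
    obtain n where "\<And>j k. n \<le> j \<Longrightarrow> n \<le> k \<Longrightarrow> (\<integral>x. cmod (w (r1 j) x - w (r1 k) x) \<partial>\<L>) \<le> \<epsilon>"
      using L1[OF \<open>0 < \<epsilon>\<close>] by blast
    moreover have "n \<le> r2 k" if "n \<le> k" for k
      using seq_suble[OF r2, of k] that by simp
    ultimately show ?thesis
      unfolding v_def r_def by blast
  qed
  have v_power: "\<exists>n. \<forall>j\<ge>n. \<forall>k\<ge>n. (\<integral>x. cmod (v j x - v k x) powr (p + 1) \<partial>\<L>) \<le> \<epsilon>" if "0 < \<epsilon>" for \<epsilon>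
    by (rule power_Cauchy_of_L1_Cauchy[OF v vM vint vL1 that])
  have v_residual: "\<bar>energy_deriv \<Omega> A s g p (v k) \<phi>\<bar> \<le> \<delta> (r k) * (1 + (norm_s2 \<Omega> s \<phi>)\<^sup>2)" if "\<phi> \<in> W" for k \<phi>
    unfolding v_def by (rule residual[OF that])
  have \<delta>r: "(\<lambda>k. \<delta> (r k)) \<longlonglongrightarrow> 0"
    using LIMSEQ_subseq_LIMSEQ[OF \<delta>(1) r] by (simp add: o_def)
  have v_modular: "\<exists>n. \<forall>j\<ge>n. \<forall>k\<ge>n. modular (\<lambda>x. v j x - v k x) \<le> \<epsilon>" if "0 < \<epsilon>" for \<epsilon>
    by (rule modular_Cauchy[OF v vM vK v_residual \<delta>r \<delta>(2) v_power that])
  define \<psi> where "\<psi> x = lim (\<lambda>k. v k x)" for x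
  have vanish: "AE x in lebesgue. \<forall>k. x \<notin> \<Omega> \<longrightarrow> v k x = 0"
    using W_vanishes[OF v] by (subst AE_all_countable) (simp add: vanishes_outside_def)
  have lim: "AE x in lebesgue. (\<lambda>k. v k x) \<longlonglongrightarrow> \<psi> x"
  proof -
    have "AE x in lebesgue. x \<in> \<Omega> \<longrightarrow> Cauchy (\<lambda>k. v k x)"
      using AE_Cauchy open_domain by (subst (asm) AE_restrict_space_iff) (auto simp: v_def r_def)
    with vanish show ?thesis
    proof eventually_elim
      case (elim x)
      then have "convergent (\<lambda>k. v k x)"
        by (cases "x \<in> \<Omega>") (auto simp: Cauchy_convergent_iff convergent_const)
      then show ?case by (simp add: \<psi>_def convergent_LIMSEQ_iff)
    qed
  qed
  have "\<psi> \<in> borel_measurable lebesgue"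
    unfolding \<psi>_def using W_measurable[OF v] by (rule borel_measurable_lim_metric)
  moreover have "vanishes_outside \<Omega> \<psi>"
  proof -
    from vanish show ?thesis unfolding vanishes_outside_def
      by eventually_elim (simp add: \<psi>_def)
  qed
  ultimately have \<psi>: "\<psi> \<in> W" using limit_in_W[OF v vM _ _ lim] by blast
  have conv: "(\<lambda>k. modular (\<lambda>x. v k x - \<psi> x)) \<longlonglongrightarrow> 0"
    by (rule modular_convergence_of_Cauchy[OF v \<psi> lim v_modular])
  have "energy_deriv \<Omega> A s g p \<psi> \<phi> = 0" if \<phi>: "\<phi> \<in> W" for \<phi>
  proof (rule LIMSEQ_unique)
    show "(\<lambda>k. energy_deriv \<Omega> A s g p (v k) \<phi>) \<longlonglongrightarrow> energy_deriv \<Omega> A s g p \<psi> \<phi>"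
      by (rule energy_deriv_tendsto[OF v \<psi> \<phi> lim conv power_convergence_of_Cauchy[OF v \<psi> lim v_power]])
    show "(\<lambda>k. energy_deriv \<Omega> A s g p (v k) \<phi>) \<longlonglongrightarrow> 0"
      by (rule Lim_null_comparison[OF _ tendsto_mult_left_zero[OF \<delta>r, of "1 + (norm_s2 \<Omega> s \<phi>)\<^sup>2"]]) (use v_residual[OF \<phi>] in auto)
  qed
  then have "\<psi> \<in> stationary_solutions \<Omega> A s g p" using \<psi> by (simp add: stationary_solutions_def)
  then show thesis
    using r seminorm_tendsto_0[OF W_diff[OF v \<psi>] conv] unfolding v_def by (rule that)
qed

end

section \<open>Global solutions\<close>

text \<open>The Cauchy-Schwarz inequality in additive form. The free weight makes it convenient when one factor
is known to be small and the other one is arbitrary.\<close>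

lemma norm_integral_mult_le_weighted:
  fixes f h :: "'a \<Rightarrow> complex"
  assumes [measurable]: "f \<in> borel_measurable M" "h \<in> borel_measurable M"
    and f: "(\<integral>\<^sup>+x. ennreal ((cmod (f x))\<^sup>2) \<partial>M) < \<infinity>" and h: "(\<integral>\<^sup>+x. ennreal ((cmod (h x))\<^sup>2) \<partial>M) < \<infinity>"
    and \<eta>: "0 < \<eta>"
  shows "cmod (\<integral>x. f x * cnj (h x) \<partial>M) \<le> (enn2real (\<integral>\<^sup>+x. ennreal ((cmod (f x))\<^sup>2) \<partial>M) / \<eta>
    + \<eta> * enn2real (\<integral>\<^sup>+x. ennreal ((cmod (h x))\<^sup>2) \<partial>M)) / 2"
proof -
  have fi: "integrable M (\<lambda>x. (cmod (f x))\<^sup>2)" and hi: "integrable M (\<lambda>x. (cmod (h x))\<^sup>2)"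
    using f h by (auto intro!: integrableI_bounded)
  have "cmod (\<integral>x. f x * cnj (h x) \<partial>M) \<le> (\<integral>x. ((cmod (f x))\<^sup>2 / \<eta> + \<eta> * (cmod (h x))\<^sup>2) / 2 \<partial>M)"
  proof (rule order_trans[OF integral_norm_bound integral_mono'])
    show "integrable M (\<lambda>x. ((cmod (f x))\<^sup>2 / \<eta> + \<eta> * (cmod (h x))\<^sup>2) / 2)" using fi hi by auto
    show "norm (f x * cnj (h x)) \<le> ((cmod (f x))\<^sup>2 / \<eta> + \<eta> * (cmod (h x))\<^sup>2) / 2" for x
    proof -
      have "0 \<le> (cmod (f x) - \<eta> * cmod (h x))\<^sup>2 / (2 * \<eta>)" using \<eta> by simp
      then show ?thesis using \<eta> by (simp add: norm_mult power2_eq_square field_simps)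
    qed
    show "0 \<le> ((cmod (f x))\<^sup>2 / \<eta> + \<eta> * (cmod (h x))\<^sup>2) / 2" for x using \<eta> by simp
  qed
  also have "\<dots> = ((\<integral>x. (cmod (f x))\<^sup>2 \<partial>M) / \<eta> + \<eta> * (\<integral>x. (cmod (h x))\<^sup>2 \<partial>M)) / 2"
    using fi hi by simp
  finally show ?thesis
    using nn_integral_eq_integral[OF fi] nn_integral_eq_integral[OF hi] by simp
qed

text \<open>Otherwise \<open>F\<^sup>2\<close> would be at least \<open>e\<^sup>2\<close> almost everywhere on a half-line, and its integral infinite.\<close>

lemma ex_late_good_time:
  fixes F :: "real \<Rightarrow> real"
  assumes fin: "(\<integral>\<^sup>+t\<in>{0<..}. ennreal ((F t)\<^sup>2) \<partial>lebesgue) < \<infinity>"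
    and good: "AE t in lebesgue_on {0<..}. good t" and "0 < e"
  shows "\<exists>t. b < t \<and> 0 < t \<and> good t \<and> F t < e"
proof (rule ccontr)
  assume "\<not> (\<exists>t. b < t \<and> 0 < t \<and> good t \<and> F t < e)"
  then have large: "e \<le> F t" if "max b 0 < t" "good t" for t
    using that by force
  have AE: "AE t in lebesgue. t \<in> {0<..} \<longrightarrow> good t"
    using good by (subst (asm) AE_restrict_space_iff) auto
  have "\<infinity> = ennreal (e\<^sup>2) * emeasure lebesgue {max b 0<..}"
  proof -
    have "of_nat n \<le> emeasure lebesgue {max b 0<..}" for n :: nat
    proof -
      have "of_nat n = emeasure lebesgue {max b 0<..max b 0 + real n}"
        by (simp add: ennreal_of_nat_eq_real_of_nat)
      also have "\<dots> \<le> emeasure lebesgue {max b 0<..}" by (intro emeasure_mono) auto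
      finally show ?thesis .
    qed
    then have "(SUP n::nat. of_nat n) \<le> emeasure lebesgue {max b 0<..}"
      by (intro SUP_least)
    then have "emeasure lebesgue {max b 0<..} = \<infinity>"
      by (simp add: ennreal_SUP_of_nat_eq_top top_unique)
    then show ?thesis using \<open>0 < e\<close> by (simp add: ennreal_mult_top)
  qed
  also have "\<dots> = (\<integral>\<^sup>+t. ennreal (e\<^sup>2) * indicator {max b 0<..} t \<partial>lebesgue)"
    by (simp add: nn_integral_cmult_indicator)
  also have "\<dots> \<le> (\<integral>\<^sup>+t\<in>{0<..}. ennreal ((F t)\<^sup>2) \<partial>lebesgue)"
  proof (rule nn_integral_mono_AE, use AE in eventually_elim)
    fix t assume "t \<in> {0<..} \<longrightarrow> good t"
    then show "ennreal (e\<^sup>2) * indicator {max b 0<..} t \<le> ennreal ((F t)\<^sup>2) * indicator {0<..} t"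
      using large[of t] \<open>0 < e\<close> by (auto intro!: ennreal_leI power_mono split: split_indicator)
  qed
  finally show False using fin by simp
qed

context nonlocal_problem
begin

lemma H_properties:
  assumes "f \<in> H0s_space \<Omega> s"
  shows "f \<in> borel_measurable lebesgue" "L2_sq \<Omega> f < \<infinity>" "gagliardo_sq \<Omega> s f < \<infinity>"
proof -
  have f: "f \<in> borel_measurable \<L>" "vanishes_outside \<Omega> f" "L2_sq \<Omega> f < \<infinity>" "gagliardo_sq \<Omega> s f < \<infinity>"
    using assms by (auto simp: H0s_space_def L2_space_def)
  show "f \<in> borel_measurable lebesgue" by (rule measurable_of_vanishing[OF f(1,2) open_domain])
  show "L2_sq \<Omega> f < \<infinity>" "gagliardo_sq \<Omega> s f < \<infinity>" by (fact f)+
qed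

lemma H_inner_le:
  assumes f: "f \<in> H0s_space \<Omega> s" and h: "h \<in> H0s_space \<Omega> s" and "0 < \<eta>"
  shows "cmod ((\<integral>x. f x * cnj (h x) \<partial>\<L>) + (\<integral>z. Ds s f z * cnj (Ds s h z) \<partial>\<mu>))
    \<le> ((norm_s2 \<Omega> s f)\<^sup>2 / \<eta> + \<eta> * (norm_s2 \<Omega> s h)\<^sup>2) / 2"
proof -
  note f = H_properties[OF f] and h = H_properties[OF h]
  have "cmod (\<integral>x. f x * cnj (h x) \<partial>\<L>) \<le> (enn2real (L2_sq \<Omega> f) / \<eta> + \<eta> * enn2real (L2_sq \<Omega> h)) / 2"
    using f h \<open>0 < \<eta>\<close> unfolding L2_sq_eq[OF open_domain]
    by (intro norm_integral_mult_le_weighted measurable_lebesgue_on)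
  moreover have "cmod (\<integral>z. Ds s f z * cnj (Ds s h z) \<partial>\<mu>)
      \<le> (enn2real (gagliardo_sq \<Omega> s f) / \<eta> + \<eta> * enn2real (gagliardo_sq \<Omega> s h)) / 2"
    using f h \<open>0 < \<eta>\<close> unfolding gagliardo_sq_eq[OF open_domain]
    by (intro norm_integral_mult_le_weighted measurable_Ds)
  ultimately show ?thesis
    using norm_triangle_ineq[of "\<integral>x. f x * cnj (h x) \<partial>\<L>" "\<integral>z. Ds s f z * cnj (Ds s h z) \<partial>\<mu>"]
    unfolding norm_s2_squared by (simp add: add_divide_distrib distrib_left)
qed

text \<open>At the selected times the residual equals, up to sign, the real part of the \<open>H\<^sub>0\<^sup>s\<close> inner product of
the time derivative with the test function. With the weight \<open>\<delta> k\<close>, which also bounds the norm of the time derivative,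
\<open>H_inner_le\<close> gives the residual bound that \<open>palais_smale\<close> requires.\<close>

lemma global_solution_converges_along_sequence:
  assumes sol: "global_weak_solution \<Omega> A s g p u0 u"
  shows "\<exists>u_star \<in> stationary_solutions \<Omega> A s g p. \<exists>t :: nat \<Rightarrow> real.
           strict_mono t \<and> (\<forall>k. 0 < t k) \<and> filterlim t at_top sequentially \<and>
           (\<lambda>k. seminorm_sGA \<Omega> A s g (\<lambda>x. u (t k) x - u_star x)) \<longlonglongrightarrow> 0"
proof -
  have WH: "W \<inter> H0s_space \<Omega> s = W" using W_subset_H by auto
  have times: "{t. 0 < t \<and> ereal t < \<infinity>} = {0<..}" by auto
  obtain C ut where uW: "\<forall>t\<in>{0<..}. u t \<in> W"
    and bound: "AE t in lebesgue_on {0<..}. norm_sGA \<Omega> A s g (u t) + norm_s2 \<Omega> s (u t) \<le> C"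
    and utH: "\<forall>t\<in>{0<..}. ut t \<in> H0s_space \<Omega> s"
    and ut_fin: "(\<integral>\<^sup>+t\<in>{0<..}. ennreal ((norm_s2 \<Omega> s (ut t))\<^sup>2) \<partial>lebesgue) < \<infinity>"
    and weak: "AE t in lebesgue_on {0<..}. \<forall>\<phi>\<in>W.
      Re ((LINT x:\<Omega>|lebesgue. ut t x * cnj (\<phi> x))
                + (LINT z:Q_set \<Omega>|frac_measure. Ds s (ut t) z * cnj (Ds s \<phi> z))
                + (LINT z:Q_set \<Omega>|frac_measure. flux g (D (u t) z) * cnj (D \<phi> z)))
            = Re (LINT x:\<Omega>|lebesgue. source p (u t x) * cnj (\<phi> x))"
    using sol unfolding global_weak_solution_def weak_solution_def Let_def WH times Linfty_in_def L2_in_def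
    by (elim conjE exE) (rule that; assumption)
  define good where "good t \<longleftrightarrow> norm_sGA \<Omega> A s g (u t) + norm_s2 \<Omega> s (u t) \<le> C \<and> (\<forall>\<phi>\<in>W.
      Re ((LINT x:\<Omega>|lebesgue. ut t x * cnj (\<phi> x))
                + (LINT z:Q_set \<Omega>|frac_measure. Ds s (ut t) z * cnj (Ds s \<phi> z))
                + (LINT z:Q_set \<Omega>|frac_measure. flux g (D (u t) z) * cnj (D \<phi> z)))
            = Re (LINT x:\<Omega>|lebesgue. source p (u t x) * cnj (\<phi> x)))" for t
  have good: "AE t in lebesgue_on {0<..}. good t"
    using bound weak unfolding good_def by eventually_elim auto
  define \<delta> where "\<delta> k = inverse (real (Suc k))" for k
  have \<delta>: "\<delta> \<longlonglongrightarrow> 0" "\<And>k. 0 < \<delta> k"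
    using LIMSEQ_inverse_real_of_nat by (auto simp: \<delta>_def[abs_def])
  have ex: "\<exists>t. b < t \<and> 0 < t \<and> good t \<and> norm_s2 \<Omega> s (ut t) < \<delta> k" for b k
    by (rule ex_late_good_time[OF ut_fin good \<delta>(2)])
  have "\<exists>\<tau>. \<forall>k. (real k < \<tau> k \<and> 0 < \<tau> k \<and> good (\<tau> k) \<and> norm_s2 \<Omega> s (ut (\<tau> k)) < \<delta> k) \<and> \<tau> k < \<tau> (Suc k)"
  proof (rule dependent_nat_choice)
    show "\<exists>t. real 0 < t \<and> 0 < t \<and> good t \<and> norm_s2 \<Omega> s (ut t) < \<delta> 0" using ex by blast
    show "\<exists>t'. (real (Suc k) < t' \<and> 0 < t' \<and> good t' \<and> norm_s2 \<Omega> s (ut t') < \<delta> (Suc k)) \<and> t < t'" for t k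
      using ex[of "max (real (Suc k)) t" "Suc k"] by auto
  qed
  then obtain \<tau> where \<tau>: "\<And>k. real k < \<tau> k" "\<And>k. 0 < \<tau> k" "\<And>k. good (\<tau> k)"
    "\<And>k. norm_s2 \<Omega> s (ut (\<tau> k)) < \<delta> k" "\<And>k. \<tau> k < \<tau> (Suc k)"
    by blast
  define w where "w k = u (\<tau> k)" for k
  have w: "w k \<in> W" for k unfolding w_def using uW \<tau>(2) by simp
  have norm_s2_nonneg: "0 \<le> norm_s2 \<Omega> s v" for v by (simp add: norm_s2_def)
  have bounds: "seminorm_sGA \<Omega> A s g (w k) < C + 1" "norm_s2 \<Omega> s (w k) \<le> C" for k
    using \<tau>(3)[of k] norm_G_nonneg[OF w[of k]] seminorm_nonneg[OF w[of k]] norm_s2_nonneg[of "w k"]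
    unfolding good_def norm_sGA_def w_def by linarith+
  have M: "modular (w k) \<le> max 1 (C + 1) powr (p + 1)" for k
    by (rule modular_le_of_seminorm_less[OF w bounds(1)])
  have K: "(norm_s2 \<Omega> s (w k))\<^sup>2 \<le> C\<^sup>2" for k
    using bounds(2) norm_s2_nonneg by (intro power_mono)
  have residual: "\<bar>energy_deriv \<Omega> A s g p (w k) \<phi>\<bar> \<le> \<delta> k * (1 + (norm_s2 \<Omega> s \<phi>)\<^sup>2)" if \<phi>: "\<phi> \<in> W" for k \<phi>
  proof -
    let ?v = "ut (\<tau> k)"
    have "energy_deriv \<Omega> A s g p (w k) \<phi> = - Re ((\<integral>x. ?v x * cnj (\<phi> x) \<partial>\<L>) + (\<integral>z. Ds s ?v z * cnj (Ds s \<phi> z) \<partial>\<mu>))"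
      using \<tau>(3)[of k] \<phi> unfolding good_def energy_deriv_eq w_def LINT_Q_eq[OF open_domain] LINT_Omega_eq[OF open_domain]
      by (auto dest!: bspec[OF _ \<phi>])
    then have "\<bar>energy_deriv \<Omega> A s g p (w k) \<phi>\<bar> \<le> cmod ((\<integral>x. ?v x * cnj (\<phi> x) \<partial>\<L>) + (\<integral>z. Ds s ?v z * cnj (Ds s \<phi> z) \<partial>\<mu>))"
      by (simp only: abs_minus_cancel abs_Re_le_cmod)
    also have "\<dots> \<le> ((norm_s2 \<Omega> s ?v)\<^sup>2 / \<delta> k + \<delta> k * (norm_s2 \<Omega> s \<phi>)\<^sup>2) / 2"
      using utH \<tau>(2)[of k] \<phi> W_subset_H by (intro H_inner_le \<delta>(2)) auto
    also have "\<dots> \<le> ((\<delta> k)\<^sup>2 / \<delta> k + \<delta> k * (norm_s2 \<Omega> s \<phi>)\<^sup>2) / 2"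
      using \<tau>(4)[of k] \<delta>(2)[of k] norm_s2_nonneg[of ?v]
      by (intro divide_right_mono add_right_mono power_mono) auto
    also have "\<dots> = \<delta> k * (1 + (norm_s2 \<Omega> s \<phi>)\<^sup>2) / 2"
      using \<delta>(2)[of k] by (simp add: power2_eq_square distrib_left)
    also have "\<dots> \<le> \<delta> k * (1 + (norm_s2 \<Omega> s \<phi>)\<^sup>2)"
      using \<delta>(2)[of k] by simp
    finally show ?thesis .
  qed
  obtain \<psi> and r :: "nat \<Rightarrow> nat" where \<psi>: "\<psi> \<in> stationary_solutions \<Omega> A s g p" and r: "strict_mono r"
    and conv: "(\<lambda>k. seminorm_sGA \<Omega> A s g (\<lambda>x. w (r k) x - \<psi> x)) \<longlonglongrightarrow> 0"
    by (rule palais_smale[OF w M K residual \<delta>(1) less_imp_le[OF \<delta>(2)]])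
  show ?thesis
  proof (intro bexI[OF _ \<psi>] exI[of _ "\<lambda>k. \<tau> (r k)"] conjI allI)
    have "strict_mono \<tau>" using \<tau>(5) by (simp add: strict_mono_Suc_iff)
    then show "strict_mono (\<lambda>k. \<tau> (r k))" using r by (simp add: strict_mono_def)
    show "0 < \<tau> (r k)" for k by (rule \<tau>(2))
    show "filterlim (\<lambda>k. \<tau> (r k)) at_top sequentially"
    proof (rule filterlim_at_top_mono[OF filterlim_real_sequentially])
      show "\<forall>\<^sub>F k in sequentially. real k \<le> \<tau> (r k)"
        using \<tau>(1) seq_suble[OF r] by (intro always_eventually allI) (meson less_imp_le of_nat_le_iff order_trans)
    qed
    show "(\<lambda>k. seminorm_sGA \<Omega> A s g (\<lambda>x. u (\<tau> (r k)) x - \<psi> x)) \<longlonglongrightarrow> 0"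
      using conv by (simp add: w_def)
  qed
qed

end

theorem theorem2p8:
  fixes \<Omega> :: "(real^'n) set"
    and A :: "real^'n \<Rightarrow> real^'n"
    and s p :: real
    and g :: "real \<Rightarrow> real"
    and u0 :: "real^'n \<Rightarrow> complex"
    and u :: "real \<Rightarrow> real^'n \<Rightarrow> complex"
  assumes "bounded_smooth_domain \<Omega>"
    and "smooth A"
    and "N_density g"
    and "N_fun g 1 = 1"
    and "\<forall>t>0. g differentiable (at t) \<and>
           q_minus g - 1 \<le> t * deriv g t / g t \<and> t * deriv g t / g t \<le> q_plus g - 1"
    and "0 < s" and "s < 1" and "1 < q_minus g" and "q_minus g \<le> q_plus g" and "q_plus g < p + 1"
    and "ereal (p + 1) < critical_exponent CARD('n) s (q_minus g)"
    and "\<forall>t>0. max (t * g t / N_fun g t - 1) 1 < p"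
    and "(\<integral>\<^sup>+t\<in>{0<..<1}. ennreal (N_fun_inv g t / t powr ((real CARD('n) + s) / real CARD('n)))
           \<partial>lborel) < \<infinity>"
    and "(\<integral>\<^sup>+t\<in>{1<..}. ennreal (N_fun_inv g t / t powr ((real CARD('n) + s) / real CARD('n)))
           \<partial>lborel) = \<infinity>"
    and "convex_on {0..} (\<lambda>t. N_fun g (sqrt t))"
    and "global_weak_solution \<Omega> A s g p u0 u"
    and "WA0_space \<Omega> A s g \<inter> H0s_space \<Omega> s = WA0_space \<Omega> A s g"
  shows "\<exists>u_star \<in> stationary_solutions \<Omega> A s g p. \<exists>t :: nat \<Rightarrow> real.
           strict_mono t \<and> (\<forall>k. 0 < t k) \<and> filterlim t at_top sequentially \<and>
           (\<lambda>k. seminorm_sGA \<Omega> A s g (\<lambda>x. u (t k) x - u_star x)) \<longlonglongrightarrow> 0"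
proof -
  have g_pos: "0 < g t" if "0 < t" for t
    using assms(3) that by (simp add: N_density_def)
  have integrable: "g integrable_on {0..t}" for t
    using assms(3) by (intro integrable_on_mono_on) (auto simp: N_density_def intro: mono_on_subset)
  have G_nonneg: "0 \<le> N_fun g t" if "0 < t" for t
    unfolding N_fun_def using g_pos assms(3) 
    by (intro integral_nonneg integrable) (auto simp: N_density_def le_less)
  have quotient: "q_minus g \<le> t * g t / N_fun g t" if "0 < t" for t
    unfolding q_minus_def
  proof (rule cINF_lower)
    show "bdd_below ((\<lambda>t. t * g t / N_fun g t) ` {0<..})"
      by (rule bdd_belowI[of _ 0]) (auto intro!: divide_nonneg_nonneg mult_nonneg_nonneg G_nonneg less_imp_le[OF g_pos])
  qed (use that in auto)
  \<comment> \<open>A zero of \<open>G\<close> would make the quotient 0, whereas its infimum exceeds 1.\<close>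
  have G_pos: "0 < N_fun g t" if "0 < t" for t
    using quotient[OF that] G_nonneg[OF that] assms(8) by (cases "N_fun g t = 0") auto
  interpret nonlocal_problem g "q_minus g" p \<Omega> A s
  proof
    show "N_density g" "N_fun g 1 = 1" "0 < s" "convex_on {0..} (\<lambda>t. N_fun g (sqrt t))"
      "ereal (p + 1) < critical_exponent CARD('n) s (q_minus g)"
      by (fact assms)+
    show "isCont g t" if "0 < t" for t
      using assms(5) that by (auto intro: differentiable_imp_continuous_within)
    show "q_minus g * N_fun g t \<le> t * g t" if "0 < t" for t
      using quotient[OF that] G_pos[OF that] by (simp add: field_simps)
    show "t * g t \<le> (p + 1) * N_fun g t" if "0 < t" for t
    proof -
      have "t * g t / N_fun g t \<le> p + 1" using assms(12) that by fastforce
      then show ?thesis using G_pos[OF that] by (simp add: field_simps)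
    qed
    show "0 < q_minus g" using assms(8) by simp
    show "0 < p" using assms(12)[rule_format, of 1] by simp
    show "open \<Omega>" "bounded \<Omega>" using assms(1) by (auto simp: bounded_smooth_domain_def)
    have "higher_differentiable 0 A" using assms(2) unfolding smooth_def by blast
    then show "continuous_on UNIV A" by simp
    show "WA0_space \<Omega> A s g \<subseteq> H0s_space \<Omega> s" using assms(17) by blast
  qed
  show ?thesis by (rule global_solution_converges_along_sequence[OF assms(16)])
qed

end
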